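(* There exists a group $G$ generated by a finite set $S$ such that: (i) $G$ has decidable Word Problem; (ii) $G$ has undecidable Conjugacy Problem; and (iii) the language $\mathrm{ConjGeo}(G,S)$ is an unambiguous context-free language.
   Context: For a group $G$ with finite generating set $S$, a word $w\in S^*$ is a conjugacy geodesic if its length equals $\min\{\|h\|_S : h \text{ conjugate in } G \text{ to the element } \bar w \text{ represented by } w\}$, where $\|h\|_S$ is the word length of $h$ with respect to $S$. $\mathrm{ConjGeo}(G,S)\subseteq S^*$ is the language of all conjugacy geodesics. *)

theory Defs
  imports "HOL-Algebra.Algebra" "HOL-Library.Nat_Bijection"
begin

datatype recf = Zero | Succ | Proj nat | Comp recf "recf list" | Prim recf recf | Mn recf

inductive eval :: "recf \<Rightarrow> nat list \<Rightarrow> nat \<Rightarrow> bool" where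
  eval_Zero: "eval Zero xs 0"
| eval_Succ: "eval Succ (x # xs) (Suc x)"
| eval_Proj: "i < length xs \<Longrightarrow> eval (Proj i) xs (xs ! i)"
| eval_Comp: "length ys = length gs \<Longrightarrow> (\<forall>i < length gs. eval (gs ! i) xs (ys ! i))
              \<Longrightarrow> eval f ys z \<Longrightarrow> eval (Comp f gs) xs z"
| eval_Prim0: "eval f xs z \<Longrightarrow> eval (Prim f g) (0 # xs) z"
| eval_PrimS: "eval (Prim f g) (n # xs) r \<Longrightarrow> eval g (n # r # xs) z
              \<Longrightarrow> eval (Prim f g) (Suc n # xs) z"
| eval_Mn: "eval f (n # xs) 0 \<Longrightarrow> (\<forall>m < n. \<exists>y. eval f (m # xs) (Suc y))
              \<Longrightarrow> eval (Mn f) xs n"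

definition decidable_set :: "nat set \<Rightarrow> bool" where
  "decidable_set A \<longleftrightarrow> (\<exists>r. \<forall>x. eval r [x] (if x \<in> A then 1 else 0))"

datatype ('n, 't) ptree = Leaf 't | Node 'n "('n, 't) ptree list"

fun root :: "('n, 't) ptree \<Rightarrow> 'n + 't" where
  "root (Leaf a) = Inr a"
| "root (Node A ts) = Inl A"

fun yield :: "('n, 't) ptree \<Rightarrow> 't list" where
  "yield (Leaf a) = [a]"
| "yield (Node A ts) = concat (map yield ts)"

fun ptree_ok :: "('n \<times> ('n + 't) list) set \<Rightarrow> ('n, 't) ptree \<Rightarrow> bool" where
  "ptree_ok P (Leaf a) = True"
| "ptree_ok P (Node A ts) = ((A, map root ts) \<in> P \<and> (\<forall>t \<in> set ts. ptree_ok P t))"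

definition parse_trees :: "('n \<times> ('n + 't) list) set \<Rightarrow> 'n \<Rightarrow> 't list \<Rightarrow> ('n, 't) ptree set" where
  "parse_trees P S0 w = {t. ptree_ok P t \<and> root t = Inl S0 \<and> yield t = w}"

definition cfg_lang :: "('n \<times> ('n + 't) list) set \<Rightarrow> 'n \<Rightarrow> 't list set" where
  "cfg_lang P S0 = {w. parse_trees P S0 w \<noteq> {}}"

definition cfg_unambiguous :: "('n \<times> ('n + 't) list) set \<Rightarrow> 'n \<Rightarrow> bool" where
  "cfg_unambiguous P S0 \<longleftrightarrow> (\<forall>w \<in> cfg_lang P S0. \<exists>!t. t \<in> parse_trees P S0 w)"

text \<open>L is an unambiguous context-free language: generated by some unambiguous grammar
  with finitely many productions (nonterminals w.l.o.g. natural numbers).\<close>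
definition unambiguous_cfl :: "'t list set \<Rightarrow> bool" where
  "unambiguous_cfl L \<longleftrightarrow>
     (\<exists>(P :: (nat \<times> (nat + 't) list) set) S0. finite P \<and> cfg_lang P S0 = L \<and> cfg_unambiguous P S0)"

definition word_eval :: "('a, 'b) monoid_scheme \<Rightarrow> 'a list \<Rightarrow> 'a" where
  "word_eval G w = foldr (\<lambda>x y. x \<otimes>\<^bsub>G\<^esub> y) w \<one>\<^bsub>G\<^esub>"

definition word_length :: "('a, 'b) monoid_scheme \<Rightarrow> 'a set \<Rightarrow> 'a \<Rightarrow> nat" where
  "word_length G S h = (LEAST n. \<exists>w \<in> lists S. length w = n \<and> word_eval G w = h)"

definition conjugate :: "('a, 'b) monoid_scheme \<Rightarrow> 'a \<Rightarrow> 'a \<Rightarrow> bool" where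
  "conjugate G x y \<longleftrightarrow> x \<in> carrier G \<and> y \<in> carrier G \<and>
     (\<exists>g \<in> carrier G. y = inv\<^bsub>G\<^esub> g \<otimes>\<^bsub>G\<^esub> x \<otimes>\<^bsub>G\<^esub> g)"

definition ConjGeo :: "('a, 'b) monoid_scheme \<Rightarrow> 'a set \<Rightarrow> 'a list set" where
  "ConjGeo G S = {w \<in> lists S.
     length w = (INF h \<in> {h \<in> carrier G. conjugate G h (word_eval G w)}. word_length G S h)}"

definition word_problem_set :: "(nat, 'b) monoid_scheme \<Rightarrow> nat set \<Rightarrow> nat set" where
  "word_problem_set G S = {list_encode w | w. w \<in> lists S \<and> word_eval G w = \<one>\<^bsub>G\<^esub>}"

definition conj_problem_set :: "(nat, 'b) monoid_scheme \<Rightarrow> nat set \<Rightarrow> nat set" where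
  "conj_problem_set G S = {prod_encode (list_encode u, list_encode v) | u v.
     u \<in> lists S \<and> v \<in> lists S \<and> conjugate G (word_eval G u) (word_eval G v)}"

end

theory Submission
  imports Defs "HOL-Library.Z2"
begin

text \<open>
Let Q be the wreath product of the group of order two with the free group H on u and r. Elements of Q
are pairs of a finite set of lit lamps in the tree of H and a position. With the generators "switch or
not, walk one step, switch or not", the length of an element is essentially the length of a shortest
tour in the tree, so that ConjGeo is described by tours of trees: no branch is entered twice, all leaves
are lit. Such cyclic tours are generated by an unambiguous grammar.

An H-invariant bilinear form on lamp configurations defines a central extension G of Q by a group of
order two with generator z. If the generating set is closed under multiplication by z, then the length of
a conjugacy class of G only depends on its image in Q (up to the words representing z), so ConjGeo does
not see the form. The form is given by a function chi on H, chi(y) being the parity of the number of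
letters r in y read at a height i such that the pair of i and the final height j encodes a halting
computation of machine i. It is computable, hence so is the word problem. But the element x(i) with two
lamps, at 1 and at the vertex represented by the i-th conjugate of r by u, is conjugate to z x(i) if and only if
some lamp of position y satisfies that i and the height of y encode a halting computation; so the
conjugacy problem is undecidable.
\<close>

section \<open>Computable functions\<close>

text \<open>Conjugating \<open>x(i)\<close> by a lamp configuration changes the central coordinate
  by the form taken in both orders, so everything depends on the asymmetry of \<open>chi\<close>.
  The conjugate of r written in front of y is read at height i while the final height, that of y, is
  still free; written behind the inverse of y it is read at or above the final height, where
  \<open>stage\<close> fails because it demands i < j. All other values of \<open>chi\<close> occur
  twice and cancel. One value of \<open>chi\<close> checks one given computation; the search over
  computations is left to the choice of the conjugator.

  The lower bound on length has to hold against conjugators that move lamps. What they cannot change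
  is the parity of the number of lit lamps in an orbit of the translation part. Each leaf of a tour
  is visited once per period, so its orbit stays odd, and every conjugate word must still visit the
  leaf.

  A cyclic tour can be read from any starting point, on the axis of its translation or far from it.
  The nonterminals therefore record the directions used at the vertex where end and start are glued,
  and closed pieces are peeled off there in a fixed order, which yields unambiguity.\<close>

lemma eval_deterministic:
  "eval r xs y \<Longrightarrow> eval r xs z \<Longrightarrow> y = z"
proof (induction arbitrary: z rule: eval.induct)
  case (eval_Zero xs) then show ?case by (cases rule: eval.cases) auto
next
  case (eval_Succ x xs) then show ?case by (cases rule: eval.cases) auto
next
  case (eval_Proj i xs) from eval_Proj(2) show ?case by (cases rule: eval.cases) auto
next
  case (eval_Comp ys gs xs f y)
  from eval_Comp.prems obtain ys' where ys': "length ys' = length gs"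
    "\<forall>i < length gs. eval (gs ! i) xs (ys' ! i)" "eval f ys' z"
    by (cases rule: eval.cases) auto
  have "ys' = ys" using ys' eval_Comp by (intro nth_equalityI) auto
  then show ?case using ys' eval_Comp.IH(2) by auto
next
  case (eval_Prim0 f xs y g) from eval_Prim0.prems eval_Prim0.IH show ?case by (cases rule: eval.cases) auto
next
  case (eval_PrimS f g n xs r y)
  from eval_PrimS.prems eval_PrimS.IH show ?case by (cases rule: eval.cases) auto
next
  case (eval_Mn f n xs)
  from eval_Mn.prems obtain "eval f (z # xs) 0" "\<forall>m < z. \<exists>y. eval f (m # xs) (Suc y)"
    by (cases rule: eval.cases) auto
  then show ?case using eval_Mn.IH eval_Mn.hyps
    by (metis linorder_neqE_nat nat.distinct(1))
qed

definition computable2 :: "(nat \<Rightarrow> nat \<Rightarrow> nat) \<Rightarrow> bool" where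
  "computable2 f \<longleftrightarrow> (\<exists>r. \<forall>x y. eval r [x, y] (f x y))"

definition computable3 :: "(nat \<Rightarrow> nat \<Rightarrow> nat \<Rightarrow> nat) \<Rightarrow> bool" where
  "computable3 f \<longleftrightarrow> (\<exists>r. \<forall>x y z. eval r [x, y, z] (f x y z))"

definition computable :: "(nat \<Rightarrow> nat) \<Rightarrow> bool" where
  "computable f \<longleftrightarrow> (\<exists>r. \<forall>x. eval r [x] (f x))"

lemma eval_Comp1: "eval g xs y \<Longrightarrow> eval f [y] z \<Longrightarrow> eval (Comp f [g]) xs z"
  by (rule eval_Comp[where ys = "[y]"]) auto

lemma eval_Comp2: "eval g xs y \<Longrightarrow> eval g' xs y' \<Longrightarrow> eval f [y, y'] z \<Longrightarrow> eval (Comp f [g, g']) xs z"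
  by (rule eval_Comp[where ys = "[y, y']"]) (auto simp: less_Suc_eq)

lemma eval_Comp3: "eval g xs y \<Longrightarrow> eval g' xs y' \<Longrightarrow> eval g'' xs y'' \<Longrightarrow> eval f [y, y', y''] z \<Longrightarrow>
    eval (Comp f [g, g', g'']) xs z"
  by (rule eval_Comp[where ys = "[y, y', y'']"]) (auto simp: less_Suc_eq)

lemma eval_Proj': "i < length xs \<Longrightarrow> xs ! i = y \<Longrightarrow> eval (Proj i) xs y"
  using eval_Proj by blast

lemma computable_id: "computable (\<lambda>x. x)"
  unfolding computable_def by (rule exI[of _ "Proj 0"]) (auto intro!: eval_Proj')
lemma computable_0: "computable (\<lambda>x. 0)"
  unfolding computable_def by (blast intro: eval_Zero)
lemma computable_Suc: "computable Suc"
  unfolding computable_def by (blast intro: eval_Succ)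
lemma computable2_fst: "computable2 (\<lambda>x y. x)"
  unfolding computable2_def by (rule exI[of _ "Proj 0"]) (auto intro!: eval_Proj')
lemma computable2_snd: "computable2 (\<lambda>x y. y)"
  unfolding computable2_def by (rule exI[of _ "Proj 1"]) (auto intro!: eval_Proj')
lemma computable3_1: "computable3 (\<lambda>x y z. x)"
  unfolding computable3_def by (rule exI[of _ "Proj 0"]) (auto intro!: eval_Proj')
lemma computable3_2: "computable3 (\<lambda>x y z. y)"
  unfolding computable3_def by (rule exI[of _ "Proj 1"]) (auto intro!: eval_Proj')
lemma computable3_3: "computable3 (\<lambda>x y z. z)"
  unfolding computable3_def by (rule exI[of _ "Proj 2"]) (auto intro!: eval_Proj')

lemma computable_comp: "computable f \<Longrightarrow> computable g \<Longrightarrow> computable (\<lambda>x. f (g x))"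
  unfolding computable_def by (blast intro: eval_Comp1)
lemma computable_comp2:
  "computable2 f \<Longrightarrow> computable g \<Longrightarrow> computable h \<Longrightarrow> computable (\<lambda>x. f (g x) (h x))"
  unfolding computable_def computable2_def by (blast intro: eval_Comp2)
lemma computable_comp3:
  "computable3 f \<Longrightarrow> computable g \<Longrightarrow> computable h \<Longrightarrow> computable k \<Longrightarrow>
    computable (\<lambda>x. f (g x) (h x) (k x))"
  unfolding computable_def computable3_def
  apply (elim exE)
  subgoal for r1 r2 r3 r4 by (rule exI[of _ "Comp r1 [r2, r3, r4]"]) (fast intro: eval_Comp3)
  done
lemma computable2_comp: "computable f \<Longrightarrow> computable2 g \<Longrightarrow> computable2 (\<lambda>x y. f (g x y))"
  unfolding computable_def computable2_def by (blast intro: eval_Comp1)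
lemma computable2_comp2:
  "computable2 f \<Longrightarrow> computable2 g \<Longrightarrow> computable2 h \<Longrightarrow> computable2 (\<lambda>x y. f (g x y) (h x y))"
  unfolding computable2_def
  apply (elim exE)
  subgoal for r1 r2 r3 by (rule exI[of _ "Comp r1 [r2, r3]"]) (fast intro: eval_Comp2)
  done
lemma computable3_comp: "computable f \<Longrightarrow> computable3 g \<Longrightarrow> computable3 (\<lambda>x y z. f (g x y z))"
  unfolding computable_def computable3_def by (blast intro: eval_Comp1)
lemma computable3_comp2:
  "computable2 f \<Longrightarrow> computable3 g \<Longrightarrow> computable3 h \<Longrightarrow> computable3 (\<lambda>x y z. f (g x y z) (h x y z))"
  unfolding computable2_def computable3_def
  apply (elim exE)
  subgoal for r1 r2 r3 by (rule exI[of _ "Comp r1 [r2, r3]"]) (fast intro: eval_Comp2)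
  done

lemma computable2_rec:
  assumes "computable f" "computable3 g"
  shows "computable2 (\<lambda>n x. rec_nat (f x) (\<lambda>m r. g m r x) n)"
proof -
  obtain rf rg where r: "\<And>x. eval rf [x] (f x)" "\<And>x y z. eval rg [x, y, z] (g x y z)"
    using assms unfolding computable_def computable3_def by blast
  have "eval (Prim rf rg) [n, x] (rec_nat (f x) (\<lambda>m r. g m r x) n)" for n x
    by (induction n) (auto intro: r eval_Prim0 eval_PrimS)
  then show ?thesis unfolding computable2_def by blast
qed

lemma computable_rec_closed:
  assumes "computable2 g"
  shows "computable (\<lambda>n. rec_nat 0 (\<lambda>m r. g m r) n)"
proof -
  have "computable3 (\<lambda>m r x. g m r)"
    by (rule computable3_comp2[OF assms computable3_1 computable3_2])
  from computable2_rec[OF computable_0 this]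
  have "computable2 (\<lambda>n x. rec_nat 0 (\<lambda>m r. g m r) n)" .
  from computable_comp2[OF this computable_id computable_id] show ?thesis .
qed

lemma computable_const: "computable (\<lambda>x. c)"
  by (induction c) (auto intro: computable_0 computable_comp[OF computable_Suc])

lemma computable2_add: "computable2 (+)"
proof -
  have "rec_nat y (\<lambda>m r. Suc r) x = x + y" for x y :: nat by (induction x) auto
  then show ?thesis
    using computable2_rec[OF computable_id computable3_comp[OF computable_Suc computable3_2]] by simp
qed

lemma computable2_flip: "computable2 f \<Longrightarrow> computable2 (\<lambda>x y. f y x)"
  by (rule computable2_comp2[OF _ computable2_snd computable2_fst])

lemma computable_pred: "computable (\<lambda>x. x - 1)"
proof -
  have "rec_nat 0 (\<lambda>m r. m) x = x - 1" for x :: nat by (induction x) auto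
  then show ?thesis using computable_rec_closed[OF computable2_fst] by simp
qed

lemma computable2_diff: "computable2 (-)"
proof -
  have "rec_nat y (\<lambda>m r. r - 1) x = y - x" for x y :: nat by (induction x) auto
  then have "computable2 (\<lambda>x y. y - x)"
    using computable2_rec[OF computable_id computable3_comp[OF computable_pred computable3_2]] by simp
  from computable2_flip[OF this] show ?thesis by simp
qed

lemma computable3_if:
  "computable3 (\<lambda>c x y. if c = 0 then x else y)"
proof -
  \<comment> \<open>The base case sees \<open>[x, y]\<close> and returns x; the step sees
    \<open>[n, r, x, y]\<close>, so \<open>Proj 3\<close> returns y whatever the recursive value r
    is. That value must still exist, which is the auxiliary claim in the successor case.\<close>
  have "eval (Prim (Proj 0) (Proj 3)) [c, x, y] (if c = 0 then x else y)" for c x y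
  proof (cases c)
    case (Suc c')
    have *: "\<exists>v. eval (Prim (Proj 0) (Proj 3)) [k, x, y] v" for k
      by (induction k) (auto intro!: eval_Prim0 eval_PrimS eval_Proj' exI)
    show ?thesis using Suc *[of c'] by (auto intro!: eval_PrimS eval_Proj')
  qed (auto intro!: eval_Prim0 eval_Proj')
  then show ?thesis unfolding computable3_def by blast
qed

lemma computable2_if_le:
  assumes "computable2 a" "computable2 b" "computable2 f" "computable2 g"
  shows "computable2 (\<lambda>x y. if a x y \<le> b x y then f x y else g x y)"
proof -
  obtain r ra rf rg where r: "\<And>c x y. eval r [c, x, y] (if c = 0 then x else y)"
    "\<And>x y. eval ra [x, y] (a x y - b x y)" "\<And>x y. eval rf [x, y] (f x y)" "\<And>x y. eval rg [x, y] (g x y)"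
    using computable3_if computable2_comp2[OF computable2_diff assms(1,2)] assms(3,4)
    unfolding computable2_def computable3_def by blast
  have "eval (Comp r [ra, rf, rg]) [x, y] (if a x y - b x y = 0 then f x y else g x y)" for x y
    by (rule eval_Comp3[OF r(2,3,4)]) (rule r(1))
  then show ?thesis unfolding computable2_def by (intro exI[of _ "Comp r [ra, rf, rg]"]) simp
qed

lemma computable_triangle: "computable triangle"
proof -
  have "rec_nat 0 (\<lambda>m r. Suc (m + r)) n = triangle n" for n by (induction n) auto
  then show ?thesis
    using computable_rec_closed[OF computable2_comp[OF computable_Suc computable2_add]] by simp
qed

section \<open>Pairs of naturals as naturals (Cantor pairing)\<close>

definition pair :: "nat \<Rightarrow> nat \<Rightarrow> nat" where "pair x y = prod_encode (x, y)"
definition pfst :: "nat \<Rightarrow> nat" where "pfst p = fst (prod_decode p)"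
definition psnd :: "nat \<Rightarrow> nat" where "psnd p = snd (prod_decode p)"

lemma pfst_pair [simp]: "pfst (pair x y) = x" by (simp add: pair_def pfst_def)
lemma psnd_pair [simp]: "psnd (pair x y) = y" by (simp add: pair_def psnd_def)
lemma pair_collapse [simp]: "pair (pfst p) (psnd p) = p" by (simp add: pair_def pfst_def psnd_def)

lemma computable2_pair: "computable2 pair"
proof -
  have "computable2 (\<lambda>x y. triangle (x + y) + x)"
    by (rule computable2_comp2[OF computable2_add computable2_comp[OF computable_triangle computable2_add]
          computable2_fst])
  moreover have "pair = (\<lambda>x y. triangle (x + y) + x)" by (simp add: pair_def prod_encode_def fun_eq_iff)
  ultimately show ?thesis by simp
qed

lemma triangle_mono: "m \<le> n \<Longrightarrow> triangle m \<le> triangle n"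
  unfolding triangle_def by (intro div_le_mono mult_le_mono) auto

text \<open>The diagonal on which the pair coded by x lies is found by primitive recursion on x.\<close>
lemma pair_diagonal:
  "rec_nat 0 (\<lambda>x k. if triangle (Suc k) \<le> Suc x then Suc k else k) x = pfst x + psnd x" (is "?k x = _")
proof -
  have k: "triangle (?k x) \<le> x \<and> x < triangle (Suc (?k x))" for x
  proof (induction x)
    case (Suc x)
    show ?case
    proof (cases "triangle (Suc (?k x)) \<le> Suc x")
      case True
      then have "Suc x = triangle (Suc (?k x))" using Suc by linarith
      then show ?thesis using True by simp
    qed (use Suc in auto)
  qed simp
  obtain m n where x: "x = pair m n" by (metis pair_collapse)
  have e: "x = triangle (m + n) + m" by (simp add: x pair_def prod_encode_def)
  have "?k x = m + n"
  proof (rule linorder_cases[of "?k x" "m + n"])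
    assume "?k x < m + n"
    then have "triangle (Suc (?k x)) \<le> triangle (m + n)" by (intro triangle_mono) simp
    then show ?thesis using k[of x] e by linarith
  next
    assume "m + n < ?k x"
    then have "triangle (Suc (m + n)) \<le> triangle (?k x)" by (intro triangle_mono) simp
    then show ?thesis using k[of x] e by (simp only: triangle_Suc) linarith
  qed
  then show ?thesis by (simp add: x)
qed

lemma computable_pair_sum: "computable (\<lambda>x. pfst x + psnd x)"
proof -
  have "computable2 (\<lambda>x k. if triangle (Suc k) \<le> Suc x then Suc k else k)"
    by (intro computable2_if_le computable2_comp[OF computable_triangle] computable2_comp[OF computable_Suc]
        computable2_snd computable2_fst)
  from computable_rec_closed[OF this] show ?thesis by (simp only: pair_diagonal)
qed

lemma computable_pfst: "computable pfst"
proof -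
  have "pfst x = x - triangle (pfst x + psnd x)" for x
  proof -
    obtain m n where x: "x = pair m n" by (metis pair_collapse)
    show ?thesis unfolding x pfst_pair psnd_pair by (simp add: pair_def prod_encode_def)
  qed
  moreover have "computable (\<lambda>x. x - triangle (pfst x + psnd x))"
    by (rule computable_comp2[OF computable2_diff computable_id
          computable_comp[OF computable_triangle computable_pair_sum]])
  ultimately show ?thesis by presburger
qed

lemma computable_psnd: "computable psnd"
proof -
  have "computable (\<lambda>x. (pfst x + psnd x) - pfst x)"
    by (rule computable_comp2[OF computable2_diff computable_pair_sum computable_pfst])
  then show ?thesis by simp
qed

lemma computable_add: "computable f \<Longrightarrow> computable g \<Longrightarrow> computable (\<lambda>x. f x + g x)"
  by (rule computable_comp2[OF computable2_add])
lemma computable_diff: "computable f \<Longrightarrow> computable g \<Longrightarrow> computable (\<lambda>x. f x - g x)"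
  by (rule computable_comp2[OF computable2_diff])
lemma computable_pairI: "computable f \<Longrightarrow> computable g \<Longrightarrow> computable (\<lambda>x. pair (f x) (g x))"
  by (rule computable_comp2[OF computable2_pair])

lemmas computable_intros1 = computable_id computable_const computable_add computable_diff computable_pairI
  computable_comp[OF computable_Suc] computable_comp[OF computable_pfst] computable_comp[OF computable_psnd]

text \<open>From here on functions of several arguments are unary functions of nested pairs:
  parameter, counter and recursive value are packed as \<open>pair x (pair m r)\<close>. Later
  computability goals thus have one shape and can be attacked by introduction rules.\<close>

lemma computable_rec:
  assumes "computable (\<lambda>p. h (pfst p) (pfst (psnd p)) (psnd (psnd p)))" "computable f" "computable k"
  shows "computable (\<lambda>x. rec_nat (f x) (\<lambda>m r. h x m r) (k x))"
proof -
  have "computable3 (\<lambda>m r x. h (pfst (pair x (pair m r))) (pfst (psnd (pair x (pair m r)))) (psnd (psnd (pair x (pair m r)))))"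
    by (rule computable3_comp[OF assms(1)])
      (intro computable3_comp2[OF computable2_pair] computable3_1 computable3_2 computable3_3)
  then have "computable3 (\<lambda>m r x. h x m r)" by simp
  from computable_comp2[OF computable2_rec[OF assms(2) this] assms(3) computable_id]
  show ?thesis .
qed

section \<open>Decidable predicates and bounded quantifiers\<close>

definition decidable_pred :: "(nat \<Rightarrow> bool) \<Rightarrow> bool" where
  "decidable_pred P \<longleftrightarrow> computable (\<lambda>x. if P x then 1 else 0)"

lemma computable_if:
  assumes "decidable_pred P" "computable f" "computable g"
  shows "computable (\<lambda>x. if P x then f x else g x)"
proof -
  have "computable (\<lambda>x. if (if P x then 1 else 0 :: nat) = 0 then g x else f x)"
    by (rule computable_comp3[OF computable3_if]) (use assms in \<open>auto simp: decidable_pred_def\<close>)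
  moreover have "(\<lambda>x. if (if P x then 1 else 0 :: nat) = 0 then g x else f x) = (\<lambda>x. if P x then f x else g x)"
    by auto
  ultimately show ?thesis by simp
qed

lemma decidable_le:
  assumes "computable f" "computable g"
  shows "decidable_pred (\<lambda>x. f x \<le> g x)"
proof -
  have "computable (\<lambda>x. if f x - g x = 0 then 1 else 0)"
    by (rule computable_comp3[OF computable3_if]) (intro computable_intros1 assms)+
  then show ?thesis by (simp add: decidable_pred_def)
qed

lemma decidable_const: "decidable_pred (\<lambda>x. b)"
  unfolding decidable_pred_def by (rule computable_const)
lemma decidable_not: "decidable_pred P \<Longrightarrow> decidable_pred (\<lambda>x. \<not> P x)"
proof -
  assume "decidable_pred P"
  from computable_if[OF this computable_const[of 0] computable_const[of 1]]
  have "computable (\<lambda>x. if P x then 0 else 1)" .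
  moreover have "(\<lambda>x. if P x then 0 else 1 :: nat) = (\<lambda>x. if \<not> P x then 1 else 0)" by auto
  ultimately show ?thesis by (simp add: decidable_pred_def)
qed
lemma decidable_conj: "decidable_pred P \<Longrightarrow> decidable_pred Q \<Longrightarrow> decidable_pred (\<lambda>x. P x \<and> Q x)"
proof -
  assume a: "decidable_pred P" "decidable_pred Q"
  have "computable (\<lambda>x. if P x then (if Q x then 1 else 0) else 0)"
    by (intro computable_if a computable_const)
  moreover have "(\<lambda>x. if P x then (if Q x then 1 else 0) else 0 :: nat) = (\<lambda>x. if P x \<and> Q x then 1 else 0)" by auto
  ultimately show ?thesis by (simp add: decidable_pred_def)
qed
lemma decidable_disj: "decidable_pred P \<Longrightarrow> decidable_pred Q \<Longrightarrow> decidable_pred (\<lambda>x. P x \<or> Q x)"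
  using decidable_not[OF decidable_conj[OF decidable_not[of P] decidable_not[of Q]]] by simp
lemma decidable_imp: "decidable_pred P \<Longrightarrow> decidable_pred Q \<Longrightarrow> decidable_pred (\<lambda>x. P x \<longrightarrow> Q x)"
  unfolding imp_conv_disj by (intro decidable_disj decidable_not)
lemma decidable_less: "computable f \<Longrightarrow> computable g \<Longrightarrow> decidable_pred (\<lambda>x. f x < g x)"
  unfolding not_le[symmetric] by (intro decidable_not decidable_le)
lemma decidable_eq: "computable f \<Longrightarrow> computable g \<Longrightarrow> decidable_pred (\<lambda>x. f x = g x)"
  unfolding eq_iff[where 'a = nat] by (intro decidable_conj decidable_le)
lemma decidable_comp: "decidable_pred P \<Longrightarrow> computable f \<Longrightarrow> decidable_pred (\<lambda>x. P (f x))"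
  unfolding decidable_pred_def by (rule computable_comp)

lemma decidable_all_less:
  assumes "decidable_pred (\<lambda>p. P (pfst p) (psnd p))" "computable k"
  shows "decidable_pred (\<lambda>x. \<forall>m < k x. P x m)"
proof -
  have *: "decidable_pred (\<lambda>p. P (pfst p) (pfst (psnd p)))"
    using decidable_comp[OF assms(1), of "\<lambda>p. pair (pfst p) (pfst (psnd p))"]
    by (simp add: computable_intros1)
  have "computable (\<lambda>x. rec_nat 1 (\<lambda>m r. if P x m then r else 0) (k x))"
    by (intro computable_rec computable_if * assms(2) computable_intros1)
  moreover have "rec_nat 1 (\<lambda>m r. if P x m then r else 0) n = (if \<forall>m < n. P x m then 1 else 0 :: nat)" for x n
    by (induction n) (auto simp: less_Suc_eq)
  ultimately show ?thesis by (simp add: decidable_pred_def)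
qed

text \<open>A list is consumed by iterating a state transition; its code bounds the number of steps needed.\<close>
lemma computable_foldl:
  assumes "computable (\<lambda>p. h (pfst p) (pfst (psnd p)) (psnd (psnd p)))" "computable a" "computable l"
  shows "computable (\<lambda>x. foldl (\<lambda>s y. h x s y) (a x) (list_decode (l x)))"
proof -
  \<comment> \<open>The state pairs the accumulator with the code of the remaining list. Code 0 is
    the empty list, any other code is the successor of a pair of head and tail, hence the
    \<open>- 1\<close>.\<close>
  define step where "step x s = (if psnd s = 0 then s
      else pair (h x (pfst s) (pfst (psnd s - 1))) (psnd (psnd s - 1)))" for x s
  have h: "computable (\<lambda>p. h (f p) (g p) (k p))" if "computable f" "computable g" "computable k" for f g k
    using computable_comp[OF assms(1), of "\<lambda>p. pair (f p) (pair (g p) (k p))"] that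
    by (simp add: computable_intros1)
  have 1: "computable (\<lambda>x. pfst (rec_nat (pair (a x) (l x)) (\<lambda>m s. step x s) (l x)))"
    unfolding step_def
    by (intro computable_intros1(7-) computable_rec computable_if computable_intros1 decidable_eq assms(2,3) h)
  have fold: "pfst (rec_nat (pair s (list_encode ys)) (\<lambda>m s. step x s) (n + length ys)) = foldl (\<lambda>s y. h x s y) s ys" for x s ys n
  proof -
    have rec: "rec_nat s (\<lambda>m s. step x s) n = (step x ^^ n) s" for s n by (induction n) auto
    have stay: "(step x ^^ n) (pair s 0) = pair s 0" for n s by (induction n) (auto simp: step_def)
    have "(step x ^^ length ys) (pair s (list_encode ys)) = pair (foldl (\<lambda>s y. h x s y) s ys) 0" for s
    proof (induction ys arbitrary: s)
      case (Cons y ys)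
      have "step x (pair s (list_encode (y # ys))) = pair (h x s y) (list_encode ys)"
        by (simp add: step_def) (simp add: pfst_def psnd_def)
      then show ?case using Cons by (simp add: funpow_swap1)
    qed simp
    then show ?thesis by (simp add: rec funpow_add stay)
  qed
  moreover have len: "length ys \<le> list_encode ys" for ys
  proof (induction ys)
    case (Cons y ys) then show ?case using le_prod_encode_2[of "list_encode ys" y] by simp
  qed simp
  ultimately have "pfst (rec_nat (pair (a x) (l x)) (\<lambda>m s. step x s) (l x)) =
      foldl (\<lambda>s y. h x s y) (a x) (list_decode (l x))" for x
    using fold[of "a x" "list_decode (l x)" x "l x - length (list_decode (l x))"] len[of "list_decode (l x)"] by simp
  then show ?thesis using 1 by simp
qed

lemma decidable_ex_list:
  assumes "decidable_pred (\<lambda>p. P (pfst p) (psnd p))" "computable l"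
  shows "decidable_pred (\<lambda>x. \<exists>y \<in> set (list_decode (l x)). P x y)"
proof -
  have *: "decidable_pred (\<lambda>p. P (pfst p) (psnd (psnd p)))"
    using decidable_comp[OF assms(1), of "\<lambda>p. pair (pfst p) (psnd (psnd p))"]
    by (simp add: computable_intros1)
  have "computable (\<lambda>x. foldl (\<lambda>s y. if P x y then 1 else s) 0 (list_decode (l x)))"
    by (intro computable_foldl computable_if * assms(2) computable_intros1)
  moreover have "foldl (\<lambda>s y. if P x y then 1 else s) b ys = (if \<exists>y \<in> set ys. P x y then 1 else b)" for x ys and b :: nat
    by (induction ys arbitrary: b) auto
  ultimately show ?thesis by (simp add: decidable_pred_def)
qed

lemma decidable_all_list:
  assumes "decidable_pred (\<lambda>p. P (pfst p) (psnd p))" "computable l"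
  shows "decidable_pred (\<lambda>x. \<forall>y \<in> set (list_decode (l x)). P x y)"
  using decidable_not[OF decidable_ex_list[OF decidable_not[OF assms(1)] assms(2)]] by simp

lemma decidable_mem_list:
  assumes "computable f" "computable l"
  shows "decidable_pred (\<lambda>x. f x \<in> set (list_decode (l x)))"
proof -
  have "decidable_pred (\<lambda>p. psnd p = f (pfst p))"
    by (intro decidable_eq computable_intros1 computable_comp[OF assms(1)])
  from decidable_ex_list[OF this assms(2)] show ?thesis by simp
qed

section \<open>Operations on coded lists\<close>

definition pcons :: "nat \<Rightarrow> nat \<Rightarrow> nat" where "pcons x l = Suc (pair x l)"

lemma pcons_list_encode: "pcons x (list_encode xs) = list_encode (x # xs)"
  by (simp add: pcons_def pair_def)
lemma list_decode_pcons [simp]: "list_decode (pcons x l) = x # list_decode l"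
  by (metis list_decode_inverse list_encode_inverse pcons_list_encode)

lemma computable_pcons: "computable f \<Longrightarrow> computable g \<Longrightarrow> computable (\<lambda>x. pcons (f x) (g x))"
  unfolding pcons_def by (intro computable_intros1)

lemma computable_rev: "computable l \<Longrightarrow> computable (\<lambda>x. list_encode (rev (list_decode (l x))))"
proof -
  assume "computable l"
  then have "computable (\<lambda>x. foldl (\<lambda>s y. pcons y s) 0 (list_decode (l x)))"
    by (intro computable_foldl computable_pcons computable_intros1)
  moreover have "foldl (\<lambda>s y. pcons y s) (list_encode zs) ys = list_encode (rev ys @ zs)" for ys zs
    by (induction ys arbitrary: zs) (simp_all add: pcons_list_encode del: list_encode.simps)
  from this[of "[]"] have "foldl (\<lambda>s y. pcons y s) 0 ys = list_encode (rev ys)" for ys by simp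
  ultimately show ?thesis by simp
qed

lemma computable_length: "computable l \<Longrightarrow> computable (\<lambda>x. length (list_decode (l x)))"
proof -
  assume "computable l"
  then have "computable (\<lambda>x. foldl (\<lambda>s y. Suc s) 0 (list_decode (l x)))"
    by (intro computable_foldl computable_intros1)
  moreover have "foldl (\<lambda>s y. Suc s) n ys = n + length ys" for ys :: "nat list" and n
    by (induction ys arbitrary: n) auto
  ultimately show ?thesis by simp
qed

definition pnth :: "nat \<Rightarrow> nat \<Rightarrow> nat" where
  "pnth l i = pfst (rec_nat l (\<lambda>m s. psnd (s - 1)) i - 1)"

lemma pdrop:
  assumes "i \<le> length xs"
  shows "rec_nat (list_encode xs) (\<lambda>m s. psnd (s - 1)) i = list_encode (drop i xs)"
  using assms
proof (induction i)
  case (Suc i)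
  then have "drop i xs = xs ! i # drop (Suc i) xs" by (simp add: Cons_nth_drop_Suc)
  then show ?case using Suc by (simp add: psnd_def)
qed simp

lemma pnth: "i < length (list_decode l) \<Longrightarrow> pnth l i = list_decode l ! i"
proof -
  assume i: "i < length (list_decode l)"
  then have "drop i (list_decode l) = list_decode l ! i # drop (Suc i) (list_decode l)" by (simp add: Cons_nth_drop_Suc)
  then show ?thesis using pdrop[of i "list_decode l"] i by (simp add: pnth_def) (simp add: pfst_def)
qed

lemma computable_pnth: "computable f \<Longrightarrow> computable g \<Longrightarrow> computable (\<lambda>x. pnth (f x) (g x))"
  unfolding pnth_def by (intro computable_intros1(7-) computable_diff computable_rec computable_intros1)

lemmas computable_intros = computable_intros1 computable_pcons computable_rev computable_length computable_pnth
  computable_if computable_foldl computable_rec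
lemmas decidable_intros = decidable_const decidable_not decidable_conj decidable_disj decidable_imp decidable_le
  decidable_less decidable_eq decidable_all_less decidable_ex_list decidable_all_list decidable_mem_list

section \<open>An undecidable projection of a decidable relation\<close>

fun rcode :: "recf \<Rightarrow> nat" where
  "rcode Zero = pair 0 0"
| "rcode Succ = pair 1 0"
| "rcode (Proj i) = pair 2 i"
| "rcode (Comp f gs) = pair 3 (pair (rcode f) (list_encode (map rcode gs)))"
| "rcode (Prim f g) = pair 4 (pair (rcode f) (rcode g))"
| "rcode (Mn f) = pair 5 (rcode f)"

section \<open>Coded derivations of evaluation judgements\<close>

definition judgement :: "nat \<Rightarrow> nat \<Rightarrow> nat \<Rightarrow> nat" where
  "judgement e xs y = pair e (pair xs y)"

text \<open>One rule application of \<open>eval\<close> in coded form: the tag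
  \<open>pfst (pfst j)\<close> selects the rule, and R holds the available premises. Every
  quantifier is bounded by R or by a number, which makes the relation decidable although
  \<open>eval\<close> is not.\<close>

definition justified :: "nat \<Rightarrow> nat set \<Rightarrow> bool" where
  "justified j R \<longleftrightarrow>
    pfst (pfst j) = 0 \<and> psnd (psnd j) = 0 \<or>
    pfst (pfst j) = 1 \<and> 0 < length (list_decode (pfst (psnd j))) \<and> psnd (psnd j) = Suc (pnth (pfst (psnd j)) 0) \<or>
    pfst (pfst j) = 2 \<and> psnd (pfst j) < length (list_decode (pfst (psnd j))) \<and>
      psnd (psnd j) = pnth (pfst (psnd j)) (psnd (pfst j)) \<or>
    pfst (pfst j) = 3 \<and> (\<exists>k \<in> R. pfst k = pfst (psnd (pfst j)) \<and> psnd (psnd k) = psnd (psnd j) \<and>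
      length (list_decode (pfst (psnd k))) = length (list_decode (psnd (psnd (pfst j)))) \<and>
      (\<forall>i < length (list_decode (psnd (psnd (pfst j)))).
        judgement (pnth (psnd (psnd (pfst j))) i) (pfst (psnd j)) (pnth (pfst (psnd k)) i) \<in> R)) \<or>
    pfst (pfst j) = 4 \<and> 0 < pfst (psnd j) \<and>
      (pfst (pfst (psnd j) - 1) = 0 \<and>
         judgement (pfst (psnd (pfst j))) (psnd (pfst (psnd j) - 1)) (psnd (psnd j)) \<in> R \<or>
       0 < pfst (pfst (psnd j) - 1) \<and>
         (\<exists>k \<in> R. pfst k = pfst j \<and>
           pfst (psnd k) = pcons (pfst (pfst (psnd j) - 1) - 1) (psnd (pfst (psnd j) - 1)) \<and>
           judgement (psnd (psnd (pfst j)))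
             (pcons (pfst (pfst (psnd j) - 1) - 1) (pcons (psnd (psnd k)) (psnd (pfst (psnd j) - 1)))) (psnd (psnd j)) \<in> R)) \<or>
    pfst (pfst j) = 5 \<and> judgement (psnd (pfst j)) (pcons (psnd (psnd j)) (pfst (psnd j))) 0 \<in> R \<and>
      (\<forall>m < psnd (psnd j). \<exists>k \<in> R. pfst k = psnd (pfst j) \<and>
        pfst (psnd k) = pcons m (pfst (psnd j)) \<and> 0 < psnd (psnd k))"

lemma decidable_justified:
  assumes "computable f" "computable g"
  shows "decidable_pred (\<lambda>x. justified (f x) (set (list_decode (g x))))"
proof -
  have "decidable_pred (\<lambda>p. justified (pfst p) (set (list_decode (psnd p))))"
    unfolding justified_def judgement_def by (intro decidable_intros computable_intros)
  from decidable_comp[OF this computable_pairI[OF assms]] show ?thesis by simp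
qed

text \<open>A derivation flattened to a list in which every judgement is followed by its
  premises.\<close>

fun certificate :: "nat list \<Rightarrow> bool" where
  "certificate [] = True"
| "certificate (j # L) = (justified j (set L) \<and> certificate L)"

text \<open>The recursion becomes a bounded quantifier over positions; the tail behind a position is
  reached by iterating the coded tail function, so that the rules for decidable predicates
  apply.\<close>

lemma certificate_iff:
  "certificate (list_decode l) \<longleftrightarrow> (\<forall>i < length (list_decode l). justified (pnth l i)
      (set (list_decode (rec_nat l (\<lambda>m s. psnd (s - 1)) (Suc i)))))"
proof -
  have 1: "certificate L \<longleftrightarrow> (\<forall>i < length L. justified (L ! i) (set (drop (Suc i) L)))" for L
    by (induction L) (auto simp: All_less_Suc2)
  have 2: "justified (pnth l i) (set (list_decode (rec_nat l (\<lambda>m s. psnd (s - 1)) (Suc i)))) \<longleftrightarrow>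
      justified (list_decode l ! i) (set (drop (Suc i) (list_decode l)))" if "i < length (list_decode l)" for i
    using pdrop[of "Suc i" "list_decode l"] that by (simp only: pnth list_decode_inverse list_encode_inverse Suc_leI)
  show ?thesis using 1 2 by blast
qed

lemma decidable_certificate: "computable l \<Longrightarrow> decidable_pred (\<lambda>x. certificate (list_decode (l x)))"
  unfolding certificate_iff
  by (intro decidable_intros decidable_justified computable_intros)
    (auto intro: computable_comp[of l] computable_pfst)

lemma justified_mono: "justified j R \<Longrightarrow> R \<subseteq> R' \<Longrightarrow> justified j R'"
  unfolding justified_def by (elim disjE; simp; blast)

lemma certificate_append: "certificate L \<Longrightarrow> certificate L' \<Longrightarrow> certificate (L @ L')"
  by (induction L) (auto intro: justified_mono)

lemma certificate_concat: "(\<forall>L \<in> set Ls. certificate L) \<Longrightarrow> certificate (concat Ls)"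
  by (induction Ls) (auto intro: certificate_append)

abbreviation jd :: "recf \<Rightarrow> nat list \<Rightarrow> nat \<Rightarrow> nat" where
  "jd r xs y \<equiv> judgement (rcode r) (list_encode xs) y"

lemma certificate_exI:
  assumes "certificate L" "justified j (set L)"
  shows "\<exists>L. certificate L \<and> j \<in> set L"
  by (rule exI[of _ "j # L"]) (use assms in auto)

lemma list_encode_Cons: "list_encode (x # xs) = pcons x (list_encode xs)"
  by (simp add: pcons_list_encode)

text \<open>Certificates of the premises can be concatenated because \<open>justified\<close> is
  monotone in the set of premises; the conclusion is then put in front.\<close>

lemma certificate_complete: "eval r xs y \<Longrightarrow> \<exists>L. certificate L \<and> jd r xs y \<in> set L"
proof (induction rule: eval.induct)
  case (eval_Zero xs)
  show ?case by (rule certificate_exI[of "[]"]) (auto simp: justified_def judgement_def)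
next
  case (eval_Succ x xs)
  show ?case by (rule certificate_exI[of "[]"])
      (auto simp: justified_def judgement_def pnth list_encode_Cons simp del: list_encode.simps)
next
  case (eval_Proj i xs)
  then show ?case by (intro certificate_exI[of "[]"]) (auto simp: justified_def judgement_def pnth)
next
  case (eval_Comp ys gs xs f z)
  have "\<forall>i \<in> {..<length gs}. \<exists>L. certificate L \<and> jd (gs ! i) xs (ys ! i) \<in> set L" using eval_Comp by auto
  from bchoice[OF this] obtain Ls where Ls: "\<And>i. i < length gs \<Longrightarrow> certificate (Ls i) \<and> jd (gs ! i) xs (ys ! i) \<in> set (Ls i)"
    by auto
  obtain L0 where L0: "certificate L0" "jd f ys z \<in> set L0" using eval_Comp by auto
  let ?L = "L0 @ concat (map Ls [0..<length gs])"
  show ?case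
  proof (rule certificate_exI[of ?L])
    show "certificate ?L" using L0 Ls by (intro certificate_append certificate_concat) auto
    have *: "jd (gs ! i) xs (ys ! i) \<in> set ?L" if "i < length gs" for i using Ls[OF that] that by auto
    have "jd f ys z \<in> set ?L" using L0 by simp
    then show "justified (jd (Comp f gs) xs z) (set ?L)"
      unfolding justified_def using * eval_Comp(1)
      by (intro disjI2[OF disjI2[OF disjI2[OF disjI1]]])
        (auto simp: judgement_def pnth simp del: set_append intro!: bexI[of _ "jd f ys z"])
  qed
next
  case (eval_Prim0 f xs z g)
  then obtain L where "certificate L" "jd f xs z \<in> set L" by auto
  then show ?case by (intro certificate_exI[of L])
      (auto simp: justified_def judgement_def list_encode_Cons pcons_def simp del: list_encode.simps)
next
  case (eval_PrimS f g n xs r z)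
  then obtain L L' where "certificate L" "jd (Prim f g) (n # xs) r \<in> set L"
    "certificate L'" "jd g (n # r # xs) z \<in> set L'" by auto
  then have c: "certificate (L @ L')" and a: "jd (Prim f g) (n # xs) r \<in> set (L @ L')"
    and b: "jd g (n # r # xs) z \<in> set (L @ L')" by (auto intro: certificate_append)
  show ?case
  proof (rule certificate_exI[OF c])
    have "\<exists>k \<in> set (L @ L'). pfst k = rcode (Prim f g) \<and> pfst (psnd k) = pcons n (list_encode xs) \<and>
        judgement (rcode g) (pcons n (pcons (psnd (psnd k)) (list_encode xs))) z \<in> set (L @ L')"
      by (rule bexI[OF _ a]) (use b in \<open>auto simp: judgement_def list_encode_Cons simp del: list_encode.simps\<close>)
    then show "justified (jd (Prim f g) (Suc n # xs) z) (set (L @ L'))"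
      unfolding justified_def
      by (intro disjI2[OF disjI2[OF disjI2[OF disjI2[OF disjI1]]]] conjI disjI2)
        (auto simp: judgement_def list_encode_Cons pcons_def simp del: list_encode.simps)
  qed
next
  case (eval_Mn f n xs)
  have "\<forall>m \<in> {..<n}. \<exists>L. certificate L \<and> (\<exists>y. jd f (m # xs) (Suc y) \<in> set L)" using eval_Mn by blast
  from bchoice[OF this] obtain Ls where Ls: "\<And>m. m < n \<Longrightarrow> certificate (Ls m) \<and> (\<exists>y. jd f (m # xs) (Suc y) \<in> set (Ls m))"
    by auto
  obtain L0 where L0: "certificate L0" "jd f (n # xs) 0 \<in> set L0" using eval_Mn by auto
  let ?L = "L0 @ concat (map Ls [0..<n])"
  show ?case
  proof (rule certificate_exI[of ?L])
    show "certificate ?L" using L0 Ls by (intro certificate_append certificate_concat) auto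
    have *: "\<exists>k \<in> set ?L. pfst k = rcode f \<and> pfst (psnd k) = pcons m (list_encode xs) \<and> 0 < psnd (psnd k)" if m: "m < n" for m
    proof -
      obtain y where "jd f (m # xs) (Suc y) \<in> set (Ls m)" using Ls[OF m] by auto
      then have "jd f (m # xs) (Suc y) \<in> set ?L" using m by auto
      then show ?thesis by (rule bexI[rotated]) (auto simp: judgement_def list_encode_Cons simp del: list_encode.simps)
    qed
    have "jd f (n # xs) 0 \<in> set ?L" using L0 by simp
    then show "justified (jd (Mn f) xs n) (set ?L)"
      unfolding justified_def using *
      by (intro disjI2[OF disjI2[OF disjI2[OF disjI2[OF disjI2]]]])
        (auto simp: judgement_def list_encode_Cons simp del: list_encode.simps set_append)
  qed
qed

lemma list_code_cases:
  obtains xs where "l = list_encode xs" by (metis list_decode_inverse)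

lemma judgement_collapse: "judgement (pfst k) (pfst (psnd k)) (psnd (psnd k)) = k"
  by (simp add: judgement_def)

text \<open>A certificate may also contain judgements about numbers that code no machine. They do no
  harm: the clause selected by the tag of \<open>rcode r\<close> uses only premises about codes of
  the parts of r or of r itself.\<close>

lemma certificate_sound: "certificate L \<Longrightarrow> jd r xs y \<in> set L \<Longrightarrow> eval r xs y"
proof (induction L arbitrary: r xs y)
  case (Cons j L)
  show ?case
  proof (cases "jd r xs y \<in> set L")
    case True then show ?thesis using Cons by auto
  next
    case False
    then have j: "j = jd r xs y" and J: "justified (jd r xs y) (set L)" using Cons by auto
    have IH: "\<And>r xs y. jd r xs y \<in> set L \<Longrightarrow> eval r xs y" using Cons by auto
    show ?thesis
    proof (cases r)
      case Zero then show ?thesis using J by (auto simp: justified_def judgement_def intro: eval_Zero)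
    next
      case Succ then show ?thesis using J
        by (cases xs) (auto simp: justified_def judgement_def pnth list_encode_Cons intro: eval_Succ simp del: list_encode.simps)
    next
      case (Proj i) then show ?thesis using J
        by (auto simp: justified_def judgement_def pnth intro: eval_Proj)
    next
      case (Comp f gs)
      then obtain k where k: "k \<in> set L" "pfst k = rcode f" "psnd (psnd k) = y"
        "length (list_decode (pfst (psnd k))) = length gs"
        "\<And>i. i < length gs \<Longrightarrow> judgement (rcode (gs ! i)) (list_encode xs) (pnth (pfst (psnd k)) i) \<in> set L"
        using J by (auto simp: justified_def judgement_def pnth)
      obtain ys where ys: "pfst (psnd k) = list_encode ys" using list_code_cases .
      have "jd f ys y = k" using judgement_collapse[of k] k ys by simp
      then show ?thesis unfolding Comp using k ys by (intro eval_Comp[of ys]) (auto intro!: IH simp: pnth)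
    next
      case (Prim f g)
      have "0 < list_encode xs" using J Prim by (auto simp: justified_def judgement_def)
      then obtain n zs where xs: "xs = n # zs" by (cases xs) auto
      show ?thesis
      proof (cases n)
        case 0
        then have "jd f zs y \<in> set L" using J Prim xs
          by (auto simp: justified_def judgement_def list_encode_Cons pcons_def simp del: list_encode.simps)
        then show ?thesis using IH Prim xs 0 by (auto intro: eval_Prim0)
      next
        case (Suc m)
        then obtain k where k: "k \<in> set L" "pfst k = rcode r" "pfst (psnd k) = list_encode (m # zs)"
          "jd g (m # psnd (psnd k) # zs) y \<in> set L" using J Prim xs
          by (auto simp: justified_def judgement_def list_encode_Cons pcons_def simp del: list_encode.simps)
        have "jd r (m # zs) (psnd (psnd k)) = k" using judgement_collapse[of k] k by simp
        then show ?thesis using eval_PrimS[OF IH IH, of f g m zs "psnd (psnd k)" y] k Prim xs Suc by simp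
      qed
    next
      case (Mn f)
      then have a: "jd f (y # xs) 0 \<in> set L" and b: "\<And>m. m < y \<Longrightarrow> \<exists>k \<in> set L. pfst k = rcode f \<and>
        pfst (psnd k) = list_encode (m # xs) \<and> 0 < psnd (psnd k)" using J
        by (auto simp: justified_def judgement_def list_encode_Cons simp del: list_encode.simps)
      have "\<exists>v. eval f (m # xs) (Suc v)" if m: "m < y" for m
      proof -
        obtain k where k: "k \<in> set L" "pfst k = rcode f" "pfst (psnd k) = list_encode (m # xs)" "0 < psnd (psnd k)"
          using b[OF m] by auto
        obtain v where v: "psnd (psnd k) = Suc v" using k(4) gr0_implies_Suc by auto
        have "jd f (m # xs) (Suc v) = k" using judgement_collapse[of k] k v by simp
        then show ?thesis using IH k(1) by blast
      qed
      then show ?thesis unfolding Mn using IH[OF a] by (intro eval_Mn) auto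
    qed
  qed
qed simp

text \<open>Halting in diagonal form: machine n applied to its own number yields 0, and s is a coded
  derivation of this.\<close>

definition halts_in :: "nat \<Rightarrow> nat \<Rightarrow> bool" where
  "halts_in n s \<longleftrightarrow> certificate (list_decode s) \<and> judgement n (list_encode [n]) 0 \<in> set (list_decode s)"

lemma decidable_halts_in:
  assumes "computable f" "computable g"
  shows "decidable_pred (\<lambda>x. halts_in (f x) (g x))"
  unfolding halts_in_def judgement_def list_encode_Cons list_encode.simps(1)
  by (intro decidable_intros decidable_certificate computable_intros assms)

lemma halts_in_rcode: "(\<exists>s. halts_in (rcode r) s) \<longleftrightarrow> eval r [rcode r] 0"
proof
  show "\<exists>s. halts_in (rcode r) s \<Longrightarrow> eval r [rcode r] 0"
    unfolding halts_in_def using certificate_sound by blast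
  assume "eval r [rcode r] 0"
  from certificate_complete[OF this] obtain L where "certificate L" "jd r [rcode r] 0 \<in> set L" by auto
  then have "halts_in (rcode r) (list_encode L)" unfolding halts_in_def by simp
  then show "\<exists>s. halts_in (rcode r) s" ..
qed

lemma undecidable_halting: "\<not> decidable_pred (\<lambda>n. \<exists>s. halts_in n s)"
proof
  assume "decidable_pred (\<lambda>n. \<exists>s. halts_in n s)"
  then obtain r where r: "\<And>n. eval r [n] (if \<exists>s. halts_in n s then 1 else 0)"
    unfolding decidable_pred_def computable_def by blast
  \<comment> \<open>Minimisation over a dummy argument: q returns 0 at n when the supposed decider
    answers 0 there, and diverges otherwise. At its own code it contradicts the decider.\<close>
  define q where "q = Mn (Comp r [Proj 1])"
  have e: "eval (Comp r [Proj 1]) [m, n] (if \<exists>s. halts_in n s then 1 else 0)" for m n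
    by (rule eval_Comp1[OF _ r]) (auto intro: eval_Proj')
  have "eval q [n] 0 \<longleftrightarrow> \<not> (\<exists>s. halts_in n s)" for n
  proof
    assume "eval q [n] 0"
    then have "eval (Comp r [Proj 1]) [0, n] 0" unfolding q_def by (cases rule: eval.cases) auto
    from eval_deterministic[OF this e] show "\<not> (\<exists>s. halts_in n s)" by (auto split: if_splits)
  next
    assume "\<not> (\<exists>s. halts_in n s)"
    then show "eval q [n] 0" unfolding q_def using e[of 0 n] by (intro eval_Mn) auto
  qed
  then show False using halts_in_rcode[of q] by blast
qed

section \<open>The free group of rank two and its tree\<close>

declare add_bit_eq_xor [simp del] mult_bit_eq_and [simp del]

text \<open>The first component is true for u, which changes the height, and false for r; the second
  is true for the generator and false for its inverse.\<close>

type_synonym gen = "bool \<times> bool"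

definition flip :: "gen \<Rightarrow> gen" where "flip s = (fst s, \<not> snd s)"

lemma flip_flip [simp]: "flip (flip s) = s" by (simp add: flip_def)
lemma flip_neq [simp]: "flip s \<noteq> s" "s \<noteq> flip s" by (auto simp: flip_def prod_eq_iff)
lemma flip_eq_iff: "flip s = t \<longleftrightarrow> s = flip t" by (metis flip_flip)
lemma flip_inject [simp]: "flip s = flip t \<longleftrightarrow> s = t" by (metis flip_flip)

definition reduced :: "gen list \<Rightarrow> bool" where "reduced = successively (\<lambda>s t. t \<noteq> flip s)"

text \<open>Words are kept last letter first, so that right multiplication by a generator acts at
  the head, with at most one cancellation.\<close>

fun push :: "gen \<Rightarrow> gen list \<Rightarrow> gen list" where
  "push s [] = [s]"
| "push s (t # w) = (if t = flip s then w else s # t # w)"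

lemma reduced_Nil [simp]: "reduced []" by (simp add: reduced_def)
lemma reduced_single [simp]: "reduced [s]" by (simp add: reduced_def)
lemma reduced_Cons2 [simp]: "reduced (s # t # w) \<longleftrightarrow> t \<noteq> flip s \<and> reduced (t # w)" by (simp add: reduced_def)
lemma reduced_tl: "reduced (s # w) \<Longrightarrow> reduced w" by (cases w) auto

lemma reduced_push: "reduced w \<Longrightarrow> reduced (push s w)"
  by (cases w) (auto dest: reduced_tl)

lemma push_reduced: "reduced (s # w) \<Longrightarrow> push s w = s # w"
  by (cases w) auto

lemma push_flip: "reduced w \<Longrightarrow> push s (push (flip s) w) = w"
proof (cases w)
  case (Cons t w')
  assume "reduced w"
  then show ?thesis using Cons push_reduced[of s w'] by (auto simp: flip_eq_iff)
qed simp

lemma reduced_fold_push: "reduced v \<Longrightarrow> reduced (fold push w v)"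
  by (induction w arbitrary: v) (auto intro: reduced_push)

lemma fold_push_reduced: "reduced w \<Longrightarrow> fold push (rev w) [] = w"
proof (induction w)
  case (Cons s w) then show ?case using reduced_tl push_reduced by simp
qed simp

text \<open>The core of associativity. If \<open>push\<close> cancels, then k starts with the
  inverse of s, and the outer \<open>push s\<close> on the right-hand side undoes exactly that
  letter.\<close>

lemma fold_push_push:
  assumes "reduced k" "reduced h"
  shows "fold push (rev (push s k)) h = push s (fold push (rev k) h)"
  using assms push_flip[OF reduced_fold_push, of h s "rev (tl k)"] by (cases k) simp_all

lemma reduced_rev: "reduced (rev w) \<longleftrightarrow> reduced w"
proof -
  have "(\<lambda>s t. s \<noteq> flip t) = (\<lambda>s t. t \<noteq> flip s)" using flip_eq_iff by (intro ext) metis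
  then show ?thesis unfolding reduced_def successively_rev by (rule arg_cong)
qed

lemma reduced_map_flip: "reduced (map flip w) \<longleftrightarrow> reduced w"
  by (induction w rule: induct_list012) (simp_all, simp add: flip_eq_iff)

typedef fg = "{w. reduced w}" by (rule exI[of _ "[]"]) simp

lemma reduced_Rep [simp]: "reduced (Rep_fg x)" using Rep_fg by auto

instantiation fg :: group_add
begin

definition "0 = Abs_fg []"
definition "x + y = Abs_fg (fold push (rev (Rep_fg y)) (Rep_fg x))"
definition "- x = Abs_fg (rev (map flip (Rep_fg x)))"
definition "x - y = x + - (y :: fg)"

lemma Rep_zero: "Rep_fg 0 = []" by (simp add: zero_fg_def Abs_fg_inverse)
lemma Rep_plus: "Rep_fg (x + y) = fold push (rev (Rep_fg y)) (Rep_fg x)"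
  by (simp add: plus_fg_def Abs_fg_inverse reduced_fold_push)
lemma Rep_uminus: "Rep_fg (- x) = rev (map flip (Rep_fg x))"
  by (simp add: uminus_fg_def Abs_fg_inverse reduced_rev reduced_map_flip)

instance
proof
  fix a b c :: fg
  have *: "fold push (rev (fold push w k)) h = fold push w (fold push (rev k) h)"
    if "reduced h" "reduced k" for w k h
    using that
  proof (induction w arbitrary: k)
    case (Cons s w) then show ?case using fold_push_push[of k h s] by (simp add: reduced_push)
  qed simp
  show "a + b + c = a + (b + c)"
    by (rule Rep_fg_inject[THEN iffD1]) (simp add: Rep_plus *)
  show "a + 0 = a" by (rule Rep_fg_inject[THEN iffD1]) (simp add: Rep_plus Rep_zero)
  show "0 + a = a"
    by (rule Rep_fg_inject[THEN iffD1]) (simp add: Rep_plus Rep_zero fold_push_reduced)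
  have right: "x + - x = 0" for x :: fg
  proof -
    have "fold push (map flip w) w = []" for w by (induction w) auto
    then show ?thesis by (intro Rep_fg_inject[THEN iffD1]) (simp add: Rep_plus Rep_zero Rep_uminus)
  qed
  have "- (- a) = a"
    by (rule Rep_fg_inject[THEN iffD1]) (simp add: Rep_uminus rev_map comp_def)
  then show "- a + a = 0" using right[of "- a"] by simp
  show "a + - b = a - b" by (simp add: minus_fg_def)
qed

end

definition gn :: "gen \<Rightarrow> fg" where "gn s = Abs_fg [s]"

lemma Rep_gn: "Rep_fg (gn s) = [s]" by (simp add: gn_def Abs_fg_inverse)
lemma Rep_plus_gn: "Rep_fg (x + gn s) = push s (Rep_fg x)" by (simp add: Rep_plus Rep_gn)
lemma uminus_gn [simp]: "- gn s = gn (flip s)"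
  by (rule Rep_fg_inject[THEN iffD1]) (simp add: Rep_uminus Rep_gn)
lemma gn_inject [simp]: "gn s = gn t \<longleftrightarrow> s = t" by (metis Rep_gn list.inject)
lemma gn_neq_0 [simp]: "gn s \<noteq> 0" "0 \<noteq> gn s" by (metis Rep_gn Rep_zero list.distinct(1))+
lemma gn_flip_cancel [simp]: "gn s + gn (flip s) = 0" "gn (flip s) + gn s = 0"
  by (metis uminus_gn add.right_inverse, metis uminus_gn add.left_inverse)
lemma gn_flip_cancel_left [simp]: "gn s + (gn (flip s) + x) = x" "gn (flip s) + (gn s + x) = x"
  by (simp_all add: add.assoc[symmetric])

lemma fg_induct [case_names zero plus_gn]:
  assumes "P 0" "\<And>x t. P x \<Longrightarrow> P (x + gn t)"
  shows "P x"
proof -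
  have "reduced w \<Longrightarrow> P (Abs_fg w)" for w
  proof (induction w)
    case Nil then show ?case using assms(1) by (simp add: zero_fg_def)
  next
    case (Cons s w)
    then have "Abs_fg (s # w) = Abs_fg w + gn s"
      by (intro Rep_fg_inject[THEN iffD1]) (simp add: Rep_plus_gn Abs_fg_inverse push_reduced reduced_tl[of s])
    then show ?case using Cons assms(2) reduced_tl by metis
  qed
  from this[of "Rep_fg x"] show ?thesis by (simp add: Rep_fg_inverse)
qed

text \<open>The elements whose reduced word begins with s: the half-tree beyond the edge from 0 to the
  neighbour of direction s. Reduced words are stored last letter first.\<close>
definition cone :: "gen \<Rightarrow> fg set" where "cone s = {x. Rep_fg x \<noteq> [] \<and> last (Rep_fg x) = s}"

lemma zero_notin_cone [simp]: "0 \<notin> cone s" by (simp add: cone_def Rep_zero)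
lemma gn_in_cone [simp]: "gn s \<in> cone t \<longleftrightarrow> s = t" by (simp add: cone_def Rep_gn)
lemma cone_disjoint: "x \<in> cone s \<Longrightarrow> x \<in> cone t \<Longrightarrow> s = t" by (simp add: cone_def)
text \<open>A half-tree is joined to its complement by a single edge, here the one between 0 and
  \<open>gn s\<close>. All later crossing arguments rest on this.\<close>

lemma cone_change:
  "(x \<in> cone s \<longleftrightarrow> x + gn t \<notin> cone s) \<longleftrightarrow> x = 0 \<and> t = s \<or> x = gn s \<and> t = flip s"
proof (cases "Rep_fg x")
  case Nil
  then have "x = 0" by (metis Rep_fg_inject Rep_zero)
  then show ?thesis by auto
next
  case (Cons r w)
  then have x0: "x \<noteq> 0" by (metis Rep_zero list.distinct(1))
  show ?thesis
  proof (cases "r = flip t")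
    case False
    then have "x \<noteq> gn s \<or> t \<noteq> flip s" using Cons Rep_gn[of s] by auto
    then show ?thesis using False Cons x0 by (auto simp: cone_def Rep_plus_gn)
  next
    case True
    then have p: "Rep_fg (x + gn t) = w" using Cons by (simp add: Rep_plus_gn)
    have "x = gn s \<longleftrightarrow> r = s \<and> w = []" using Cons Rep_gn[of s] by (metis Rep_fg_inject list.inject)
    then show ?thesis using True Cons x0 p by (auto simp: cone_def)
  qed
qed

lemma cone_enter: "x \<notin> cone s \<Longrightarrow> x + gn t \<in> cone s \<Longrightarrow> x = 0 \<and> t = s"
  using cone_change[of x s t] by auto
lemma cone_exit: "x \<in> cone s \<Longrightarrow> x + gn t \<notin> cone s \<Longrightarrow> x = gn s \<and> t = flip s"
  using cone_change[of x s t] by auto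

text \<open>Left translation by \<open>gn s\<close> maps the edge between 0 and
  \<open>gn (flip s)\<close> to the edge between \<open>gn s\<close> and 0. Along a path both sides
  of the equivalence therefore change at the same steps; the induction follows such a path from
  0.\<close>

lemma gn_plus_in_cone: "gn s + y \<in> cone s \<longleftrightarrow> y \<notin> cone (flip s)"
proof (induction y rule: fg_induct)
  case (plus_gn y t)
  have 1: "gn s + y = 0 \<longleftrightarrow> y = gn (flip s)" by (metis gn_flip_cancel(1) gn_flip_cancel_left(2) add.right_neutral)
  have 2: "gn s + y = gn s \<longleftrightarrow> y = 0" by (metis add.right_neutral add_left_imp_eq)
  show ?case
    using cone_change[of "gn s + y" s t] cone_change[of y "flip s" t] plus_gn 1 2
    by (auto simp: add.assoc)
qed simp

lemma gn_plus_in_cone': "y \<in> cone t \<Longrightarrow> t \<noteq> flip s \<Longrightarrow> gn s + y \<in> cone s"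
  using gn_plus_in_cone cone_disjoint by blast

fun gsum :: "gen list \<Rightarrow> fg" where
  "gsum [] = 0"
| "gsum (s # w) = gn s + gsum w"

lemma gsum_append [simp]: "gsum (v @ w) = gsum v + gsum w" by (induction v) (auto simp: add.assoc)

text \<open>Ping-pong: without cancellation each letter maps the cone of the next one into its
  own.\<close>

lemma reduced_gsum_cone: "reduced (s # w) \<Longrightarrow> gsum (s # w) \<in> cone s"
proof (induction w arbitrary: s)
  case (Cons t w)
  then have "gsum (t # w) \<in> cone t" "t \<noteq> flip s" by auto
  then show ?case using gn_plus_in_cone' by simp
qed simp

definition gword :: "fg \<Rightarrow> gen list" where "gword x = rev (Rep_fg x)"

lemma gsum_gword [simp]: "gsum (gword x) = x"
proof -
  have "gsum (rev w) = Abs_fg w" if "reduced w" for w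
    using that
  proof (induction w)
    case (Cons s w)
    then have "Abs_fg (s # w) = Abs_fg w + gn s"
      by (intro Rep_fg_inject[THEN iffD1]) (simp add: Rep_plus_gn Abs_fg_inverse push_reduced reduced_tl[of s])
    then show ?case using Cons reduced_tl by simp
  qed (simp add: zero_fg_def)
  then show ?thesis by (simp add: gword_def Rep_fg_inverse)
qed

lemma Rep_gsum: "Rep_fg (gsum w) = fold push w []"
proof -
  have "Rep_fg (x + gsum w) = fold push w (Rep_fg x)" for x
    by (induction w arbitrary: x) (auto simp: add.assoc[symmetric] Rep_plus_gn)
  from this[of 0] show ?thesis by (simp add: Rep_zero)
qed

lemma bit_add_self [simp]: "x + x = (0 :: bit)" by (cases x) (simp_all flip: one_add_one)
lemma bit_add_self_left [simp]: "x + (x + y) = (y :: bit)" by (simp flip: add.assoc)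

section \<open>Heights and the function behind the form\<close>

definition step_height :: "gen \<Rightarrow> int" where
  "step_height s = (if fst s then if snd s then 1 else - 1 else 0)"

fun height :: "gen list \<Rightarrow> int" where
  "height [] = 0"
| "height (s # w) = step_height s + height w"

lemma height_append [simp]: "height (v @ w) = height v + height w" by (induction v) auto

text \<open>Height i names the machine and the excess \<open>j - i - 1\<close> the coded
  computation. The strict inequality has a second task: the condition fails when r is read at or
  above the final height.\<close>

definition stage :: "int \<Rightarrow> int \<Rightarrow> bool" where
  "stage i j \<longleftrightarrow> 0 \<le> i \<and> i < j \<and> halts_in (nat i) (nat (j - i - 1))"

text \<open>Here j is the final height, fixed in advance, and i the height at which the rest of the
  word is read.\<close>

fun chi_from :: "int \<Rightarrow> int \<Rightarrow> gen list \<Rightarrow> bit" where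
  "chi_from j i [] = 0"
| "chi_from j i (s # w) = (if fst s then 0 else of_bool (stage i j)) + chi_from j (i + step_height s) w"

lemma chi_from_append: "chi_from j i (v @ w) = chi_from j i v + chi_from j (i + height v) w"
  by (induction v arbitrary: i) (simp_all add: add.assoc)

definition chi :: "fg \<Rightarrow> bit" where
  "chi x = chi_from (height (gword x)) 0 (gword x)"

lemma step_height_flip [simp]: "step_height (flip s) = - step_height s"
  by (simp add: step_height_def flip_def)

lemma height_fold_push: "height (rev (fold push w v)) = height (rev v) + height w"
proof (induction w arbitrary: v)
  case (Cons s w)
  have "height (rev (push s v)) = height (rev v) + step_height s" by (cases v) auto
  then show ?case using Cons by simp
qed simp

lemma height_gword_gsum: "height (gword (gsum w)) = height w"
  using height_fold_push[of w "[]"] by (simp add: gword_def Rep_gsum)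

text \<open>Any word for the element may be used, reduced or not: r and its inverse count alike and
  keep the height, so a cancelling pair contributes the same bit twice, and letters u contribute
  nothing. The word algorithm and the evaluation at conjugates of r both depend on this.\<close>

lemma chi_gsum: "chi (gsum w) = chi_from (height w) 0 w"
proof -
  have "chi_from j 0 (rev (fold push w v)) = chi_from j 0 (rev v @ w)" for j v
  proof (induction w arbitrary: v)
    case (Cons s w)
    have "chi_from j 0 (rev (push s v)) = chi_from j 0 (rev v @ [s])"
    proof (cases v)
      case (Cons t v')
      show ?thesis
      proof (cases "t = flip s")
        case True
        have "fst (flip s) = fst s" by (simp add: flip_def)
        moreover have "\<not> fst s \<Longrightarrow> step_height s = 0" by (simp add: step_height_def)
        ultimately show ?thesis using Cons True by (cases "fst s") (simp_all add: chi_from_append add.assoc)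
      qed (use Cons in simp)
    qed simp
    moreover have "height (rev (push s v)) = height (rev v @ [s])" by (cases v) auto
    ultimately have "chi_from j 0 (rev (push s v) @ w) = chi_from j 0 ((rev v @ [s]) @ w)"
      unfolding chi_from_append by simp
    then show ?case using Cons by simp
  qed simp
  from this[of _ "[]"] show ?thesis
    unfolding chi_def height_gword_gsum by (simp add: gword_def Rep_gsum)
qed

section \<open>A central extension of a lamplighter group\<close>

definition sd :: "'a set \<Rightarrow> 'a set \<Rightarrow> 'a set" where "sd A B = {x. (x \<in> A) \<noteq> (x \<in> B)}"

definition tr :: "fg \<Rightarrow> fg set \<Rightarrow> fg set" where "tr h A = (\<lambda>x. h + x) ` A"

lemma mem_sd [simp]: "x \<in> sd A B \<longleftrightarrow> (x \<in> A) \<noteq> (x \<in> B)" by (simp add: sd_def)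
lemma mem_tr: "x \<in> tr h A \<longleftrightarrow> - h + x \<in> A"
  by (force simp: tr_def add.assoc[symmetric] image_iff)
lemma finite_sd [simp]: "finite A \<Longrightarrow> finite B \<Longrightarrow> finite (sd A B)"
  by (rule finite_subset[of _ "A \<union> B"]) auto
lemma finite_tr [simp]: "finite (tr h A) \<longleftrightarrow> finite A"
  unfolding tr_def by (rule finite_image_iff) (simp add: inj_on_def)
lemma tr_empty [simp]: "tr h {} = {}" by (simp add: tr_def)
lemma tr_0 [simp]: "tr 0 A = A" by (simp add: tr_def)
lemma tr_tr: "tr h (tr k A) = tr (h + k) A" by (simp add: tr_def image_image add.assoc)
lemma tr_sd: "tr h (sd A B) = sd (tr h A) (tr h B)" by (auto simp: mem_tr)
lemma sd_empty [simp]: "sd A {} = A" "sd {} A = A" by (auto simp: sd_def)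
lemma sd_self [simp]: "sd A A = {}" by (auto simp: sd_def)
lemma sd_assoc: "sd (sd A B) C = sd A (sd B C)" by (auto simp: sd_def)
lemma sd_commute: "sd A B = sd B A" by (auto simp: sd_def)

text \<open>The common part is counted twice and vanishes in characteristic two; symmetric
  difference is addition of configurations.\<close>

lemma sum_sd:
  fixes \<phi> :: "'a \<Rightarrow> bit"
  assumes "finite A" "finite B"
  shows "sum \<phi> (sd A B) = sum \<phi> A + sum \<phi> B"
proof -
  have "sum \<phi> A = sum \<phi> (A - B) + sum \<phi> (A \<inter> B)" "sum \<phi> B = sum \<phi> (B - A) + sum \<phi> (A \<inter> B)"
    using assms by (metis sum.Int_Diff add.commute, metis sum.Int_Diff add.commute inf_commute)
  moreover have "sd A B = (A - B) \<union> (B - A)" by auto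
  then have "sum \<phi> (sd A B) = sum \<phi> (A - B) + sum \<phi> (B - A)"
    using assms sum.union_disjoint[of "A - B" "B - A" \<phi>] by auto
  ultimately show ?thesis by (simp add: ac_simps)
qed

lemma sum_tr: "sum \<phi> (tr h A) = (\<Sum>x \<in> A. \<phi> (h + x))"
  unfolding tr_def by (rule sum.reindex_cong[where l = "\<lambda>x. h + x"]) (auto simp: inj_on_def)

definition beta :: "fg set \<Rightarrow> fg set \<Rightarrow> bit" where
  "beta f g = (\<Sum>u \<in> f. \<Sum>v \<in> g. chi (- u + v))"

lemma beta_sd_left: "finite f \<Longrightarrow> finite g \<Longrightarrow> beta (sd f g) k = beta f k + beta g k"
  unfolding beta_def by (rule sum_sd)
lemma beta_sd_right: "finite g \<Longrightarrow> finite k \<Longrightarrow> beta f (sd g k) = beta f g + beta f k"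
  unfolding beta_def by (simp add: sum_sd sum.distrib)
lemma beta_tr: "beta (tr h f) (tr h g) = beta f g"
proof -
  have "- (h + u) + (h + v) = - u + v" for u v
    by (simp only: minus_add add.assoc minus_add_cancel)
  then show ?thesis unfolding beta_def sum_tr by simp
qed
lemma beta_empty [simp]: "beta {} g = 0" "beta f {} = 0" by (simp_all add: beta_def)

type_synonym gel = "fg set \<times> fg \<times> bit"

text \<open>The central extension by the group of order two of the lamplighter group over the free
  group: lamp configuration, position, central coordinate.\<close>
definition Gam :: "gel monoid" where
  "Gam = \<lparr>carrier = {(f, h, e). finite f},
    monoid.mult = (\<lambda>(f, h, e) (g, k, d). (sd f (tr h g), h + k, e + d + beta f (tr h g))),
    one = ({}, 0, 0)\<rparr>"

lemma Gam_simps [simp]: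
  "(f, h, e) \<in> carrier Gam \<longleftrightarrow> finite f"
  "(f, h, e) \<otimes>\<^bsub>Gam\<^esub> (g, k, d) = (sd f (tr h g), h + k, e + d + beta f (tr h g))"
  "\<one>\<^bsub>Gam\<^esub> = ({}, 0, 0)"
  by (simp_all add: Gam_def)

text \<open>Associativity is the cocycle condition for the form, which follows from bilinearity and
  invariance under \<open>tr\<close>.\<close>

lemma group_Gam: "group Gam"
proof (rule groupI)
  fix x y z assume "x \<in> carrier Gam" "y \<in> carrier Gam" "z \<in> carrier Gam"
  moreover obtain f h a g k b i l c where "x = (f, h, a)" "y = (g, k, b)" "z = (i, l, c)"
    by (metis prod_cases3)
  ultimately show "x \<otimes>\<^bsub>Gam\<^esub> y \<otimes>\<^bsub>Gam\<^esub> z = x \<otimes>\<^bsub>Gam\<^esub> (y \<otimes>\<^bsub>Gam\<^esub> z)"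
    by (simp add: tr_tr[symmetric] tr_sd sd_assoc add.assoc beta_sd_left beta_sd_right beta_tr add.left_commute)
next
  fix x assume x: "x \<in> carrier Gam"
  obtain f h a where f: "x = (f, h, a)" by (metis prod_cases3)
  \<comment> \<open>In the product the form contributes \<open>beta f f\<close> by invariance; the
    central coordinate of the inverse cancels it in advance.\<close>
  show "\<exists>y \<in> carrier Gam. y \<otimes>\<^bsub>Gam\<^esub> x = \<one>\<^bsub>Gam\<^esub>"
    by (rule bexI[of _ "(tr (- h) f, - h, a + beta f f)"]) (use x f in \<open>auto simp: beta_tr ac_simps\<close>)
qed (auto simp: ac_simps)

interpretation Gam: group Gam by (rule group_Gam)

section \<open>Generators, words and their values\<close>

type_synonym letter = "bool \<times> gen \<times> bool \<times> bool"

definition pre :: "letter \<Rightarrow> bool" where "pre l = fst l"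
definition dir :: "letter \<Rightarrow> gen" where "dir l = fst (snd l)"
definition post :: "letter \<Rightarrow> bool" where "post l = fst (snd (snd l))"
definition cen :: "letter \<Rightarrow> bool" where "cen l = snd (snd (snd l))"

lemma letter_simps [simp]: "pre (a, s, b, c) = a" "dir (a, s, b, c) = s" "post (a, s, b, c) = b" "cen (a, s, b, c) = c"
  by (simp_all add: pre_def dir_def post_def cen_def)

text \<open>Letters switch the lamp at the current position, walk, switch the lamp at the new position,
  and multiply by a power of the central involution.\<close>
definition lset :: "letter \<Rightarrow> fg set" where
  "lset l = {x. x = 0 \<and> pre l \<or> x = gn (dir l) \<and> post l}"
definition gl :: "letter \<Rightarrow> gel" where "gl l = (lset l, gn (dir l), of_bool (cen l))"

lemma finite_lset [simp]: "finite (lset l)"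
  by (rule finite_subset[of _ "{0, gn (dir l)}"]) (auto simp: lset_def)

lemma inj_gl: "inj gl"
proof (rule injI)
  fix x y assume e: "gl x = gl y"
  then have d: "dir x = dir y" and c: "cen x = cen y" and l: "lset x = lset y"
    by (auto simp: gl_def of_bool_eq_iff)
  have "0 \<in> lset x \<longleftrightarrow> 0 \<in> lset y" "gn (dir x) \<in> lset x \<longleftrightarrow> gn (dir x) \<in> lset y" using l by auto
  then have "pre x = pre y" "post x = post y" using d by (auto simp: lset_def)
  then show "x = y" using d c by (simp add: prod_eq_iff pre_def dir_def post_def cen_def)
qed

fun hw :: "letter list \<Rightarrow> fg" where
  "hw [] = 0" | "hw (l # w) = gn (dir l) + hw w"
fun lw :: "letter list \<Rightarrow> fg set" where
  "lw [] = {}" | "lw (l # w) = sd (lset l) (tr (gn (dir l)) (lw w))"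

definition ev :: "letter list \<Rightarrow> gel" where "ev w = word_eval Gam (map gl w)"

lemma ev_Nil [simp]: "ev [] = \<one>\<^bsub>Gam\<^esub>" by (simp add: ev_def word_eval_def)
lemma ev_Cons: "ev (l # w) = gl l \<otimes>\<^bsub>Gam\<^esub> ev w" by (simp add: ev_def word_eval_def)
lemma gl_carrier [simp]: "gl l \<in> carrier Gam" by (simp add: gl_def)
lemma ev_carrier [simp]: "ev w \<in> carrier Gam" by (induction w) (simp_all add: ev_Cons del: Gam_simps(3))
lemma ev_append: "ev (u @ v) = ev u \<otimes>\<^bsub>Gam\<^esub> ev v"
  by (induction u) (simp_all add: ev_Cons Gam.m_assoc del: Gam_simps)
lemma hw_append [simp]: "hw (u @ v) = hw u + hw v" by (induction u) (auto simp: add.assoc)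
lemma lw_append: "lw (u @ v) = sd (lw u) (tr (hw u) (lw v))"
  by (induction u) (simp_all add: tr_sd tr_tr sd_assoc)
lemma finite_lw [simp]: "finite (lw w)" by (induction w) auto

lemma ev_eq: "\<exists>e. ev w = (lw w, hw w, e)"
  by (induction w) (auto simp: ev_Cons gl_def)
lemma hw_gsum: "hw w = gsum (map dir w)" by (induction w) auto

lemma ev_surj: assumes "g \<in> carrier Gam" shows "\<exists>w. ev w = g"
proof -
  have mult: "\<exists>w. ev w = x \<otimes>\<^bsub>Gam\<^esub> y" if "\<exists>w. ev w = x" "\<exists>w. ev w = y" for x y
    using that ev_append by metis
  obtain s :: gen where True by simp
  have walk: "\<exists>w. ev w = ({}, h, 0)" for h
  proof (induction h rule: fg_induct)
    case zero show ?case by (rule exI[of _ "[]"]) simp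
  next
    case (plus_gn h t)
    then obtain u where "ev u = ({}, h, 0)" by auto
    then have "ev (u @ [(False, t, False, False)]) = ({}, h + gn t, 0)"
      by (simp add: ev_append ev_Cons gl_def lset_def)
    then show ?case ..
  qed
  \<comment> \<open>A step forth and back with one central mark represents z.\<close>
  have "ev [(False, s, False, False), (False, flip s, False, True)] = ({}, 0, 1)"
    by (simp add: ev_Cons gl_def lset_def)
  then have central: "\<exists>w. ev w = ({}, 0, e)" for e
    using walk[of 0] by (cases e) auto
  have "ev [(True, s, False, False), (False, flip s, False, False)] = ({0}, 0, 0)"
    by (simp add: ev_Cons gl_def lset_def)
  then have lamp0: "\<exists>w. ev w = ({0}, 0, 0)" ..
  have lamp: "\<exists>w. ev w = ({x}, 0, 0)" for x
    using mult[OF mult[OF walk[of x] lamp0] walk[of "- x"]] by (simp add: tr_def)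
  have base: "\<exists>w. ev w = (f, 0, e)" if "finite f" for f e
    using that
  proof (induction f arbitrary: e rule: finite_induct)
    case (insert x f)
    \<comment> \<open>Multiplying by the lamp x from the left costs one value of the form, which is
      built into the central coordinate of the rest.\<close>
    have "\<exists>w. ev w = (f, 0, e + beta {x} f)" using insert by blast
    from mult[OF lamp[of x] this] have "\<exists>w. ev w = (sd {x} f, 0, e)" by (simp add: ac_simps)
    moreover have "sd {x} f = insert x f" using insert by auto
    ultimately show ?case by simp
  qed (rule central)
  obtain f h e where g: "g = (f, h, e)" by (metis prod_cases3)
  show ?thesis using mult[OF base[of f e] walk[of h]] assms g by simp
qed

definition conj_geo :: "letter list \<Rightarrow> bool" where
  "conj_geo w \<longleftrightarrow> (\<forall>w'. conjugate Gam (ev w') (ev w) \<longrightarrow> length w \<le> length w')"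

lemma conjugate_iff:
  "conjugate Gam x y \<longleftrightarrow> x \<in> carrier Gam \<and> y \<in> carrier Gam \<and>
    (\<exists>g \<in> carrier Gam. g \<otimes>\<^bsub>Gam\<^esub> y = x \<otimes>\<^bsub>Gam\<^esub> g)"
proof -
  have "y = inv\<^bsub>Gam\<^esub> g \<otimes>\<^bsub>Gam\<^esub> x \<otimes>\<^bsub>Gam\<^esub> g \<longleftrightarrow> g \<otimes>\<^bsub>Gam\<^esub> y = x \<otimes>\<^bsub>Gam\<^esub> g"
    if "x \<in> carrier Gam" "y \<in> carrier Gam" "g \<in> carrier Gam" for g
    using that by (metis Gam.inv_solve_left Gam.m_assoc Gam.m_closed Gam.inv_closed)
  then show ?thesis unfolding conjugate_def by blast
qed

lemma conjugate_trans: "conjugate Gam x y \<Longrightarrow> conjugate Gam y z \<Longrightarrow> conjugate Gam x z"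
  unfolding conjugate_iff by (metis Gam.m_assoc Gam.m_closed)

lemma conjugate_rotate: "conjugate Gam (ev (u @ v)) (ev (v @ u))"
  unfolding conjugate_iff using ev_append[of u] ev_append[of v] ev_carrier
  by (metis Gam.m_assoc)

lemma conj_geo_rotate: "conj_geo (u @ v) \<longleftrightarrow> conj_geo (v @ u)"
proof -
  have "conj_geo (v @ u)" if "conj_geo (u @ v)" for u v
    unfolding conj_geo_def
  proof (intro allI impI)
    fix w' assume "conjugate Gam (ev w') (ev (v @ u))"
    from conjugate_trans[OF this conjugate_rotate] that show "length (v @ u) \<le> length w'"
      unfolding conj_geo_def by fastforce
  qed
  then show ?thesis by blast
qed

text \<open>Toggling the central mark of the first letter multiplies by z at no cost in length. The
  empty word has no letter to mark, which is why the shortest words need separate treatment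
  later.\<close>

lemma fix_central:
  assumes "u \<noteq> []" "lw u = lw v" "hw u = hw v"
  shows "\<exists>u'. length u' = length u \<and> ev u' = ev v"
proof -
  obtain l u0 where u: "u = l # u0" using assms by (cases u) auto
  obtain e d where e: "ev u = (lw u, hw u, e)" "ev v = (lw v, hw v, d)" using ev_eq by metis
  let ?u' = "(pre l, dir l, post l, \<not> cen l) # u0"
  have "lset (pre l, dir l, post l, \<not> cen l) = lset l" by (simp add: lset_def)
  then have "ev ?u' = (lw u, hw u, e + 1)"
    using e(1) ev_eq[of u0] unfolding u by (auto simp: ev_Cons gl_def ac_simps)
  moreover have "d = e \<or> d = e + 1" by (cases d; cases e) auto
  ultimately show ?thesis using e assms u by (metis length_Cons)
qed

text \<open>The criterion behind all shortenings: only lamps and position of a rotation have to be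
  reproduced, since the central coordinate can be repaired.\<close>

lemma conj_geo_shorten:
  assumes "conj_geo (u @ v)" "lw w = lw (v @ u)" "hw w = hw (v @ u)" "w \<noteq> []"
  shows "length u + length v \<le> length w"
proof -
  obtain w' where w': "length w' = length w" "ev w' = ev (v @ u)" using fix_central[OF assms(4,2,3)] by auto
  then have "conjugate Gam (ev w') (ev (u @ v))" using conjugate_rotate[of v u] by simp
  then show ?thesis using assms(1) w' unfolding conj_geo_def by fastforce
qed

lemma ex_letter:
  assumes "A \<subseteq> {0, gn s}"
  shows "\<exists>l. dir l = s \<and> lset l = A"
  by (rule exI[of _ "(0 \<in> A, s, gn s \<in> A, False)"]) (use assms in \<open>auto simp: lset_def\<close>)

lemma lset_subset: "lset l \<subseteq> {0, gn (dir l)}" by (auto simp: lset_def)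

text \<open>A branch entered twice can be visited once: closed words commute up to the central coordinate.\<close>
lemma conj_geo_no_revisit:
  assumes "conj_geo (u @ v)" "v @ u = l1 # U @ l2 # V @ l3 # R" "dir l2 = flip (dir l1)" "dir l3 = dir l1"
    "hw U = 0" "hw V = 0"
  shows False
proof -
  let ?s = "dir l1"
  let ?A = "sd (lset l1) (sd (tr (gn ?s) (lset l2)) (lset l3))"
  have "?A \<subseteq> {0, gn ?s}"
  proof -
    have "lset l2 \<subseteq> {0, gn (flip ?s)}" using lset_subset[of l2] assms(3) by simp
    then have "tr (gn ?s) (lset l2) \<subseteq> {gn ?s, 0}" unfolding tr_def by (auto dest!: subsetD)
    then show ?thesis using lset_subset[of l1] lset_subset[of l3] assms(4) by (auto simp: subset_iff)
  qed
  then obtain l where l: "dir l = ?s" "lset l = ?A" using ex_letter by blast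
  \<comment> \<open>V is done at the near end first, then the edge is crossed once, then U is done
    at the far end. The three crossings switch only lamps at the ends of this edge, so one letter l
    can carry all their switchings; two letters are saved.\<close>
  let ?w = "V @ l # U @ R"
  have "hw ?w = hw (v @ u)" unfolding assms(2) using assms l by simp
  moreover have "lw ?w = lw (v @ u)" unfolding assms(2)
    using assms l by (simp add: lw_append tr_sd tr_tr) (auto simp: sd_def)
  ultimately have "length u + length v \<le> length ?w" using conj_geo_shorten[OF assms(1)] by blast
  moreover have "length u + length v = length (v @ u)" by simp
  ultimately show False unfolding assms(2) by simp
qed

text \<open>The lamp at the leaf is switched twice or not at all, so the two letters affect only the
  lamp at the base point; the next letter takes this over in its first switch.\<close>

lemma conj_geo_no_dark_leaf:
  assumes "conj_geo (u @ v)" "v @ u = l1 # l2 # R" "dir l2 = flip (dir l1)" "post l1 = pre l2" "R \<noteq> []"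
  shows False
proof -
  obtain r R' where R: "R = r # R'" using assms by (cases R) auto
  let ?r = "(pre r \<noteq> (pre l1 \<noteq> post l2), dir r, post r, cen r)"
  have l: "sd (lset l1) (tr (gn (dir l1)) (lset l2)) = {x. x = 0 \<and> pre l1 \<noteq> post l2}"
  proof -
    have "- gn (dir l1) + x = 0 \<longleftrightarrow> x = gn (dir l1)" for x
      by (metis add.left_inverse add_left_imp_eq)
    moreover have "- gn (dir l1) + x = gn (flip (dir l1)) \<longleftrightarrow> x = 0" for x
      by (metis add.right_neutral add_left_imp_eq uminus_gn)
    ultimately show ?thesis using assms(3,4) by (auto simp: lset_def mem_tr)
  qed
  have r: "lset ?r = sd {x. x = 0 \<and> pre l1 \<noteq> post l2} (lset r)" by (auto simp: lset_def)
  have "lw (v @ u) = sd (sd (lset l1) (tr (gn (dir l1)) (lset l2))) (lw R)"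
    unfolding assms(2) using assms(3) by (simp add: tr_sd tr_tr sd_assoc)
  then have "lw (?r # R') = lw (v @ u)" unfolding l R using r by (simp add: sd_assoc)
  moreover have "hw (?r # R') = hw (v @ u)" unfolding assms(2) R using assms(3) by simp
  ultimately have "length u + length v \<le> length (?r # R')" using conj_geo_shorten[OF assms(1)] by blast
  moreover have "length u + length v = length (v @ u)" by simp
  ultimately show False unfolding assms(2) R by simp
qed

section \<open>Periodic walks in the tree\<close>

lemma mod_eq_shift:
  fixes i j n :: int
  assumes "i mod n = j mod n"
  shows "i = j + (i div n - j div n) * n"
proof -
  have "(i div n - j div n) * n = i div n * n - j div n * n" by (rule left_diff_distrib)
  then show ?thesis using div_mult_mod_eq[of i n] div_mult_mod_eq[of j n] assms by linarith
qed

lemma finite_int_bounded: "finite F \<Longrightarrow> \<exists>M. \<forall>q \<in> F. \<bar>q\<bar> < (M :: int)"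
proof (induction rule: finite_induct)
  case (insert x F)
  then obtain M where M: "\<forall>q \<in> F. \<bar>q\<bar> < M" by blast
  show ?case by (rule exI[of _ "max M (\<bar>x\<bar> + 1)"]) (use M in force)
qed simp

lemma add_left_eq_self: "d + x = x \<Longrightarrow> d = (0 :: fg)"
  by (metis add_right_imp_eq add_0_left)

lemma first_switch:
  fixes A :: "int \<Rightarrow> bool"
  assumes "i < j" "\<not> A i" "A j"
  shows "\<exists>k. i \<le> k \<and> k < j \<and> A (k + 1) \<and> (\<forall>l. i \<le> l \<and> l \<le> k \<longrightarrow> \<not> A l)"
proof -
  define N where "N = nat (j - i)"
  have N: "j = i + int N" using assms(1) by (simp add: N_def)
  have "\<exists>k. k < N \<and> A (i + int (Suc k)) \<and> (\<forall>l \<le> k. \<not> A (i + int l))"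
    using ex_least_nat_less[of "\<lambda>k. A (i + int k)" N] assms N by auto
  then obtain k where k: "k < N" "A (i + int (Suc k))" "\<forall>l \<le> k. \<not> A (i + int l)" by blast
  have "\<not> A l" if "i \<le> l \<and> l \<le> i + int k" for l
    using k(3)[rule_format, of "nat (l - i)"] that by (auto simp: nat_le_iff)
  then show ?thesis using k N by (intro exI[of _ "i + int k"]) (auto simp: ac_simps)
qed

lemma last_switch:
  fixes A :: "int \<Rightarrow> bool"
  assumes "i < j" "\<not> A i" "A j"
  shows "\<exists>k. i \<le> k \<and> k < j \<and> \<not> A k \<and> (\<forall>l. k < l \<and> l \<le> j \<longrightarrow> A l)"
proof -
  obtain k where k: "- j \<le> k" "k < - i" "\<not> A (- (k + 1))" "\<forall>l. - j \<le> l \<and> l \<le> k \<longrightarrow> A (- l)"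
    using first_switch[of "- j" "- i" "\<lambda>l. \<not> A (- l)"] assms by auto
  have "A l" if "- (k + 1) < l \<and> l \<le> j" for l using k(4)[rule_format, of "- l"] that by auto
  then show ?thesis using k by (intro exI[of _ "- (k + 1)"]) auto
qed

definition half :: "fg \<Rightarrow> gen \<Rightarrow> fg set" where "half x s = {y. - x + y \<in> cone s}"

lemma half_enter: "y \<notin> half x s \<Longrightarrow> y + gn t \<in> half x s \<Longrightarrow> y = x \<and> t = s"
  using cone_enter[of "- x + y" s t] by (auto simp: half_def add.assoc) (metis add.right_neutral add_minus_cancel)
lemma half_exit: "y \<in> half x s \<Longrightarrow> y + gn t \<notin> half x s \<Longrightarrow> y = x + gn s \<and> t = flip s"
  using cone_exit[of "- x + y" s t] by (auto simp: half_def add.assoc) (metis add_minus_cancel)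
lemma half_base [simp]: "x \<notin> half x s" by (simp add: half_def)
lemma half_next_iff [simp]: "x + gn t \<in> half x s \<longleftrightarrow> t = s" by (simp add: half_def)

locale walk =
  fixes P :: "int \<Rightarrow> fg" and D :: "int \<Rightarrow> gen"
  assumes step: "P (i + 1) = P i + gn (D i)"
begin

lemma enter_first:
  assumes "i < j" "P i \<notin> half x s" "P j \<in> half x s"
  shows "\<exists>k. i \<le> k \<and> k < j \<and> P k = x \<and> D k = s \<and> (\<forall>l. i \<le> l \<and> l \<le> k \<longrightarrow> P l \<notin> half x s)"
proof -
  obtain k where k: "i \<le> k" "k < j" "P (k + 1) \<in> half x s" "\<forall>l. i \<le> l \<and> l \<le> k \<longrightarrow> P l \<notin> half x s"
    using first_switch[of i j "\<lambda>i. P i \<in> half x s"] assms by auto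
  then have "P k \<notin> half x s" by simp
  then show ?thesis using half_enter[of "P k" x s "D k"] k step[of k] by auto
qed

lemma exit_first:
  assumes "i < j" "P i \<in> half x s" "P j \<notin> half x s"
  shows "\<exists>k. i \<le> k \<and> k < j \<and> P k = x + gn s \<and> D k = flip s \<and> P (k + 1) \<notin> half x s \<and>
    (\<forall>l. i \<le> l \<and> l \<le> k \<longrightarrow> P l \<in> half x s)"
proof -
  obtain k where k: "i \<le> k" "k < j" "P (k + 1) \<notin> half x s" "\<forall>l. i \<le> l \<and> l \<le> k \<longrightarrow> P l \<in> half x s"
    using first_switch[of i j "\<lambda>i. P i \<notin> half x s"] assms by auto
  then have "P k \<in> half x s" by simp
  then show ?thesis using half_exit[of "P k" x s "D k"] k step[of k] by auto
qed

lemma exit_last: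
  assumes "i < j" "P i \<in> half x s" "P j \<notin> half x s"
  shows "\<exists>k. i \<le> k \<and> k < j \<and> P k = x + gn s \<and> D k = flip s \<and>
    (\<forall>l. k < l \<and> l \<le> j \<longrightarrow> P l \<notin> half x s)"
proof -
  obtain k where k: "i \<le> k" "k < j" "P k \<in> half x s" "\<forall>l. k < l \<and> l \<le> j \<longrightarrow> P l \<notin> half x s"
    using last_switch[of i j "\<lambda>i. P i \<notin> half x s"] assms by auto
  then have "P (k + 1) \<notin> half x s" by simp
  then show ?thesis using half_exit[OF k(3), of "D k"] k step[of k] by auto
qed

lemma walk_gsum: "P (i + int N) = P i + gsum (map (\<lambda>k. D (i + int k)) [0..<N])"
proof (induction N)
  case (Suc N)
  have "P (i + int (Suc N)) = P (i + int N) + gn (D (i + int N))"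
    using step[of "i + int N"] by (simp add: ac_simps)
  then show ?case using Suc by (simp add: add.assoc)
qed simp

text \<open>Directions without immediate reversal spell a reduced word, which stays in the cone of
  its first letter.\<close>

lemma no_backtrack_cone:
  assumes "i < j" "\<And>m. i < m \<Longrightarrow> m < j \<Longrightarrow> D m \<noteq> flip (D (m - 1))"
  shows "- P i + P j \<in> cone (D i)"
proof -
  obtain N where N: "j = i + int (Suc N)" using assms(1) zless_iff_Suc_zadd[of i j] by auto
  let ?w = "map (\<lambda>k. D (i + int k)) [0..<Suc N]"
  have "reduced ?w" unfolding reduced_def successively_conv_nth
  proof (intro allI impI)
    fix k assume k: "Suc k < length ?w"
    have *: "?w ! k = D (i + int k)" "?w ! Suc k = D (i + int (Suc k))"
      using k by (simp_all del: upt_Suc add: nth_map nth_upt)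
    have "i + int (Suc k) - 1 = i + int k" by simp
    then show "?w ! Suc k \<noteq> flip (?w ! k)"
      using assms(2)[of "i + int (Suc k)"] k N unfolding * by simp
  qed
  moreover have "?w = D i # map (\<lambda>k. D (i + int k)) [Suc 0..<Suc N]"
    by (simp add: upt_conv_Cons del: upt_Suc)
  ultimately have "gsum ?w \<in> cone (D i)" using reduced_gsum_cone by metis
  moreover have "P j = P i + gsum ?w" unfolding N by (rule walk_gsum)
  ultimately show ?thesis by simp
qed

text \<open>A walk that enters a half-tree and is later found outside must have turned round inside,
  for otherwise its directions would form a reduced word. These turning points are the leaves where
  a second walk can be caught.\<close>

lemma backtrack_after:
  assumes "i < j" "P j \<notin> half (P i) (D i)"
  shows "\<exists>m. D m = flip (D (m - 1)) \<and> P m \<in> half (P i) (D i)"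
proof -
  have i1: "P (i + 1) \<in> half (P i) (D i)" by (simp add: step)
  then have "i + 1 < j" using assms by (cases "i + 1 = j") auto
  from exit_first[OF this i1 assms(2)] obtain k where k: "i + 1 \<le> k" "P (k + 1) \<notin> half (P i) (D i)"
    "\<forall>l. i + 1 \<le> l \<and> l \<le> k \<longrightarrow> P l \<in> half (P i) (D i)" by blast
  show ?thesis
  proof (rule ccontr)
    assume "\<not> ?thesis"
    then have "- P i + P (k + 1) \<in> cone (D i)" using k by (intro no_backtrack_cone) auto
    then show False using k(2) by (simp add: half_def)
  qed
qed

lemma backtrack_before:
  assumes "j < i" "P j \<in> half (P i) (D i)"
  shows "\<exists>m. D m = flip (D (m - 1)) \<and> P m \<notin> half (P i) (D i)"
proof -
  from exit_last[OF assms] obtain k where k: "k < i" "P k = P i + gn (D i)"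
    "\<forall>l. k < l \<and> l \<le> i \<longrightarrow> P l \<notin> half (P i) (D i)" by auto
  show ?thesis
  proof (rule ccontr)
    assume "\<not> ?thesis"
    then have "- P k + P (i + 1) \<in> cone (D k)" using k by (intro no_backtrack_cone) auto
    then show False using k(2) by (simp add: step)
  qed
qed

end

locale periodic_walk = walk P D for P D +
  fixes n :: int and h :: fg
  assumes n_pos: "0 < n" and D_period: "D (i + n) = D i" and P_period: "P (i + n) = h + P i"
begin

lemma D_periods: "D (i + q * n) = D i"
proof (induction q rule: int_induct[where k = 0])
  case (step1 q) then show ?case using D_period[of "i + q * n"] by (simp add: algebra_simps)
next
  case (step2 q) then show ?case using D_period[of "i + (q - 1) * n"] by (simp add: algebra_simps)
qed simp

lemma D_mod: "i mod n = j mod n \<Longrightarrow> D i = D j"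
proof -
  assume "i mod n = j mod n"
  from mod_eq_shift[OF this] show ?thesis using D_periods by metis
qed

text \<open>\<open>P (q * n) - P 0\<close> serves as the q-th power of h, for integers q of either
  sign.\<close>

lemma P_periods: "P (i + q * n) = P (q * n) - P 0 + P i"
proof (induction q rule: int_induct[where k = 0])
  case (step1 q)
  have "P (i + (q + 1) * n) = h + P (i + q * n)" using P_period[of "i + q * n"] by (simp add: algebra_simps)
  moreover have "P ((q + 1) * n) = h + P (q * n)" using P_period[of "q * n"] by (simp add: algebra_simps)
  ultimately show ?case using step1 by (simp add: add.assoc add_diff_eq[symmetric])
next
  case (step2 q)
  have "h + P (i + (q - 1) * n) = P (i + q * n)" using P_period[of "i + (q - 1) * n"] by (simp add: algebra_simps)
  moreover have "h + P ((q - 1) * n) = P (q * n)" using P_period[of "(q - 1) * n"] by (simp add: algebra_simps)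
  moreover have "h + P ((q - 1) * n) - P 0 + P i = h + (P ((q - 1) * n) - P 0 + P i)"
    by (simp only: add_diff_eq[symmetric] add.assoc)
  ultimately have "h + P (i + (q - 1) * n) = h + (P ((q - 1) * n) - P 0 + P i)"
    using step2 by metis
  then show ?case by simp
qed simp

end

lemma periods_match:
  assumes "periodic_walk P D n h" "periodic_walk P' D' n' h"
  shows "P (q * n) - P 0 = P' (q * n') - P' 0"
proof -
  interpret a: periodic_walk P D n h by fact
  interpret b: periodic_walk P' D' n' h by fact
  show ?thesis
  proof (induction q rule: int_induct[where k = 0])
    case (step1 q)
    have "P ((q + 1) * n) = h + P (q * n)" "P' ((q + 1) * n') = h + P' (q * n')"
      using a.P_period[of "q * n"] b.P_period[of "q * n'"] by (simp_all add: algebra_simps)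
    then show ?case using step1 by (simp add: add_diff_eq[symmetric])
  next
    case (step2 q)
    have "h + P ((q - 1) * n) = P (q * n)" "h + P' ((q - 1) * n') = P' (q * n')"
      using a.P_period[of "(q - 1) * n"] b.P_period[of "(q - 1) * n'"] by (simp_all add: algebra_simps)
    then have "h + (P ((q - 1) * n) - P 0) = h + (P' ((q - 1) * n') - P' 0)"
      using step2 by (simp add: add_diff_eq)
    then show ?case by simp
  qed simp
qed

locale simple_walk = periodic_walk +
  assumes simple: "P i = P j \<Longrightarrow> D i = D j \<Longrightarrow> i mod n = j mod n"
begin

text \<open>After time m the walk is in the half-tree at the leaf in direction \<open>D m\<close>
  and can come back only through the directed edge crossed at time \<open>m - 1\<close>. By
  simplicity such an arrival is congruent to m, and the walk leaves at once. Before m the argument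
  is reversed in time.\<close>

lemma leaf_visited_once:
  assumes m: "D m = flip (D (m - 1))" and j: "P j = P m"
  shows "j mod n = m mod n"
proof -
  let ?y = "P m" and ?t = "D m"
  have Dm: "D (m - 1) = flip ?t" using m by simp
  have Pm: "P (m - 1) = ?y + gn ?t" using step[of "m - 1"] Dm by (simp add: add.assoc)
  consider "j = m" | "m < j" | "j < m" by linarith
  then show ?thesis
  proof cases
    case 2
    have m1: "P (m + 1) \<in> half ?y ?t" by (simp add: step)
    have "P j \<notin> half ?y ?t" using j by simp
    moreover have "m + 1 < j" using 2 m1 calculation by (cases "m + 1 = j") auto
    ultimately obtain k where k: "m + 1 \<le> k" "k < j" "P k = ?y + gn ?t" "D k = flip ?t"
      "\<forall>l. k < l \<and> l \<le> j \<longrightarrow> P l \<notin> half ?y ?t" using exit_last[OF _ m1] by blast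
    have "k mod n = (m - 1) mod n" using k Pm Dm by (intro simple) auto
    then have km: "(k + 1) mod n = m mod n" by (metis diff_add_cancel mod_add_left_eq)
    have "k + 1 = j"
    proof (rule ccontr)
      assume "k + 1 \<noteq> j"
      then have "P (k + 1 + 1) \<notin> half ?y ?t" using k by auto
      moreover have "P (k + 1) = ?y" using step[of k] k by (simp add: add.assoc)
      moreover have "D (k + 1) = ?t" using D_mod[OF km] .
      ultimately show False using step[of "k + 1"] by simp
    qed
    then show ?thesis using km by simp
  next
    case 3
    have "P j \<notin> half ?y ?t" "P (m - 1) \<in> half ?y ?t" using j Pm by auto
    moreover have "j < m - 1" using 3 calculation by (cases "j = m - 1") auto
    ultimately obtain k where k: "j \<le> k" "k < m - 1" "P k = ?y" "D k = ?t"
      "\<forall>l. j \<le> l \<and> l \<le> k \<longrightarrow> P l \<notin> half ?y ?t" using enter_first by blast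
    have km: "k mod n = m mod n" using k by (intro simple) auto
    have "k = j"
    proof (rule ccontr)
      assume "k \<noteq> j"
      then have "P (k - 1) \<notin> half ?y ?t" using k by auto
      moreover have "(k - 1) mod n = (m - 1) mod n" using km by (metis mod_diff_left_eq)
      then have "D (k - 1) = flip ?t" using D_mod[of "k - 1" "m - 1"] Dm by simp
      then have "P (k - 1) = ?y + gn ?t" using step[of "k - 1"] k by (simp add: add.assoc)
      ultimately show False by simp
    qed
    then show ?thesis using km by simp
  qed simp
qed

end

text \<open>If a second walk with the same translation visits all the leaves of a simple walk,
  it crosses every directed edge that the simple walk crosses.\<close>
locale two_walks = simple_walk P D n h + other: periodic_walk P' D' n' h for P D n h P' D' n' +
  assumes torsion: "h = 0 \<or> (\<forall>q > 0. P (q * n) \<noteq> P 0)"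
    and leaves: "D m = flip (D (m - 1)) \<Longrightarrow> \<exists>j. P' j = P m"
begin

lemma other_periods: "P' (j + q * n') = P (q * n) - P 0 + P' j"
  using other.P_periods[of j q] periods_match[OF periodic_walk_axioms other.periodic_walk_axioms, of q] by simp

lemma translation_inj: "h \<noteq> 0 \<Longrightarrow> inj (\<lambda>q. P (q * n) - P 0)"
proof (rule injI)
  fix a b assume h: "h \<noteq> 0" and ab: "P (a * n) - P 0 = P (b * n) - P 0"
  have *: "a \<le> b" if ab: "P (a * n) = P (b * n)" for a b
  proof (rule ccontr)
    assume "\<not> a \<le> b"
    then have "P ((a - b) * n) \<noteq> P 0" using torsion h by auto
    moreover have "P (b * n + (a - b) * n) = P ((a - b) * n) - P 0 + P (b * n)" by (rule P_periods)
    moreover have "b * n + (a - b) * n = a * n" by (simp add: algebra_simps)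
    ultimately have "P ((a - b) * n) - P 0 + P (b * n) = P (b * n)" using ab by simp
    from add_left_eq_self[OF this] show False using \<open>P ((a - b) * n) \<noteq> P 0\<close> by simp
  qed
  have "P (a * n) = P (b * n)" using ab by (metis diff_add_cancel)
  then show "a = b" using *[of a b] *[of b a] by simp
qed

text \<open>The two positions are joined by a path of fixed shape, translated by powers of h. Each
  step of this path meets the edge in question for at most two exponents, because distinct exponents
  give distinct powers.\<close>

lemma same_ends:
  assumes "h \<noteq> 0"
  shows "finite {q. (P (q * n) \<in> half x s) \<noteq> (P' (q * n') \<in> half x s)}"
proof -
  let ?H = "\<lambda>q. P (q * n) - P 0"
  have "finite {q. (?H q + P 0 \<in> half x s) \<noteq> (?H q + (P 0 + y) \<in> half x s)}" for y
  proof (induction y rule: fg_induct)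
    case (plus_gn y t)
    let ?A = "?H -` {x - (P 0 + y), x + gn s - (P 0 + y)}"
    have "{q. (?H q + P 0 \<in> half x s) \<noteq> (?H q + (P 0 + (y + gn t)) \<in> half x s)} \<subseteq>
        {q. (?H q + P 0 \<in> half x s) \<noteq> (?H q + (P 0 + y) \<in> half x s)} \<union> ?A"
    proof
      fix q assume q: "q \<in> {q. (?H q + P 0 \<in> half x s) \<noteq> (?H q + (P 0 + (y + gn t)) \<in> half x s)}"
      show "q \<in> {q. (?H q + P 0 \<in> half x s) \<noteq> (?H q + (P 0 + y) \<in> half x s)} \<union> ?A"
      proof (cases "(?H q + P 0 \<in> half x s) = (?H q + (P 0 + y) \<in> half x s)")
        case True
        let ?z = "?H q + (P 0 + y)"
        have "(?z \<in> half x s) \<noteq> (?z + gn t \<in> half x s)" using q True by (auto simp: add.assoc)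
        then have "?z = x \<or> ?z = x + gn s" using half_enter[of ?z x s t] half_exit[of ?z x s t] by blast
        then have "?H q = x - (P 0 + y) \<or> ?H q = x + gn s - (P 0 + y)" by (metis add_diff_cancel)
        then show ?thesis by auto
      qed auto
    qed
    moreover have "finite ?A" using translation_inj[OF assms] by (intro finite_vimageI) auto
    ultimately show ?case using plus_gn by (meson finite_UnI finite_subset)
  qed simp
  from this[of "- P 0 + P' 0"] show ?thesis
    using other_periods[of 0] by (simp add: add.assoc[symmetric])
qed

text \<open>It suffices to find the second walk outside the half-tree C at some time and inside C
  later, since it can enter only through the edge in question. Leaves on either side, or the common
  behaviour towards both ends, provide these times.\<close>

lemma crosses: "\<exists>j. P' j = P i \<and> D' j = D i"
proof -
  let ?C = "half (P i) (D i)"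
  have goal: ?thesis if "a < b" "P' a \<notin> ?C" "P' b \<in> ?C" for a b
    using other.enter_first[OF that] by blast
  have lit_in: "\<exists>j. P' j \<in> ?C" if "i < j" "P j \<notin> ?C" for j
    using backtrack_after[OF that] leaves by metis
  have lit_out: "\<exists>j. P' j \<notin> ?C" if "j \<le> i" "P j \<in> ?C" for j
    using backtrack_before[of j i] that leaves half_base by (metis order_le_less)
  show ?thesis
  proof (cases "h = 0")
    case True
    have "P (i + n) \<notin> ?C" using P_period[of i] True by simp
    then obtain b where b: "P' b \<in> ?C" using lit_in[of "i + n"] n_pos by auto
    have "P (i + 1 - n) = P (i + 1)" using P_period[of "i + 1 - n"] True by simp
    then have "P (i + 1 - n) \<in> ?C" by (simp add: step)
    then obtain a where a: "P' a \<notin> ?C" using lit_out[of "i + 1 - n"] n_pos by auto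
    \<comment> \<open>For h = 0 the second walk is closed; going back k periods puts the time
      outside C before the time inside.\<close>
    define k where "k = \<bar>a - b\<bar> + 1"
    have P0: "P (q * n) = P 0" for q
    proof (induction q rule: int_induct[where k = 0])
      case (step1 q) then show ?case using P_period[of "q * n"] True by (simp add: algebra_simps)
    next
      case (step2 q) then show ?case using P_period[of "(q - 1) * n"] True by (simp add: algebra_simps)
    qed simp
    then have "P' (a - k * n') = P' a" using other_periods[of a "- k"] P0[of "- k"] by simp
    moreover have "a - k * n' < b"
    proof -
      have "k * 1 \<le> k * n'" using other.n_pos by (intro mult_left_mono) (auto simp: k_def)
      then show ?thesis using k_def by linarith
    qed
    ultimately show ?thesis using goal[of "a - k * n'" b] a b by simp
  next
    case False
    from same_ends[OF False, of "P i" "D i"]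
    obtain Q where Q: "\<And>q. \<bar>q\<bar> \<ge> Q \<Longrightarrow> (P (q * n) \<in> ?C) = (P' (q * n') \<in> ?C)"
    proof -
      let ?F = "{q. (P (q * n) \<in> ?C) \<noteq> (P' (q * n') \<in> ?C)}"
      assume "finite ?F"
      then obtain M where M: "\<And>q. q \<in> ?F \<Longrightarrow> \<bar>q\<bar> < M" using finite_int_bounded by blast
      show thesis
      proof (rule that[of M])
        fix q assume "M \<le> \<bar>q\<bar>"
        then have "q \<notin> ?F" using M[of q] by linarith
        then show "(P (q * n) \<in> ?C) = (P' (q * n') \<in> ?C)" by simp
      qed
    qed
    have future: "\<exists>b > N. P' b \<in> ?C" if A1: "\<forall>j > i. P j \<in> ?C" for N
    proof -
      define q where "q = \<bar>Q\<bar> + \<bar>i\<bar> + \<bar>N\<bar> + 1"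
      have "q * 1 \<le> q * n" using n_pos by (intro mult_left_mono) (auto simp: q_def)
      moreover have "q * 1 \<le> q * n'" using other.n_pos by (intro mult_left_mono) (auto simp: q_def)
      ultimately have "i < q * n" "N < q * n'" using q_def by linarith+
      moreover have "Q \<le> \<bar>q\<bar>" unfolding q_def by linarith
      ultimately show ?thesis using A1 Q[of q] by blast
    qed
    have past: "\<exists>a < N. P' a \<notin> ?C" if B1: "\<forall>j \<le> i. P j \<notin> ?C" for N
    proof -
      define q where "q = \<bar>Q\<bar> + \<bar>i\<bar> + \<bar>N\<bar> + 1"
      have "q * 1 \<le> q * n" using n_pos by (intro mult_left_mono) (auto simp: q_def)
      moreover have "q * 1 \<le> q * n'" using other.n_pos by (intro mult_left_mono) (auto simp: q_def)
      ultimately have "- (q * n) \<le> i" "- (q * n') < N" using q_def by linarith+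
      then have "(- q) * n \<le> i" "(- q) * n' < N" by simp_all
      moreover have "Q \<le> \<bar>- q\<bar>" unfolding q_def by linarith
      ultimately show ?thesis using B1 Q[of "- q"] by blast
    qed
    consider "\<forall>j \<le> i. P j \<notin> ?C" | "\<forall>j > i. P j \<in> ?C" "\<not> (\<forall>j \<le> i. P j \<notin> ?C)"
      | j k where "j \<le> i" "P j \<in> ?C" "i < k" "P k \<notin> ?C" by blast
    then show ?thesis
    proof cases
      case 1
      have "\<exists>b. P' b \<in> ?C" using future lit_in by blast
      then obtain b where "P' b \<in> ?C" ..
      moreover obtain a where "a < b" "P' a \<notin> ?C" using past[OF 1] by blast
      ultimately show ?thesis using goal by blast
    next
      case 2
      then obtain a where "P' a \<notin> ?C" using lit_out by blast
      moreover obtain b where "b > a" "P' b \<in> ?C" using future[OF 2(1)] by blast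
      ultimately show ?thesis using goal by blast
    next
      case (3 j k)
      \<comment> \<open>The walk would leave C both before and after time i through the same
        directed edge. Simplicity makes the two times differ by a nonzero multiple of the period, so
        a nonzero power of h would be trivial.\<close>
      have ji: "j < i" using 3 half_base by (metis order_le_less)
      obtain k1 where k1: "k1 < i" "P k1 = P i + gn (D i)" "D k1 = flip (D i)"
        using exit_last[OF ji 3(2) half_base] by auto
      have i1: "P (i + 1) \<in> ?C" by (simp add: step)
      have "i + 1 < k" using 3 i1 by (cases "i + 1 = k") auto
      then obtain k2 where k2: "i + 1 \<le> k2" "P k2 = P i + gn (D i)" "D k2 = flip (D i)"
        using exit_last[OF _ i1 3(4)] by blast
      have "k1 mod n = k2 mod n" using k1 k2 by (intro simple) auto
      then have "k2 = k1 + (k2 div n - k1 div n) * n" using mod_eq_shift[of k2 n k1] by simp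
      moreover have "k2 div n - k1 div n \<noteq> 0" using calculation k1 k2 by auto
      moreover define q where "q = k2 div n - k1 div n"
      ultimately have q: "P (k1 + q * n) = P k1" "q \<noteq> 0" using k1 k2 by auto
      then have "P (q * n) - P 0 = P (0 * n) - P 0"
        using P_periods[of k1 q] add_left_eq_self[of "P (q * n) - P 0" "P k1"] by simp
      from injD[OF translation_inj[OF False] this] q(2) show ?thesis by simp
    qed
  qed
qed

text \<open>If the crossings chosen for two edges agree modulo n', the edges differ by a power of h,
  and simplicity identifies their phases. So phases of the simple walk inject into those of the
  other.\<close>

lemma period_le: "n \<le> n'"
proof -
  obtain J where J: "\<And>i. P' (J i) = P i \<and> D' (J i) = D i" using crosses by metis
  have "inj_on (\<lambda>i. J i mod n') {0..<n}"
  proof (rule inj_onI)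
    fix a b assume ab: "a \<in> {0..<n}" "b \<in> {0..<n}" "J a mod n' = J b mod n'"
    define q where "q = J a div n' - J b div n'"
    have "J a = J b + q * n'" unfolding q_def by (rule mod_eq_shift[OF ab(3)])
    then have "P a = P (b + q * n)" using J other_periods[of "J b" q] P_periods[of b q] by metis
    moreover have "D a = D (b + q * n)" using J \<open>J a = J b + q * n'\<close> other.D_periods[of "J b" q] D_periods[of b q] by metis
    ultimately have "a mod n = (b + q * n) mod n" by (rule simple)
    then show "a = b" using ab by simp
  qed
  moreover have "(\<lambda>i. J i mod n') ` {0..<n} \<subseteq> {0..<n'}" using other.n_pos by auto
  ultimately have "card {0..<n} \<le> card {0..<n'}" by (intro card_inj_on_le) auto
  then show ?thesis using other.n_pos by simp
qed

end

section \<open>Leaves of a simple walk are visited by all conjugate words\<close>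

declare sum_of_bool_eq [simp del]

text \<open>The letters and positions of the bi-infinite periodic continuation of a word.\<close>
definition vl :: "letter list \<Rightarrow> int \<Rightarrow> letter" where
  "vl v i = v ! nat (i mod int (length v))"

definition pp :: "letter list \<Rightarrow> int \<Rightarrow> fg" where
  "pp v i = (if 0 \<le> i then hw (map (vl v) [0..i - 1]) else - hw (map (vl v) [i..- 1]))"

lemma pp_0 [simp]: "pp v 0 = 0" by (simp add: pp_def)

lemma pp_step: "pp v (i + 1) = pp v i + gn (dir (vl v i))"
proof (cases "0 \<le> i")
  case True
  then show ?thesis using upto_rec2[of 0 i] by (simp add: pp_def)
next
  case False
  then have *: "[i..- 1] = i # [i + 1..- 1]" by (intro upto_rec1) simp
  have "pp v (i + 1) = - hw (map (vl v) [i + 1..- 1])"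
    using False by (cases "i = - 1") (auto simp: pp_def)
  then show ?thesis using False by (simp add: pp_def * minus_add add.assoc)
qed

lemma vl_nth: "i < length v \<Longrightarrow> vl v (int i) = v ! i"
  by (simp add: vl_def)

lemma pp_take: "i \<le> length v \<Longrightarrow> pp v (int i) = hw (take i v)"
proof (induction i)
  case (Suc i)
  then have "pp v (int i + 1) = hw (take i v) + gn (dir (v ! i))" by (simp add: pp_step vl_nth)
  then show ?case using Suc by (simp add: take_Suc_conv_app_nth add.commute)
qed simp

lemma vl_period: "vl v (i + int (length v)) = vl v i" by (simp add: vl_def)

lemma pp_period: "pp v (i + int (length v)) = hw v + pp v i"
proof (induction i rule: int_induct[where k = 0])
  case base then show ?case using pp_take[of "length v" v] by simp
next
  case (step1 i)
  then show ?case using pp_step[of v "i + int (length v)"] pp_step[of v i]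
    by (simp add: vl_period ac_simps)
next
  case (step2 i)
  have "pp v (i - 1 + int (length v)) + gn (dir (vl v (i - 1))) = hw v + pp v i"
    using pp_step[of v "i - 1 + int (length v)"] step2 vl_period[of v "i - 1"] by simp
  moreover have "pp v i = pp v (i - 1) + gn (dir (vl v (i - 1)))" using pp_step[of v "i - 1"] by simp
  ultimately have "pp v (i - 1 + int (length v)) + gn (dir (vl v (i - 1))) =
      hw v + pp v (i - 1) + gn (dir (vl v (i - 1)))" by (simp add: add.assoc)
  then show ?case by simp
qed

lemma periodic_walk_word:
  assumes "v \<noteq> []"
  shows "periodic_walk (\<lambda>i. k + pp v i) (\<lambda>i. dir (vl v i)) (int (length v)) (k + hw v - k)"
proof
  fix i
  show "k + pp v (i + 1) = k + pp v i + gn (dir (vl v i))" by (simp add: pp_step add.assoc)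
  show "dir (vl v (i + int (length v))) = dir (vl v i)" by (simp add: vl_period)
  show "k + pp v (i + int (length v)) = k + hw v - k + (k + pp v i)"
    unfolding pp_period by (metis add.assoc diff_add_cancel)
  show "0 < int (length v)" using assms by simp
qed

lemma lset_alt: "lset l = (if pre l then {0} else {}) \<union> (if post l then {gn (dir l)} else {})"
  by (auto simp: lset_def)

text \<open>A lamp switched several times is counted once per switching; modulo two this equals
  counting lit lamps.\<close>

lemma sum_tr_lw:
  "(\<Sum>x \<in> tr h (lw w). of_bool (x \<in> Y) :: bit) =
    (\<Sum>i\<in>{..<length w}. of_bool (pre (w ! i) \<and> h + hw (take i w) \<in> Y) +
      of_bool (post (w ! i) \<and> h + hw (take (Suc i) w) \<in> Y))"
proof (induction w arbitrary: h)
  case (Cons l w)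
  have "(\<Sum>x \<in> tr h (lset l). of_bool (x \<in> Y) :: bit) =
      of_bool (pre l \<and> h \<in> Y) + of_bool (post l \<and> h + gn (dir l) \<in> Y)"
    by (simp add: sum_tr lset_alt)
  then show ?case
    using Cons[of "h + gn (dir l)"]
    by (simp add: tr_sd sum_sd tr_tr sum.lessThan_Suc_shift add.assoc del: sum.lessThan_Suc)
qed simp

lemma lw_visited: "x \<in> lw w \<Longrightarrow> \<exists>j \<le> length w. x = hw (take j w)"
proof (induction w arbitrary: x)
  case (Cons l w)
  then consider "x = 0" | "x = gn (dir l)" | "- gn (dir l) + x \<in> lw w"
    by (auto simp: lset_def mem_tr)
  then show ?case
  proof cases
    case 3
    then obtain j where "j \<le> length w" "- gn (dir l) + x = hw (take j w)" using Cons by blast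
    moreover from this have "x = gn (dir l) + hw (take j w)" by (metis add_minus_cancel)
    ultimately show ?thesis by (intro exI[of _ "Suc j"]) auto
  qed (auto intro: exI[of _ 0] exI[of _ "Suc 0"])
qed simp

lemma sum_single:
  assumes "0 \<le> a" "a < int n"
  shows "(\<Sum>i\<in>{..<n}. of_bool (A i \<and> int i = a) :: bit) = of_bool (A (nat a))"
proof -
  have "(\<Sum>i\<in>{..<n}. of_bool (A i \<and> int i = a) :: bit) = (\<Sum>i\<in>{..<n}. if i = nat a then of_bool (A i) else 0)"
    using assms by (intro sum.cong) auto
  then show ?thesis using assms by (simp add: nat_less_iff)
qed

text \<open>The number of lit lamps in an orbit of the translation part is invariant modulo two under
  conjugation, so the leaves of a simple walk are visited by every conjugate word.\<close>
lemma conj_geo_if_simple: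
  assumes v: "v \<noteq> []"
    and simple: "\<And>i j. pp v i = pp v j \<Longrightarrow> dir (vl v i) = dir (vl v j) \<Longrightarrow>
      i mod int (length v) = j mod int (length v)"
    and lit: "\<And>m. dir (vl v m) = flip (dir (vl v (m - 1))) \<Longrightarrow> post (vl v (m - 1)) \<noteq> pre (vl v m)"
    and tors: "hw v = 0 \<or> (\<forall>q > 0. pp v (q * int (length v)) \<noteq> 0)"
  shows "conj_geo v"
  unfolding conj_geo_def
proof (intro allI impI)
  fix w assume "conjugate Gam (ev w) (ev v)"
  then obtain g where g: "g \<in> carrier Gam" "g \<otimes>\<^bsub>Gam\<^esub> ev v = ev w \<otimes>\<^bsub>Gam\<^esub> g" unfolding conjugate_iff by blast
  obtain \<phi> k d where \<phi>: "g = (\<phi>, k, d)" by (metis prod_cases3)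
  obtain e e' where e: "ev v = (lw v, hw v, e)" "ev w = (lw w, hw w, e')" using ev_eq by metis
  have fin: "finite \<phi>" and lamps: "sd \<phi> (tr k (lw v)) = sd (lw w) (tr (hw w) \<phi>)" and pos: "k + hw v = hw w + k"
    using g unfolding \<phi> e by auto
  define n where "n = int (length v)"
  \<comment> \<open>The walk of v is translated by the position k of the conjugator. Then it has the
    translation part of w, and the two walks can be compared.\<close>
  define P where "P = (\<lambda>i. k + pp v i)"
  define D where "D = (\<lambda>i. dir (vl v i))"
  define h where "h = hw w"
  have h: "k + hw v - k = h" unfolding h_def pos by (rule add_diff_cancel)
  have pw: "periodic_walk P D n h"
    using periodic_walk_word[OF v, of k] unfolding h by (simp only: P_def D_def n_def)
  interpret a: periodic_walk P D n h by (rule pw)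
  interpret a: simple_walk P D n h
  proof
    fix i j assume "P i = P j" "D i = D j"
    then show "i mod n = j mod n" using simple[of i j] by (simp add: P_def D_def n_def)
  qed
  have lit_lamp: "\<exists>x \<in> lw w. \<exists>q. x = P (m + q * n)" if m: "D m = flip (D (m - 1))" for m
  proof -
    \<comment> \<open>The orbit of the leaf under the powers of h. It is invariant under h and met
      by the walk of v only at times congruent to m.\<close>
    define Y where "Y = {x. \<exists>q. x = P (m + q * n)}"
    let ?\<sigma> = "\<lambda>f. \<Sum>x \<in> f. of_bool (x \<in> Y) :: bit"
    have X1: "h + x \<in> Y" if x: "x \<in> Y" for x
    proof -
      obtain q where "x = P (m + q * n)" using x by (auto simp: Y_def)
      then have "h + x = P (m + (q + 1) * n)" using a.P_period[of "m + q * n"] by (simp add: algebra_simps)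
      then show ?thesis by (auto simp: Y_def)
    qed
    have X2: "x \<in> Y" if x: "h + x \<in> Y" for x
    proof -
      obtain q where "h + x = P (m + q * n)" using x by (auto simp: Y_def)
      also have "\<dots> = h + P (m + (q - 1) * n)" using a.P_period[of "m + (q - 1) * n"] by (simp add: algebra_simps)
      finally have "x = P (m + (q - 1) * n)" by simp
      then show ?thesis by (auto simp: Y_def)
    qed
    have PX: "P i \<in> Y \<longleftrightarrow> i mod n = m mod n" for i
    proof
      assume "P i \<in> Y"
      then obtain q where q: "P i = P (m + q * n)" by (auto simp: Y_def)
      have "D (m + q * n) = flip (D (m + q * n - 1))"
        using m a.D_periods[of m q] a.D_periods[of "m - 1" q] by (simp add: algebra_simps)
      from a.leaf_visited_once[OF this q] show "i mod n = m mod n" by simp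
    next
      assume "i mod n = m mod n"
      from mod_eq_shift[OF this] show "P i \<in> Y" unfolding Y_def by (intro CollectI exI) (rule arg_cong)
    qed
    have npos: "0 < n" by (rule a.n_pos)
    have A: "k + hw (take i v) \<in> Y \<longleftrightarrow> int i = m mod n" if "i < length v" for i
      using PX[of "int i"] pp_take[of i v] that by (simp add: P_def n_def)
    have B: "k + hw (take (Suc i) v) \<in> Y \<longleftrightarrow> int i = (m - 1) mod n" if i: "i < length v" for i
    proof -
      have "k + hw (take (Suc i) v) \<in> Y \<longleftrightarrow> (int i + 1) mod n = m mod n"
        using PX[of "int (Suc i)"] pp_take[of "Suc i" v] i by (simp add: P_def add.commute)
      also have "\<dots> \<longleftrightarrow> int i mod n = (m - 1) mod n"
        by (metis add_diff_cancel_right' diff_add_cancel mod_add_left_eq mod_diff_left_eq)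
      finally show ?thesis using i by (simp add: n_def)
    qed
    have "?\<sigma> (tr k (lw v)) = (\<Sum>i\<in>{..<length v}. of_bool (pre (v ! i) \<and> int i = m mod n) +
        of_bool (post (v ! i) \<and> int i = (m - 1) mod n))"
      unfolding sum_tr_lw by (intro sum.cong refl arg_cong2[where f = "(+)"]) (auto simp: A B)
    also have "\<dots> = of_bool (pre (vl v m)) + of_bool (post (vl v (m - 1)))"
      unfolding sum.distrib using sum_single[of "m mod n" "length v" "\<lambda>i. pre (v ! i)"]
        sum_single[of "(m - 1) mod n" "length v" "\<lambda>i. post (v ! i)"] npos
      by (simp add: vl_def n_def)
    also have "\<dots> = 1" using lit[of m] m by (cases "pre (vl v m)"; cases "post (vl v (m - 1))") (auto simp: D_def)
    finally have "?\<sigma> (tr k (lw v)) = 1" .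
    \<comment> \<open>The lamps of the conjugator enter on both sides, once translated by h; as Y is
      invariant they have equal parity there and cancel.\<close>
    moreover have "?\<sigma> \<phi> + ?\<sigma> (tr k (lw v)) = ?\<sigma> (lw w) + ?\<sigma> (tr h \<phi>)"
      using lamps fin sum_sd[of \<phi> "tr k (lw v)" "\<lambda>x. of_bool (x \<in> Y)"] sum_sd[of "lw w" "tr h \<phi>" "\<lambda>x. of_bool (x \<in> Y)"]
      by (simp add: h_def)
    moreover have "?\<sigma> (tr h \<phi>) = ?\<sigma> \<phi>" 
    proof -
      have "h + x \<in> Y \<longleftrightarrow> x \<in> Y" for x using X1[of x] X2[of x] by blast
      then show ?thesis unfolding sum_tr by simp
    qed
    ultimately have "?\<sigma> (lw w) = 1" by (cases "?\<sigma> \<phi>"; cases "?\<sigma> (lw w)") simp_all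
    then have "\<exists>x \<in> lw w. x \<in> Y"
      by (metis (mono_tags, lifting) of_bool_eq(1) sum.neutral zero_neq_one)
    then show ?thesis unfolding Y_def by blast
  qed
  \<comment> \<open>An empty w would have h = 0. The walk of v would be closed, hence have a leaf,
    whose orbit the empty word would have to light.\<close>
  have w: "w \<noteq> []"
  proof
    assume "w = []"
    then have "h = 0" by (simp add: h_def)
    then have "- P 0 + P (0 + n) = 0" using a.P_period[of 0] by simp
    moreover have "- P 0 + P (0 + n) \<in> cone (D 0)" if "\<nexists>m. D m = flip (D (m - 1))"
      by (rule a.no_backtrack_cone) (use that a.n_pos in auto)
    ultimately obtain m where m: "D m = flip (D (m - 1))" by (metis zero_notin_cone)
    show False using lit_lamp[OF m] \<open>w = []\<close> by simp
  qed
  define n' where "n' = int (length w)"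
  have wk: "periodic_walk (pp w) (\<lambda>i. dir (vl w i)) n' h"
    using periodic_walk_word[OF w, of 0] by (simp add: n'_def h_def)
  interpret b: periodic_walk "pp w" "\<lambda>i. dir (vl w i)" n' h by (rule wk)
  interpret two_walks P D n h "pp w" "\<lambda>i. dir (vl w i)" n'
  proof
    show "h = 0 \<or> (\<forall>q > 0. P (q * n) \<noteq> P 0)"
    proof (cases "hw v = 0")
      case True then show ?thesis using h by simp
    next
      case False
      have "k + x = k \<longleftrightarrow> x = 0" for x by (metis add.right_neutral add_left_imp_eq)
      then show ?thesis using False tors by (auto simp: P_def n_def)
    qed
  next
    fix m assume "D m = flip (D (m - 1))"
    from lit_lamp[OF this] obtain j q where j: "j \<le> length w" "hw (take j w) = P (m + q * n)"
      using lw_visited by metis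
    \<comment> \<open>The lit lamp lies only in the orbit of the leaf; a shift by -q periods moves
      the visit to the leaf itself.\<close>
    have "pp w (int j + (- q) * n') = P ((- q) * n) - P 0 + pp w (int j)"
      using b.P_periods[of "int j" "- q"] periods_match[OF a.periodic_walk_axioms wk, of "- q"] by simp
    also have "\<dots> = P ((- q) * n) - P 0 + P (m + q * n)" using j pp_take by simp
    also have "\<dots> = P (m + q * n + (- q) * n)" by (rule a.P_periods[symmetric])
    finally show "\<exists>j. pp w j = P m" by auto
  qed
  show "length v \<le> length w" using period_le by (simp add: n_def n'_def)
qed

section \<open>Languages of conjugacy geodesics\<close>

definition sh :: "fg \<Rightarrow> fg \<times> gen \<Rightarrow> fg \<times> gen" where "sh h e = (h + fst e, snd e)"

lemma inj_sh: "inj (sh h)" by (rule injI) (simp add: sh_def prod_eq_iff)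
lemma distinct_sh [simp]: "distinct (map (sh h) es) \<longleftrightarrow> distinct es"
  by (simp add: distinct_map inj_on_subset[OF inj_sh])
lemma sh_sh [simp]: "sh h (sh k e) = sh (h + k) e" by (simp add: sh_def add.assoc)
lemma sh_0 [simp]: "sh 0 e = e" by (simp add: sh_def)

text \<open>The directed edges crossed by a word, in order.\<close>
fun cr :: "letter list \<Rightarrow> (fg \<times> gen) list" where
  "cr [] = []"
| "cr (l # w) = (0, dir l) # map (sh (gn (dir l))) (cr w)"

lemma cr_append: "cr (u @ v) = cr u @ map (sh (hw u)) (cr v)"
  by (induction u) (auto simp: comp_def)

lemma length_cr [simp]: "length (cr w) = length w" by (induction w) auto

lemma cr_nth: "i < length w \<Longrightarrow> cr w ! i = (hw (take i w), dir (w ! i))"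
proof (induction w arbitrary: i)
  case (Cons l w) then show ?case by (cases i) (auto simp: sh_def)
qed simp

text \<open>All directed edges of the half-tree in direction s, together with both orientations of
  the edge leading to it: the return \<open>(gn s, flip s)\<close> starts in the cone.\<close>

definition branch :: "gen \<Rightarrow> (fg \<times> gen) set" where
  "branch s = {e. fst e \<in> cone s \<or> fst e = 0 \<and> snd e = s}"

lemma branch_disjoint: "e \<in> branch s \<Longrightarrow> e \<in> branch t \<Longrightarrow> s = t"
  using cone_disjoint[of "fst e" s t] by (auto simp: branch_def)

lemma sh_branch: "e \<in> branch t \<Longrightarrow> t \<noteq> flip s \<Longrightarrow> fst (sh (gn s) e) \<in> cone s"
proof -
  assume "e \<in> branch t" "t \<noteq> flip s"
  then have "fst e \<notin> cone (flip s)" using cone_disjoint[of "fst e" t "flip s"] by (auto simp: branch_def)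
  then show ?thesis by (simp add: sh_def gn_plus_in_cone)
qed

text \<open>A backtrack is a leaf of the tour; its lamp must be lit.\<close>
definition ok_pair :: "letter \<Rightarrow> letter \<Rightarrow> bool" where
  "ok_pair l l' \<longleftrightarrow> (dir l' = flip (dir l) \<longrightarrow> post l \<noteq> pre l')"

text \<open>EL s: an excursion that starts along s and returns at once after exploring the branch beyond s.
  NL F: a sequence of excursions along pairwise distinct directions outside F.\<close>
inductive EL :: "gen \<Rightarrow> letter list \<Rightarrow> bool" and NL :: "gen set \<Rightarrow> letter list \<Rightarrow> bool" where
  EL_I: "dir l1 = s \<Longrightarrow> dir l2 = flip s \<Longrightarrow> NL {flip s} M \<Longrightarrow> (M = [] \<longrightarrow> post l1 \<noteq> pre l2) \<Longrightarrow> EL s (l1 # M @ [l2])"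
| NL_Nil: "NL F []"
| NL_Cons: "t \<notin> F \<Longrightarrow> EL t u \<Longrightarrow> NL (insert t F) v \<Longrightarrow> NL F (u @ v)"

text \<open>PL c d: a walk along a reduced path with first direction c and last direction d, with excursions
  off the path at its inner vertices.\<close>
inductive PL :: "gen \<Rightarrow> gen \<Rightarrow> letter list \<Rightarrow> bool" where
  PL_one: "dir l = c \<Longrightarrow> PL c c [l]"
| PL_Cons: "dir l = c \<Longrightarrow> c' \<noteq> flip c \<Longrightarrow> NL {flip c, c'} u \<Longrightarrow> PL c' d v \<Longrightarrow> PL c d (l # u @ v)"

text \<open>WL F, VL F: a walk that does not close up, whose end points become one vertex of the cyclic word,
  where the directions in F are already used; VL makes no excursion at its beginning.\<close>
inductive WL :: "gen set \<Rightarrow> letter list \<Rightarrow> bool" and VL :: "gen set \<Rightarrow> letter list \<Rightarrow> bool" where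
  WL_E: "t \<notin> F \<Longrightarrow> EL t u \<Longrightarrow> WL (insert t F) w \<Longrightarrow> WL F (u @ w)"
| WL_V: "VL F w \<Longrightarrow> WL F w"
| VL_E: "t \<notin> F \<Longrightarrow> VL (insert t F) w \<Longrightarrow> EL t u \<Longrightarrow> VL F (w @ u)"
| VL_layer: "dir l1 = s \<Longrightarrow> dir l2 = flip s \<Longrightarrow> s \<notin> F \<Longrightarrow> (F = {} \<longrightarrow> pre l1 \<noteq> post l2) \<Longrightarrow> WL {flip s} w \<Longrightarrow>
    VL F (l1 # w @ [l2])"
| VL_P: "c \<notin> F \<Longrightarrow> flip d \<notin> F \<Longrightarrow> flip d \<noteq> c \<Longrightarrow> PL c d w \<Longrightarrow> VL F w"

text \<open>Two-letter closed words escape the leaf condition and need only be nontrivial, so that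
  words for z are included. In \<open>SL_closed1\<close> the tour passes its base point in the
  middle; in \<open>SL_closed2\<close> it does not, and the base point is itself a leaf, whose lamp
  is switched by the last and the first letter.\<close>

inductive SL :: "letter list \<Rightarrow> bool" where
  SL_Nil: "SL []"
| SL_two: "dir l2 = flip (dir l1) \<Longrightarrow> ev [l1, l2] \<noteq> \<one>\<^bsub>Gam\<^esub> \<Longrightarrow> SL [l1, l2]"
| SL_closed1: "EL t u \<Longrightarrow> NL {t} r \<Longrightarrow> r \<noteq> [] \<Longrightarrow> SL (u @ r)"
| SL_closed2: "dir l1 = s \<Longrightarrow> dir l2 = flip s \<Longrightarrow> NL {flip s} M \<Longrightarrow> M \<noteq> [] \<Longrightarrow> pre l1 \<noteq> post l2 \<Longrightarrow> SL (l1 # M @ [l2])"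
| SL_W: "WL {} w \<Longrightarrow> SL w"

text \<open>Edges are distinct because branches are disjoint: the interior of an excursion along s
  starts all its edges in the cone of s, and excursions in different directions share no
  edge.\<close>

lemma EL_NL_facts:
  "EL s w \<Longrightarrow> hw w = 0 \<and> set (cr w) \<subseteq> branch s \<and> distinct (cr w) \<and> w \<noteq> [] \<and> dir (hd w) = s \<and>
    dir (last w) = flip s \<and> successively ok_pair w"
  "NL F w \<Longrightarrow> hw w = 0 \<and> (\<forall>e \<in> set (cr w). \<exists>t. t \<notin> F \<and> e \<in> branch t) \<and> distinct (cr w) \<and>
    successively ok_pair w \<and> (w \<noteq> [] \<longrightarrow> dir (hd w) \<notin> F \<and> flip (dir (last w)) \<notin> F)"
proof (induction rule: EL_NL.inducts)
  case (EL_I l1 s l2 M)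
  have M: "hw M = 0" "\<And>e. e \<in> set (cr M) \<Longrightarrow> \<exists>t. t \<noteq> flip s \<and> e \<in> branch t" "distinct (cr M)" "successively ok_pair M"
    "M \<noteq> [] \<Longrightarrow> dir (hd M) \<noteq> flip s" "M \<noteq> [] \<Longrightarrow> flip (dir (last M)) \<noteq> flip s" using EL_I by auto
  have cr: "cr (l1 # M @ [l2]) = (0, s) # map (sh (gn s)) (cr M) @ [(gn s, flip s)]"
    using M EL_I by (simp add: cr_append sh_def)
  have c: "fst e \<in> cone s" if "e \<in> set (map (sh (gn s)) (cr M))" for e
  proof -
    have "e \<in> sh (gn s) ` set (cr M)" using that by (simp only: set_map)
    then obtain e' where "e = sh (gn s) e'" "e' \<in> set (cr M)" by blast
    then show ?thesis using M(2)[of e'] sh_branch[of e' _ s] by blast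
  qed
  have "(gn s, flip s) \<notin> set (map (sh (gn s)) (cr M))"
  proof
    assume "(gn s, flip s) \<in> set (map (sh (gn s)) (cr M))"
    then obtain e where e: "e \<in> set (cr M)" "gn s + fst e = gn s" "snd e = flip s" by (auto simp: sh_def)
    then have "fst e = 0" by (metis add.right_neutral add_left_imp_eq)
    then show False using M(2)[OF e(1)] e by (auto simp: branch_def)
  qed
  moreover have "(0, s) \<notin> set (map (sh (gn s)) (cr M))" using c by (metis fst_conv zero_notin_cone)
  moreover have "distinct (map (sh (gn s)) (cr M))" using M(3) by simp
  moreover have "set (cr (l1 # M @ [l2])) \<subseteq> branch s" unfolding cr using c by (auto simp: branch_def)
  moreover have "successively ok_pair (l1 # M @ [l2])"
    using M(4-6) EL_I by (cases "M = []") (auto simp: successively_Cons successively_append_iff ok_pair_def)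
  ultimately show ?case using M EL_I unfolding cr by auto
next
  case (NL_Cons t F u v)
  have "set (cr u) \<inter> set (cr v) = {}" using NL_Cons branch_disjoint by blast
  moreover have "successively ok_pair (u @ v)"
    using NL_Cons by (auto simp: successively_append_iff ok_pair_def)
  moreover have cr: "cr (u @ v) = cr u @ cr v" using NL_Cons by (simp add: cr_append sh_0[abs_def])
  moreover have "\<exists>t. t \<notin> F \<and> e \<in> branch t" if "e \<in> set (cr (u @ v))" for e
    using that NL_Cons unfolding cr by (simp only: set_append) blast
  moreover have "dir (hd (u @ v)) \<notin> F" using NL_Cons by simp
  moreover have "flip (dir (last (u @ v))) \<notin> F" using NL_Cons by (cases "v = []") simp_all
  ultimately show ?case using NL_Cons by simp
qed auto

lemma PL_facts:
  "PL c d w \<Longrightarrow> hw w \<in> cone c \<and> set (cr w) \<subseteq> branch c \<and> distinct (cr w) \<and> w \<noteq> [] \<and> dir (hd w) = c \<and>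
    dir (last w) = d \<and> successively ok_pair w"
proof (induction rule: PL.induct)
  case (PL_Cons l c c' u d v)
  note u = EL_NL_facts(2)[OF PL_Cons(3)]
  have cr: "cr (l # u @ v) = (0, c) # map (sh (gn c)) (cr u @ cr v)"
    using PL_Cons u by (simp add: cr_append sh_0[abs_def] comp_def)
  have c: "fst e \<in> cone c" if "e \<in> set (map (sh (gn c)) (cr u @ cr v))" for e
  proof -
    have "e \<in> sh (gn c) ` (set (cr u) \<union> set (cr v))" using that by (simp only: set_map set_append)
    then obtain e' where e': "e = sh (gn c) e'" "e' \<in> set (cr u) \<union> set (cr v)" by blast
    then obtain t where "t \<noteq> flip c" "e' \<in> branch t" using u PL_Cons by blast
    then show ?thesis using sh_branch e' by blast
  qed
  have "set (cr u) \<inter> set (cr v) = {}" using u PL_Cons branch_disjoint by blast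
  then have "distinct (cr u @ cr v)" using u PL_Cons by (simp only: distinct_append)
  then have "distinct (map (sh (gn c)) (cr u @ cr v))" by (simp only: distinct_sh)
  moreover have "(0, c) \<notin> set (map (sh (gn c)) (cr u @ cr v))" using c by (metis fst_conv zero_notin_cone)
  moreover have "set (cr (l # u @ v)) \<subseteq> branch c"
  proof
    fix e assume "e \<in> set (cr (l # u @ v))"
    then show "e \<in> branch c" using c[of e] unfolding cr list.set(2) by (elim insertE) (simp_all add: branch_def)
  qed
  moreover have "hw (l # u @ v) \<in> cone c" using PL_Cons u gn_plus_in_cone'[of "hw v" c' c] by simp
  moreover have "successively ok_pair (l # u @ v)"
    using PL_Cons u by (cases "u = []") (auto simp: successively_Cons successively_append_iff ok_pair_def)
  ultimately show ?case using PL_Cons unfolding cr by auto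
qed (auto simp: branch_def)

text \<open>This lets powers of a cyclic word be read as one long path.\<close>

lemma PL_append:
  "PL c d p \<Longrightarrow> NL {flip d, c'} Z \<Longrightarrow> c' \<noteq> flip d \<Longrightarrow> PL c' d' p' \<Longrightarrow> PL c d' (p @ Z @ p')"
proof (induction rule: PL.induct)
  case (PL_one l c) then show ?case using PL_Cons[of l c c' Z d' p'] by simp
next
  case (PL_Cons l c c2 u d v) then show ?case using PL.PL_Cons[of l c c2 u d' "v @ Z @ p'"] by simp
qed

definition pw :: "letter list \<Rightarrow> nat \<Rightarrow> letter list" where "pw v N = map (\<lambda>i. vl v (int i)) [0..<N]"

lemma concat_replicate_Suc: "concat (replicate (Suc q) v) = concat (replicate q v) @ v"
  by (induction q) auto

lemma pw_powers: "pw v (q * length v) = concat (replicate q v)"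
proof (induction q)
  case (Suc q)
  have "[0..<q * length v + length v] = [0..<q * length v] @ [q * length v..<q * length v + length v]"
    by (rule upt_add_eq_append) simp
  then have "pw v (q * length v + length v) =
      pw v (q * length v) @ map (\<lambda>i. vl v (int i)) [q * length v..<q * length v + length v]"
    by (simp only: pw_def map_append)
  also have "map (\<lambda>i. vl v (int i)) [q * length v..<q * length v + length v] = v"
    by (rule nth_equalityI) (simp_all add: vl_def nat_mod_as_int)
  finally show ?case using Suc unfolding concat_replicate_Suc by (simp add: add.commute)
qed (simp add: pw_def)

lemma hw_pw: "hw (pw v N) = pp v (int N)"
proof (induction N)
  case (Suc N) then show ?case using pp_step[of v "int N"] by (simp add: pw_def add.commute)
qed (simp add: pw_def)

lemma cr_pw: "a < N \<Longrightarrow> cr (pw v N) ! a = (pp v (int a), dir (vl v (int a)))"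
proof -
  assume a: "a < N"
  then have "take a (pw v N) = pw v a" by (simp add: pw_def take_map)
  then show ?thesis using a cr_nth[of a "pw v N"] hw_pw[of v a] by (simp add: pw_def)
qed

lemma lit_if_ok:
  assumes v: "v \<noteq> []" and ok: "successively ok_pair (v @ v)" and m: "dir (vl v m) = flip (dir (vl v (m - 1)))"
  shows "post (vl v (m - 1)) \<noteq> pre (vl v m)"
proof -
  let ?n = "int (length v)"
  define a where "a = nat ((m - 1) mod ?n)"
  have n: "0 < ?n" using v by simp
  have a: "int a = (m - 1) mod ?n" "a < length v" using n by (auto simp: a_def nat_less_iff)
  have vv: "(v @ v) ! b = vl v (int b)" if "b < 2 * length v" for b
  proof (cases "b < length v")
    case False
    then have "vl v (int b) = vl v (int (b - length v) + ?n)" by (simp add: of_nat_diff)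
    also have "\<dots> = v ! (b - length v)" unfolding vl_period using that False by (intro vl_nth) simp
    finally show ?thesis using False by (simp add: nth_append)
  qed (simp add: nth_append vl_nth)
  have "vl v (int a) = vl v (m - 1)" using a by (simp add: vl_def)
  moreover have "int (Suc a) mod ?n = m mod ?n" using a(1) by (simp add: mod_add_right_eq)
  then have "vl v (int (Suc a)) = vl v m" by (simp add: vl_def)
  moreover have "ok_pair ((v @ v) ! a) ((v @ v) ! Suc a)"
    using ok a(2) unfolding successively_conv_nth by auto
  ultimately show ?thesis using m a(2) vv[of a] vv[of "Suc a"] by (auto simp: ok_pair_def)
qed

text \<open>The walk of a closed word repeats itself, so distinct edges within one period already
  give simplicity.\<close>

lemma conj_geo_closed:
  assumes v: "v \<noteq> []" "hw v = 0" "distinct (cr v)" "successively ok_pair (v @ v)"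
  shows "conj_geo v"
proof (rule conj_geo_if_simple[OF v(1)])
  interpret periodic_walk "\<lambda>i. pp v i" "\<lambda>i. dir (vl v i)" "int (length v)" 0
    using periodic_walk_word[OF v(1), of 0] v(2) by simp
  have 0: "pp v (q * int (length v)) = 0" for q
  proof (induction q rule: int_induct[where k = 0])
    case (step1 q) then show ?case using pp_period[of v "q * int (length v)"] v(2) by (simp add: algebra_simps)
  next
    case (step2 q) then show ?case using pp_period[of v "(q - 1) * int (length v)"] v(2) by (simp add: algebra_simps)
  qed simp
  fix i j assume ij: "pp v i = pp v j" "dir (vl v i) = dir (vl v j)"
  have "cr v ! nat (k mod int (length v)) = (pp v k, dir (vl v k)) \<and> nat (k mod int (length v)) < length v" for k
  proof -
    let ?a = "nat (k mod int (length v))"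
    have a: "int ?a = k mod int (length v)" "?a < length v" using n_pos by (auto simp: nat_less_iff)
    have "pp v k = pp v (k mod int (length v) + k div int (length v) * int (length v))" by simp
    also have "\<dots> = pp v (k mod int (length v))" unfolding P_periods 0 by simp
    finally have "pp v k = pp v (int ?a)" using a by simp
    then show ?thesis using a cr_nth[of ?a v] pp_take[of ?a v] by (simp add: vl_def)
  qed
  then have "nat (i mod int (length v)) = nat (j mod int (length v))"
    using v(3) ij by (metis length_cr nth_eq_iff_index_eq)
  then show "i mod int (length v) = j mod int (length v)"
    using n_pos by (simp only: eq_nat_nat_iff pos_mod_sign)
next
  show "post (vl v (m - 1)) \<noteq> pre (vl v m)" if "dir (vl v m) = flip (dir (vl v (m - 1)))" for m
    using lit_if_ok[OF v(1,4)] that by blast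
qed (use v in simp)

text \<open>All powers of the word, completed by p, are again paths with excursions. Hence no
  directed edge recurs in any number of periods, and no positive power has trivial position.\<close>

lemma conj_geo_axis:
  assumes p: "PL c d p" and Z: "NL {flip d, c} Z" and cd: "flip d \<noteq> c"
  shows "conj_geo (p @ Z)"
proof -
  let ?v = "p @ Z"
  let ?n = "int (length ?v)"
  have v: "?v \<noteq> []" using PL_facts[OF p] by simp
  have powers: "PL c d (concat (replicate q ?v) @ p)" for q
  proof (induction q)
    case (Suc q) then show ?case using PL_append[OF p Z, of d "concat (replicate q ?v) @ p"] cd by simp
  qed (use p in simp)
  have nz: "pp ?v (q * ?n) \<noteq> 0" if q: "q > 0" for q
  proof -
    obtain N where N: "q = int (Suc N)" using q by (metis gr0_implies_Suc of_nat_0_less_iff zero_less_imp_eq_int)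
    have "pp ?v (q * ?n) = hw (concat (replicate (Suc N) ?v))"
      unfolding N of_nat_mult[symmetric] hw_pw[symmetric] pw_powers ..
    also have "\<dots> = hw (concat (replicate N ?v) @ p) + hw Z"
      unfolding concat_replicate_Suc by (simp add: add.assoc)
    also have "\<dots> = hw (concat (replicate N ?v) @ p)" using EL_NL_facts(2)[OF Z] by simp
    finally show ?thesis using PL_facts[OF powers[of N]] by (metis zero_notin_cone)
  qed
  show ?thesis
  proof (rule conj_geo_if_simple[OF v])
    interpret periodic_walk "\<lambda>i. pp ?v i" "\<lambda>i. dir (vl ?v i)" ?n "hw ?v"
      using periodic_walk_word[OF v, of 0] by simp
    fix i j assume ij: "pp ?v i = pp ?v j" "dir (vl ?v i) = dir (vl ?v j)"
    \<comment> \<open>A shift by K periods moves both times into the first 2K periods, where the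
      edges are those of a finite word.\<close>
    define K where "K = \<bar>i\<bar> + \<bar>j\<bar> + 1"
    have K: "K * 1 \<le> K * ?n" using n_pos by (intro mult_left_mono) (auto simp: K_def)
    have nn: "0 \<le> k + K * ?n" "k + K * ?n < int (nat (2 * K) * length ?v)" if "k = i \<or> k = j" for k
    proof -
      have "\<bar>k\<bar> < K" using that by (auto simp: K_def)
      then show "0 \<le> k + K * ?n" using K by linarith
      have "int (nat (2 * K) * length ?v) = 2 * (K * ?n)" by (simp add: K_def)
      then show "k + K * ?n < int (nat (2 * K) * length ?v)" using \<open>\<bar>k\<bar> < K\<close> K by linarith
    qed
    let ?w = "pw ?v (nat (2 * K) * length ?v)"
    have "distinct (cr (concat (replicate (nat (2 * K)) ?v) @ p))" using PL_facts[OF powers] by blast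
    then have dist: "distinct (cr ?w)" unfolding pw_powers by (simp add: cr_append)
    have *: "cr ?w ! nat (k + K * ?n) = (pp ?v (k + K * ?n), dir (vl ?v k)) \<and> nat (k + K * ?n) < length ?w"
      if "k = i \<or> k = j" for k
    proof -
      have lt: "nat (k + K * ?n) < nat (2 * K) * length ?v"
        using nn[OF that] by (simp only: nat_less_iff)
      have "length ?w = nat (2 * K) * length ?v" unfolding pw_def length_map length_upt by (rule minus_nat.diff_0)
      then show ?thesis using cr_pw[OF lt, of ?v] lt D_periods[of k K] by (simp only: nat_0_le[OF nn(1)[OF that]])
    qed
    have "pp ?v (i + K * ?n) = pp ?v (j + K * ?n)" using P_periods[of i K] P_periods[of j K] ij by simp
    then have "nat (i + K * ?n) = nat (j + K * ?n)"
      using *[of i] *[of j] dist ij by (metis length_cr nth_eq_iff_index_eq)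
    then have "i = j" using nn[of i] nn[of j] by (simp only: nat_eq_iff2) auto
    then show "i mod ?n = j mod ?n" by simp
  next
    have "successively ok_pair (concat (replicate 2 ?v) @ p)" using PL_facts[OF powers] by blast
    moreover have "concat (replicate 2 ?v) @ p = (?v @ ?v) @ p" by (simp add: numeral_2_eq_2)
    ultimately have "successively ok_pair (?v @ ?v)" by (simp only: successively_append_iff[of _ "?v @ ?v" p])
    then show "post (vl ?v (m - 1)) \<noteq> pre (vl ?v m)" if "dir (vl ?v m) = flip (dir (vl ?v (m - 1)))" for m
      using lit_if_ok[OF v] that by blast
  qed (use nz in blast)
qed

lemma NL_snoc: "NL H K \<Longrightarrow> H = insert t G \<Longrightarrow> EL t u \<Longrightarrow> t \<notin> G \<Longrightarrow> NL G (K @ u)"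
proof (induction K arbitrary: H G rule: length_induct)
  case (1 K)
  from 1(2) show ?case
  proof cases
    case NL_Nil then show ?thesis using NL_Cons[OF 1(5) 1(4), of "[]"] EL_NL.NL_Nil by simp
  next
    case (NL_Cons t1 u1 v1)
    have "u1 \<noteq> []" using EL_NL_facts(1) NL_Cons by blast
    moreover have "NL (insert t (insert t1 G)) v1" using NL_Cons 1 by (simp add: insert_commute)
    ultimately have "NL (insert t1 G) (v1 @ u)"
      using 1(1)[rule_format, of v1 "insert t (insert t1 G)" "insert t1 G"] NL_Cons 1 by auto
    then show ?thesis using EL_NL.NL_Cons[of t1 G u1 "v1 @ u"] NL_Cons 1 by simp
  qed
qed

text \<open>K is what rotation has moved in front of a word: excursions from the base point with
  directions in F only. Emptiness is tracked because with an empty context the adjoining two letters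
  form a leaf.\<close>

definition context_word :: "gen set \<Rightarrow> letter list \<Rightarrow> bool" where
  "context_word F K \<longleftrightarrow> (\<forall>G. F \<inter> G = {} \<longrightarrow> NL G K) \<and> (F = {} \<longleftrightarrow> K = [])"

text \<open>Up to rotation, every word of WL has its starting point on the axis of its translation part.\<close>
lemma WL_VL_rotate:
  "WL F w \<Longrightarrow> context_word F K \<Longrightarrow>
    \<exists>x y p Z c d. K @ w = x @ y \<and> y @ x = p @ Z \<and> PL c d p \<and> NL {flip d, c} Z \<and> flip d \<noteq> c"
  "VL F w \<Longrightarrow> context_word F K \<Longrightarrow>
    \<exists>x y p Z c d. K @ w = x @ y \<and> y @ x = p @ Z \<and> PL c d p \<and> NL {flip d, c} Z \<and> flip d \<noteq> c"
proof (induction arbitrary: K and K rule: WL_VL.inducts)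
  case (WL_E t F u w)
  have "context_word (insert t F) (K @ u)" unfolding context_word_def
  proof (intro conjI allI impI)
    fix G assume G: "insert t F \<inter> G = {}"
    then have "NL (insert t G) K" using WL_E unfolding context_word_def by auto
    then show "NL G (K @ u)" using NL_snoc[of _ K t G u] WL_E G by auto
  qed (use EL_NL_facts(1) WL_E in auto)
  from WL_E.IH[OF this] show ?case by simp
next
  case (VL_E t F w u)
  have "context_word (insert t F) (u @ K)" unfolding context_word_def
  proof (intro conjI allI impI)
    fix G assume G: "insert t F \<inter> G = {}"
    then have "NL (insert t G) K" using VL_E unfolding context_word_def by auto
    then show "NL G (u @ K)" using NL_Cons[of t G u K] VL_E G by auto
  qed (use EL_NL_facts(1) VL_E in auto)
  from VL_E.IH[OF this] obtain x y p Z c d where *: "u @ K @ w = x @ y" "y @ x = p @ Z" "PL c d p"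
    "NL {flip d, c} Z" "flip d \<noteq> c" by auto
  have "\<exists>x' y'. K @ w @ u = x' @ y' \<and> y' @ x' = y @ x"
  proof -
    from *(1) obtain us where "x = u @ us \<and> us @ y = K @ w \<or> x @ us = u \<and> us @ K @ w = y"
      by (auto simp: append_eq_append_conv2)
    then show ?thesis
    proof
      assume "x = u @ us \<and> us @ y = K @ w"
      then have "K @ w @ u = us @ (y @ u) \<and> (y @ u) @ us = y @ x" by (metis append.assoc)
      then show ?thesis by blast
    next
      assume "x @ us = u \<and> us @ K @ w = y"
      then have "u = x @ us" "y = us @ K @ w" by simp_all
      then have "K @ w @ u = (K @ w @ x) @ us \<and> us @ (K @ w @ x) = y @ x" by simp
      then show ?thesis by blast
    qed
  qed
  then obtain x' y' where xy: "K @ w @ u = x' @ y'" "y' @ x' = y @ x" by blast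
  show ?case
    by (intro exI[of _ x'] exI[of _ y'] exI[of _ p] exI[of _ Z] exI[of _ c] exI[of _ d]) (simp only: xy * simp_thms)
next
  case (VL_layer l1 s l2 F w)
  have NLs: "NL {s} K" using VL_layer unfolding context_word_def by auto
  \<comment> \<open>Seen from the far end of the edge of l1, the outer layer read cyclically from l2
    through K to l1 is an excursion in direction \<open>flip s\<close>. It becomes the context of
    the inner word; for empty K its leaf condition is the one in \<open>VL_layer\<close>.\<close>
  have "EL (flip s) (l2 # K @ [l1])"
    by (rule EL_I) (use VL_layer NLs in \<open>auto simp: context_word_def\<close>)
  then have "NL G (l2 # K @ [l1])" if "flip s \<notin> G" for G using NL_Cons[OF that, of _ "[]"] NL_Nil by fastforce
  then have "context_word {flip s} (l2 # K @ [l1])" unfolding context_word_def by auto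
  from VL_layer.IH[OF this] obtain x y p Z c d where *: "l2 # K @ [l1] @ w = x @ y" "y @ x = p @ Z" "PL c d p"
    "NL {flip d, c} Z" "flip d \<noteq> c" by auto
  have "\<exists>x' y'. K @ l1 # w @ [l2] = x' @ y' \<and> y' @ x' = y @ x"
  proof (cases x)
    case Nil
    then show ?thesis using *(1) by (intro exI[of _ "K @ l1 # w"] exI[of _ "[l2]"]) auto
  next
    case (Cons a x')
    then show ?thesis using *(1) by (intro exI[of _ x'] exI[of _ "y @ [l2]"]) auto
  qed
  then obtain x' y' where xy: "K @ l1 # w @ [l2] = x' @ y'" "y' @ x' = y @ x" by blast
  show ?case
    by (intro exI[of _ x'] exI[of _ y'] exI[of _ p] exI[of _ Z] exI[of _ c] exI[of _ d]) (simp only: xy * simp_thms)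
next
  case (VL_P c F d w)
  have "NL {flip d, c} K" using VL_P unfolding context_word_def by auto
  then show ?case using VL_P by (intro exI[of _ K] exI[of _ w]) blast
qed auto

lemma conj_geo_EL_NL:
  assumes "EL t u" "NL {t} r" "r \<noteq> []"
  shows "conj_geo (u @ r)"
proof -
  note u = EL_NL_facts(1)[OF assms(1)] and r = EL_NL_facts(2)[OF assms(2)]
  have "NL {} (u @ r)" using assms by (intro NL_Cons) auto
  note n = EL_NL_facts(2)[OF this]
  show ?thesis
    by (rule conj_geo_closed) (use n u r assms in \<open>auto simp: successively_append_iff ok_pair_def\<close>)
qed

lemma SL_conj_geo: "SL w \<Longrightarrow> conj_geo w"
proof (induction rule: SL.induct)
  case SL_Nil then show ?case by (simp add: conj_geo_def)
next
  case (SL_two l2 l1)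
  show ?case unfolding conj_geo_def
  proof (intro allI impI)
    fix w assume w: "conjugate Gam (ev w) (ev [l1, l2])"
    then obtain g where g: "g \<in> carrier Gam" "g \<otimes>\<^bsub>Gam\<^esub> ev [l1, l2] = ev w \<otimes>\<^bsub>Gam\<^esub> g" unfolding conjugate_iff by blast
    have "w \<noteq> []"
    proof
      assume "w = []"
      then have "g \<otimes>\<^bsub>Gam\<^esub> ev [l1, l2] = g \<otimes>\<^bsub>Gam\<^esub> \<one>\<^bsub>Gam\<^esub>" using g by (simp del: Gam_simps)
      then show False using SL_two g(1) by (metis Gam.l_cancel ev_carrier Gam.one_closed)
    qed
    moreover have "w \<noteq> [l]" for l
    proof
      assume "w = [l]"
      obtain \<phi> k d where \<phi>: "g = (\<phi>, k, d)" by (metis prod_cases3)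
      obtain e e' where e: "ev [l1, l2] = (lw [l1, l2], hw [l1, l2], e)" "ev w = (lw w, hw w, e')" using ev_eq by metis
      have "k + hw [l1, l2] = hw w + k" using g unfolding \<phi> e by auto
      then have "hw w + k = k" using SL_two by simp
      then show False using add_left_eq_self[of "hw w" k] \<open>w = [l]\<close> by simp
    qed
    ultimately show "length [l1, l2] \<le> length w" by (cases w; cases "tl w") auto
  qed
next
  case (SL_closed1 t u r) then show ?case by (rule conj_geo_EL_NL)
next
  case (SL_closed2 l1 s l2 M)
  have "EL (flip s) [l2, l1]" using EL_I[of l2 "flip s" l1 "[]"] NL_Nil SL_closed2 by auto
  from conj_geo_EL_NL[OF this SL_closed2(3,4)] have "conj_geo ([l2, l1] @ M)" .
  then have "conj_geo ([l1] @ M @ [l2])" using conj_geo_rotate[of "[l1] @ M" "[l2]"] by simp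
  then show ?case by simp
next
  case (SL_W w)
  have "context_word {} []" unfolding context_word_def using NL_Nil by simp
  from WL_VL_rotate(1)[OF SL_W this] obtain x y p Z c d where *: "w = x @ y" "y @ x = p @ Z" "PL c d p"
    "NL {flip d, c} Z" "flip d \<noteq> c" by auto
  have "conj_geo (y @ x)" unfolding *(2) by (rule conj_geo_axis[OF *(3-5)])
  then show ?case unfolding *(1) by (simp only: conj_geo_rotate[of x y])
qed

section \<open>Parsing conjugacy geodesics\<close>

definition revisit_free :: "letter list \<Rightarrow> bool" where
  "revisit_free w \<longleftrightarrow> (\<forall>A l1 U l2 V l3 B. w = A @ l1 # U @ l2 # V @ l3 # B \<longrightarrow> dir l2 = flip (dir l1) \<longrightarrow>
    dir l3 = dir l1 \<longrightarrow> hw U = 0 \<longrightarrow> hw V = 0 \<longrightarrow> False)"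

definition tight :: "letter list \<Rightarrow> bool" where "tight w \<longleftrightarrow> revisit_free w \<and> successively ok_pair w"

text \<open>Rotations are included because the conditions must also hold across the point where end
  and start are glued.\<close>

definition cyc_tight :: "letter list \<Rightarrow> bool" where "cyc_tight w \<longleftrightarrow> (\<forall>n. tight (rotate n w))"

lemma revisit_freeD:
  "revisit_free (A @ l1 # U @ l2 # V @ l3 # B) \<Longrightarrow> dir l2 = flip (dir l1) \<Longrightarrow> dir l3 = dir l1 \<Longrightarrow>
    hw U = 0 \<Longrightarrow> hw V = 0 \<Longrightarrow> False"
  unfolding revisit_free_def by blast

lemma tight_factor: assumes "tight (A @ w @ B)" shows "tight w"
proof -
  have "revisit_free w" unfolding revisit_free_def
  proof (intro allI impI)
    fix A' l1 U l2 V l3 B'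
    assume *: "w = A' @ l1 # U @ l2 # V @ l3 # B'" "dir l2 = flip (dir l1)" "dir l3 = dir l1" "hw U = 0" "hw V = 0"
    have "revisit_free ((A @ A') @ l1 # U @ l2 # V @ l3 # (B' @ B))" using assms *(1) by (simp add: tight_def)
    from revisit_freeD[OF this *(2-)] show False .
  qed
  then show ?thesis using assms by (simp add: tight_def successively_append_iff)
qed

lemma cyc_tight_rotate: "cyc_tight (x @ y) \<Longrightarrow> cyc_tight (y @ x)"
  unfolding cyc_tight_def by (metis rotate_append rotate_rotate)

lemma cyc_tight_tight: "cyc_tight w \<Longrightarrow> tight w" unfolding cyc_tight_def by (metis rotate0 id_apply)

lemma exit_split:
  "x \<in> cone s \<Longrightarrow> x + hw w \<notin> cone s \<Longrightarrow>
    \<exists>M l2 w2. w = M @ l2 # w2 \<and> x + hw M = gn s \<and> dir l2 = flip s \<and> (\<forall>A B. M = A @ B \<longrightarrow> x + hw A \<in> cone s)"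
proof (induction w arbitrary: x)
  case (Cons l w)
  show ?case
  proof (cases "x + gn (dir l) \<in> cone s")
    case False
    from cone_exit[OF Cons(2) False] show ?thesis using Cons(2) by (intro exI[of _ "[]"] exI[of _ l] exI[of _ w]) simp
  next
    case True
    then obtain M l2 w2 where *: "w = M @ l2 # w2" "x + gn (dir l) + hw M = gn s" "dir l2 = flip s"
      "\<forall>A B. M = A @ B \<longrightarrow> x + gn (dir l) + hw A \<in> cone s"
      using Cons(1)[OF True] Cons(3) by (auto simp: add.assoc)
    have "x + hw A \<in> cone s" if "l # M = A @ B" for A B
      using that *(4) Cons(2) by (cases A) (auto simp: add.assoc)
    then show ?thesis using * by (intro exI[of _ "l # M"] exI[of _ l2] exI[of _ w2]) (auto simp: add.assoc)
  qed
qed simp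

lemma enter_split_from:
  "x \<notin> cone s \<Longrightarrow> x + hw w \<in> cone s \<Longrightarrow> \<exists>C l D. w = C @ l # D \<and> x + hw C = 0 \<and> dir l = s"
proof (induction w rule: rev_induct)
  case (snoc l w)
  show ?case
  proof (cases "x + hw w \<in> cone s")
    case True then show ?thesis using snoc by fastforce
  next
    case False
    have "x + hw w + gn (dir l) \<in> cone s" using snoc(3) by (simp add: add.assoc)
    from cone_enter[OF False this] show ?thesis by blast
  qed
qed simp

lemma enter_split: "hw w \<in> cone s \<Longrightarrow> \<exists>C l D. w = C @ l # D \<and> hw C = 0 \<and> dir l = s"
  using enter_split_from[of 0 s w] by simp

lemma first_return:
  assumes "hw (l1 # w) = 0"
  shows "\<exists>M l2 w2. w = M @ l2 # w2 \<and> hw M = 0 \<and> hw w2 = 0 \<and> dir l2 = flip (dir l1) \<and>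
    (\<forall>A B. M = A @ B \<longrightarrow> gn (dir l1) + hw A \<in> cone (dir l1))"
proof -
  let ?s = "dir l1"
  have "gn ?s + hw w \<notin> cone ?s" using assms by simp
  from exit_split[OF _ this] obtain M l2 w2 where *: "w = M @ l2 # w2" "gn ?s + hw M = gn ?s" "dir l2 = flip ?s"
    "\<forall>A B. M = A @ B \<longrightarrow> gn ?s + hw A \<in> cone ?s" by auto
  have "hw M = 0" using *(2) by (metis add.right_neutral add_left_imp_eq)
  moreover have "hw w2 = 0" using assms *(1,3) calculation by (simp add: add.assoc)
  ultimately show ?thesis using * by blast
qed

text \<open>The first return to the base point cuts off one excursion; its interior and the rest are
  parsed by induction. No direction recurs, since that would revisit a branch.\<close>

lemma NL_parse:
  "tight w \<Longrightarrow> hw w = 0 \<Longrightarrow> (\<And>A l B. w = A @ l # B \<Longrightarrow> hw A = 0 \<Longrightarrow> dir l \<notin> F) \<Longrightarrow> NL F w"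
proof (induction w arbitrary: F rule: length_induct)
  case (1 w)
  show ?case
  proof (cases w)
    case Nil then show ?thesis by (simp add: NL_Nil)
  next
    case (Cons l1 w1)
    let ?s = "dir l1"
    obtain M l2 w2 where *: "w1 = M @ l2 # w2" "hw M = 0" "hw w2 = 0" "dir l2 = flip ?s"
      "\<forall>A B. M = A @ B \<longrightarrow> gn ?s + hw A \<in> cone ?s" using first_return[of l1 w1] 1(3) Cons by blast
    have w: "w = l1 # M @ l2 # w2" using Cons * by simp
    have s: "?s \<notin> F" using 1(4)[of "[]" l1 w1] Cons by simp
    have "NL {flip ?s} M"
    proof (rule 1(1)[rule_format])
      show "length M < length w" using w by simp
      show "tight M" using tight_factor[of "[l1]" M "l2 # w2"] 1(2) w by simp
      fix A l B assume M: "M = A @ l # B" "hw A = 0"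
      have "gn ?s + hw (A @ [l]) \<in> cone ?s" using *(5)[rule_format, of "A @ [l]" B] M by simp
      then show "dir l \<notin> {flip ?s}" using M by auto
    qed (use * in auto)
    moreover have "ok_pair l1 l2" if "M = []" using 1(2) w that by (simp add: tight_def)
    ultimately have "EL ?s (l1 # M @ [l2])" using * by (intro EL_I) (auto simp: ok_pair_def)
    moreover have "NL (insert ?s F) w2"
    proof (rule 1(1)[rule_format])
      show "length w2 < length w" using w by simp
      show "tight w2" using tight_factor[of "l1 # M @ [l2]" w2 "[]"] 1(2) w by simp
      fix A l B assume w2: "w2 = A @ l # B" "hw A = 0"
      have "dir l \<notin> F" using 1(4)[of "l1 # M @ l2 # A" l B] w w2 * by simp
      moreover have "dir l \<noteq> ?s"
      proof
        assume "dir l = ?s"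
        moreover have "revisit_free ([] @ l1 # M @ l2 # A @ l # B)" using 1(2) w w2 by (simp add: tight_def)
        ultimately show False using revisit_freeD * w2 by blast
      qed
      ultimately show "dir l \<notin> insert ?s F" by simp
    qed (use * in auto)
    ultimately have "NL F ((l1 # M @ [l2]) @ w2)" using NL_Cons s by blast
    then show ?thesis using w by simp
  qed
qed

lemma EL_parse:
  assumes "tight (l1 # M @ [l2])" "hw M = 0" "dir l2 = flip (dir l1)"
    "\<forall>A B. M = A @ B \<longrightarrow> gn (dir l1) + hw A \<in> cone (dir l1)"
  shows "EL (dir l1) (l1 # M @ [l2])"
proof (rule EL_I)
  show "NL {flip (dir l1)} M"
  proof (rule NL_parse)
    show "tight M" using tight_factor[of "[l1]" M "[l2]"] assms by simp
    fix A l B assume M: "M = A @ l # B" "hw A = 0"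
    have "gn (dir l1) + hw (A @ [l]) \<in> cone (dir l1)" using assms(4)[rule_format, of "A @ [l]" B] M by simp
    then show "dir l \<notin> {flip (dir l1)}" using M by auto
  qed (rule assms)
  show "M = [] \<longrightarrow> post l1 \<noteq> pre l2" using assms by (auto simp: tight_def ok_pair_def)
qed (use assms in auto)

definition no_closed_prefix :: "letter list \<Rightarrow> bool" where "no_closed_prefix w \<longleftrightarrow> (\<forall>A B. w = A @ B \<longrightarrow> A \<noteq> [] \<longrightarrow> hw A \<noteq> 0)"
definition no_closed_suffix :: "letter list \<Rightarrow> bool" where "no_closed_suffix w \<longleftrightarrow> (\<forall>A B. w = A @ B \<longrightarrow> B \<noteq> [] \<longrightarrow> hw B \<noteq> 0)"

lemma max_closed_prefix: "\<exists>Z w'. w = Z @ w' \<and> hw Z = 0 \<and> no_closed_prefix w'"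
proof (induction w rule: length_induct)
  case (1 w)
  show ?case
  proof (cases "no_closed_prefix w")
    case True then show ?thesis by (intro exI[of _ "[]"] exI[of _ w]) simp
  next
    case False
    then obtain A B where A: "w = A @ B" "A \<noteq> []" "hw A = 0" unfolding no_closed_prefix_def by blast
    then obtain Z w' where "B = Z @ w'" "hw Z = 0" "no_closed_prefix w'" using 1[rule_format, of B] by auto
    then show ?thesis using A by (intro exI[of _ "A @ Z"] exI[of _ w']) simp
  qed
qed

text \<open>A closed word starting with l contains the return along l, so a forbidden revisit arises
  without naming that return.\<close>

lemma revisit_free_after:
  assumes "revisit_free (X0 @ (A @ l # B) @ l3 # X1)" "hw A = 0" "hw (A @ l # B) = 0" "dir l3 = dir l"
  shows False
proof -
  have "hw (l # B) = 0" using assms by simp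
  from first_return[OF this] obtain M l2 w2 where *: "B = M @ l2 # w2" "hw M = 0" "hw w2 = 0" "dir l2 = flip (dir l)"
    by blast
  have "revisit_free ((X0 @ A) @ l # M @ l2 # w2 @ l3 # X1)" using assms(1) * by simp
  from revisit_freeD[OF this *(4) assms(4) *(2,3)] show False .
qed

text \<open>After each path step the maximal closed prefix consists of the excursions at the new
  vertex; the letter behind it is the next path step.\<close>

lemma PL_parse: "tight w \<Longrightarrow> w \<noteq> [] \<Longrightarrow> no_closed_prefix w \<Longrightarrow> no_closed_suffix w \<Longrightarrow> PL (dir (hd w)) (dir (last w)) w"
proof (induction w rule: length_induct)
  case (1 w)
  obtain l1 w1 where w: "w = l1 # w1" using 1(3) by (cases w) auto
  obtain Z w' where Z: "w1 = Z @ w'" "hw Z = 0" "no_closed_prefix w'" using max_closed_prefix by blast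
  let ?c = "dir l1"
  show ?case
  proof (cases w')
    case Nil
    have "Z = []"
    proof (rule ccontr)
      assume "Z \<noteq> []"
      then show False using 1(5) w Z Nil unfolding no_closed_suffix_def by (metis append.right_neutral append_Cons append_Nil)
    qed
    then show ?thesis using w Z Nil PL_one by simp
  next
    case (Cons l3 w3)
    let ?c' = "dir l3"
    have w': "w = l1 # Z @ l3 # w3" using w Z Cons by simp
    have nz: "hw A \<noteq> 0" if "w = A @ B" "A \<noteq> []" for A B using 1(4) that unfolding no_closed_prefix_def by blast
    have "?c' \<noteq> flip ?c" using nz[of "l1 # Z @ [l3]" w3] w' Z by auto
    moreover have "NL {flip ?c, ?c'} Z"
    proof (rule NL_parse)
      show "tight Z" using tight_factor[of "[l1]" Z "l3 # w3"] 1(2) w' by simp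
      fix A l B assume A: "Z = A @ l # B" "hw A = 0"
      have "dir l \<noteq> flip ?c" using nz[of "l1 # A @ [l]" "B @ l3 # w3"] w' A by auto
      moreover have "dir l \<noteq> ?c'"
        using revisit_free_after[of "[l1]" A l B l3 w3] 1(2) w' A Z(2) by (auto simp: tight_def)
      ultimately show "dir l \<notin> {flip ?c, ?c'}" by simp
    qed (rule Z)
    moreover have "PL (dir (hd w')) (dir (last w')) w'"
    proof (rule 1(1)[rule_format])
      show "tight w'" using tight_factor[of "l1 # Z" w' "[]"] 1(2) w Z by simp
      show "no_closed_suffix w'" unfolding no_closed_suffix_def
      proof (intro allI impI)
        fix A B assume "w' = A @ B" "B \<noteq> []"
        moreover from this have "w = (l1 # Z @ A) @ B" using w Z by simp
        ultimately show "hw B \<noteq> 0" using 1(5) unfolding no_closed_suffix_def by blast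
      qed
    qed (use w Z Cons in auto)
    ultimately show ?thesis using PL_Cons[of l1 ?c ?c' Z "dir (last w')" w'] w Z Cons by simp
  qed
qed

text \<open>The directions in which a word leaves its base point.\<close>
definition toplevel :: "letter list \<Rightarrow> gen set" where
  "toplevel K = {dir l | A l B. K = A @ l # B \<and> hw A = 0}"

lemma toplevelE:
  assumes "t \<in> toplevel K"
  obtains A l B where "K = A @ l # B" "hw A = 0" "dir l = t"
  using assms unfolding toplevel_def by blast

lemma toplevelI: "K = A @ l # B \<Longrightarrow> hw A = 0 \<Longrightarrow> dir l \<in> toplevel K"
  unfolding toplevel_def by blast

lemma toplevel_Nil [simp]: "toplevel [] = {}" by (simp add: toplevel_def)
lemma toplevel_empty: "toplevel K = {} \<Longrightarrow> K = []"
  by (cases K) (auto simp: toplevel_def, metis append_Nil hw.simps(1))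

lemma toplevel_append: assumes "hw K = 0" shows "toplevel (K @ u) = toplevel K \<union> toplevel u"
proof
  show "toplevel (K @ u) \<subseteq> toplevel K \<union> toplevel u"
  proof
    fix t assume "t \<in> toplevel (K @ u)"
    then obtain A l B where A: "K @ u = A @ l # B" "hw A = 0" "t = dir l" unfolding toplevel_def by blast
    then consider us where "K = A @ us" "us @ u = l # B" | us where "K @ us = A" "u = us @ l # B"
      by (auto simp: append_eq_append_conv2)
    then show "t \<in> toplevel K \<union> toplevel u"
    proof cases
      case (1 us)
      show ?thesis
      proof (cases us)
        case Nil
        then show ?thesis using 1 A unfolding toplevel_def by (metis (mono_tags, lifting) UnI2 append_Nil hw.simps(1) mem_Collect_eq)
      next
        case (Cons a us')
        then have "K = A @ l # us'" using 1 by simp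
        then show ?thesis using A unfolding toplevel_def by blast
      qed
    next
      case (2 us)
      then have "hw us = 0" using A assms by auto
      then show ?thesis using 2 A unfolding toplevel_def by blast
    qed
  qed
  show "toplevel K \<union> toplevel u \<subseteq> toplevel (K @ u)"
  proof
    fix t assume "t \<in> toplevel K \<union> toplevel u"
    then consider A l B where "K = A @ l # B" "hw A = 0" "t = dir l" | A l B where "u = A @ l # B" "hw A = 0" "t = dir l"
      unfolding toplevel_def by blast
    then show "t \<in> toplevel (K @ u)"
    proof cases
      case (1 A l B) then have "K @ u = A @ l # (B @ u)" by simp
      then show ?thesis using 1 unfolding toplevel_def by blast
    next
      case (2 A l B) then have "K @ u = (K @ A) @ l # B" "hw (K @ A) = 0" using assms by simp_all
      then show ?thesis using 2 unfolding toplevel_def by blast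
    qed
  qed
qed

lemma toplevel_excursion:
  assumes "\<And>A B. M = A @ B \<Longrightarrow> gn (dir l1) + hw A \<noteq> 0"
  shows "toplevel (l1 # M @ [l2]) = {dir l1}"
proof
  show "{dir l1} \<subseteq> toplevel (l1 # M @ [l2])"
  proof -
    have "l1 # M @ [l2] = [] @ l1 # (M @ [l2])" "hw [] = 0" by simp_all
    then show ?thesis unfolding toplevel_def by blast
  qed
  show "toplevel (l1 # M @ [l2]) \<subseteq> {dir l1}"
  proof
    fix t assume "t \<in> toplevel (l1 # M @ [l2])"
    then obtain A l B where A: "l1 # M @ [l2] = A @ l # B" "hw A = 0" "t = dir l" unfolding toplevel_def by blast
    show "t \<in> {dir l1}"
    proof (cases A)
      case (Cons a A')
      then have A': "M @ [l2] = A' @ l # B" "a = l1" using A by auto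
      then have "M = A' @ butlast (l # B)" by (metis butlast_append butlast_snoc list.distinct(1))
      then show ?thesis using assms A Cons A' by auto
    qed (use A in auto)
  qed
qed

text \<open>K is the closed part rotated in front of W, and its top-level directions are the set
  recorded by the grammar. Closed prefixes are peeled off, then closed suffixes; when both are
  exhausted, W is a layer if its last letter reverses its first, and a path otherwise.\<close>

lemma WL_parse:
  "cyc_tight (K @ W) \<Longrightarrow> hw W \<noteq> 0 \<Longrightarrow> hw K = 0 \<Longrightarrow> WL (toplevel K) W \<and> (no_closed_prefix W \<longrightarrow> VL (toplevel K) W)"
proof (induction W arbitrary: K rule: length_induct)
  case (1 W)
  note IH = 1(1)[rule_format]
  have tight: "tight (K @ W)" using cyc_tight_tight 1 by blast
  have VL: "VL (toplevel K) W" if no_closed_prefix: "no_closed_prefix W"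
  proof (cases "no_closed_suffix W")
    case False
    \<comment> \<open>A shortest closed suffix is a single excursion: anything behind its first
      return would be a shorter closed suffix.\<close>
    define Q where "Q u \<longleftrightarrow> (\<exists>W'. W = W' @ u) \<and> u \<noteq> [] \<and> hw u = 0" for u
    have "\<exists>u. Q u" using False unfolding no_closed_suffix_def Q_def by blast
    then obtain u0 where "Q u0" ..
    from ex_has_least_nat[of Q u0 length, OF this]
    obtain u where Qu: "Q u" "\<forall>u'. Q u' \<longrightarrow> length u \<le> length u'" by blast
    have u: "\<exists>W'. W = W' @ u" "u \<noteq> []" "hw u = 0" using Qu(1) unfolding Q_def by blast+
    obtain W' where W': "W = W' @ u" using u by blast
    obtain l1 u1 where u1: "u = l1 # u1" using u by (cases u) auto
    obtain M l2 w2 where *: "u1 = M @ l2 # w2" "hw M = 0" "hw w2 = 0" "dir l2 = flip (dir l1)"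
      "\<forall>A B. M = A @ B \<longrightarrow> gn (dir l1) + hw A \<in> cone (dir l1)" using first_return[of l1 u1] u u1 by blast
    have "w2 = []"
    proof (rule ccontr)
      assume "w2 \<noteq> []"
      moreover have "W = (W' @ l1 # M @ [l2]) @ w2" using W' u1 * by simp
      ultimately have "Q w2" using *(3) unfolding Q_def by blast
      then have "length u \<le> length w2" using Qu(2) by blast
      then show False using u1 * by simp
    qed
    then have ul: "u = l1 # M @ [l2]" using u1 * by simp
    have "tight u" using tight_factor[of "K @ W'" u "[]"] tight W' by simp
    then have E: "EL (dir l1) u" using EL_parse[of l1 M l2] * ul by simp
    have rot: "cyc_tight ((u @ K) @ W')" using cyc_tight_rotate[of "K @ W'" u] 1(2) W' by simp
    have top: "toplevel (u @ K) = insert (dir l1) (toplevel K)"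
    proof -
      have "toplevel u = {dir l1}" unfolding ul by (rule toplevel_excursion) (use *(5) zero_notin_cone in metis)
      then show ?thesis using toplevel_append[OF u(3), of K] by simp
    qed
    have s: "dir l1 \<notin> toplevel K"
    proof
      assume "dir l1 \<in> toplevel K"
      then obtain A l B where A: "K = A @ l # B" "hw A = 0" "dir l = dir l1" by (rule toplevelE)
      have "revisit_free ([] @ l1 # M @ l2 # A @ l # (B @ W'))" using cyc_tight_tight[OF rot] A ul by (simp add: tight_def)
      from revisit_freeD[OF this *(4) A(3) *(2) A(2)] show False .
    qed
    have "no_closed_prefix W'" using no_closed_prefix W' unfolding no_closed_prefix_def by simp
    moreover have "hw W' \<noteq> 0" using 1(3) W' u(3) by auto
    ultimately have "VL (toplevel (u @ K)) W'"
      using IH[of W' "u @ K"] rot W' u 1(4) by auto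
    then show ?thesis using VL_E[OF s _ E, of W'] top W' by simp
  next
    case True
    have "W \<noteq> []" using 1(3) by auto
    then obtain l1 W0 where W0: "W = l1 # W0" by (cases W) auto
    have s: "dir l1 \<notin> toplevel K"
    proof
      assume "dir l1 \<in> toplevel K"
      then obtain A l B where A: "K = A @ l # B" "hw A = 0" "dir l1 = dir l" unfolding toplevel_def by blast
      show False using revisit_free_after[of "[]" A l B l1 W0] tight A W0 1(4) by (simp add: tight_def)
    qed
    show ?thesis
    proof (cases "dir (last W) = flip (dir l1)")
      case True
      then have "W0 \<noteq> []" using W0 by auto
      then obtain W1 l2 where W1: "W0 = W1 @ [l2]" by (metis append_butlast_last_id)
      have d: "dir l2 = flip (dir l1)" using True W0 W1 by simp
      \<comment> \<open>The base point moves to the far end of the edge of l1, and the layer around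
        K becomes the new context.\<close>
      have rot: "cyc_tight ((l2 # K @ [l1]) @ W1)" using cyc_tight_rotate[of "K @ l1 # W1" "[l2]"] 1(2) W0 W1 by simp
      have "toplevel (l2 # K @ [l1]) = {dir l2}"
      proof (rule toplevel_excursion)
        fix A B assume A: "K = A @ B"
        show "gn (dir l2) + hw A \<noteq> 0"
        proof
          assume "gn (dir l2) + hw A = 0"
          then have "hw A = gn (dir l1)" using d by (metis gn_flip_cancel_left(1) add.right_neutral)
          then have "hw A \<in> cone (dir l1)" by simp
          from enter_split[OF this] obtain C l D where "A = C @ l # D" "hw C = 0" "dir l = dir l1" by blast
          then have "K = C @ l # (D @ B)" using A by simp
          then have "dir l \<in> toplevel K" using \<open>hw C = 0\<close> by (rule toplevelI)
          then show False using s \<open>dir l = dir l1\<close> by simp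
        qed
      qed
      moreover have "hw W1 \<noteq> 0" using 1(3) W0 W1 d by auto
      moreover have "hw (l2 # K @ [l1]) = 0" using d 1(4) by simp
      ultimately have "WL {flip (dir l1)} W1" using IH[of W1 "l2 # K @ [l1]"] rot W0 W1 d by simp
      moreover have "pre l1 \<noteq> post l2" if "toplevel K = {}"
      proof -
        have "tight ([] @ [l2, l1] @ W1)" using cyc_tight_tight[OF rot] toplevel_empty[OF that] by simp
        from tight_factor[OF this] show ?thesis using d by (auto simp: tight_def ok_pair_def)
      qed
      ultimately show ?thesis using VL_layer[of l1 "dir l1" l2 "toplevel K" W1] d s W0 W1 by simp
    next
      case False
      have "flip (dir (last W)) \<notin> toplevel K"
      proof
        assume "flip (dir (last W)) \<in> toplevel K"
        then obtain A l B where A: "K = A @ l # B" "hw A = 0" "dir l = flip (dir (last W))" by (rule toplevelE)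
        have "hw (l # B) = 0" using A 1(4) by simp
        from first_return[OF this] obtain M l2 w2 where *: "B = M @ l2 # w2" "hw M = 0" "dir l2 = flip (dir l)" by blast
        \<comment> \<open>With the last letter in front, the excursion of K along the same edge
          yields a revisit: across by the last letter, back by l, across again by l2.\<close>
        have "cyc_tight ([last W] @ K @ butlast W)"
          using cyc_tight_rotate[of "K @ butlast W" "[last W]"] 1(2) \<open>W \<noteq> []\<close> by simp
        then have "revisit_free ([] @ last W # A @ l # M @ l2 # (w2 @ butlast W))" using cyc_tight_tight A * by (simp add: tight_def)
        from revisit_freeD[OF this A(3) _ A(2) *(2)] show False using *(3) A(3) by simp
      qed
      moreover have "PL (dir l1) (dir (last W)) W"
        using PL_parse[OF _ \<open>W \<noteq> []\<close> no_closed_prefix \<open>no_closed_suffix W\<close>] tight_factor[of K W "[]"] tight W0 by simp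
      ultimately show ?thesis using VL_P[of "dir l1" "toplevel K" "dir (last W)" W] s False by (metis flip_flip)
    qed
  qed
  moreover have "WL (toplevel K) W"
  proof (cases "no_closed_prefix W")
    case True then show ?thesis using VL WL_V by blast
  next
    case False
    then obtain A B where AB: "W = A @ B" "A \<noteq> []" "hw A = 0" unfolding no_closed_prefix_def by blast
    then obtain l1 A1 where A1: "A = l1 # A1" by (cases A) auto
    obtain M l2 w2 where *: "A1 = M @ l2 # w2" "hw M = 0" "hw w2 = 0" "dir l2 = flip (dir l1)"
      "\<forall>A B. M = A @ B \<longrightarrow> gn (dir l1) + hw A \<in> cone (dir l1)" using first_return[of l1 A1] AB A1 by blast
    let ?u = "l1 # M @ [l2]"
    have W: "W = ?u @ (w2 @ B)" using AB A1 * by simp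
    have u0: "hw ?u = 0" using * by simp
    have "tight ?u" using tight_factor[of K ?u "w2 @ B"] tight W by simp
    then have E: "EL (dir l1) ?u" using EL_parse[of l1 M l2] * by simp
    have s: "dir l1 \<notin> toplevel K"
    proof
      assume "dir l1 \<in> toplevel K"
      then obtain A l B' where A: "K = A @ l # B'" "hw A = 0" "dir l1 = dir l" unfolding toplevel_def by blast
      show False using revisit_free_after[of "[]" A l B' l1 "M @ [l2] @ w2 @ B"] tight A W 1(4) by (simp add: tight_def)
    qed
    have top: "toplevel (K @ ?u) = insert (dir l1) (toplevel K)"
    proof -
      have "toplevel ?u = {dir l1}" by (rule toplevel_excursion) (use *(5) zero_notin_cone in metis)
      then show ?thesis using toplevel_append[OF 1(4), of ?u] by simp
    qed
    have "hw W = hw ?u + hw (w2 @ B)" unfolding W by (rule hw_append)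
    then have "hw (w2 @ B) \<noteq> 0" using 1(3) u0 by (metis add.right_neutral)
    then have "WL (toplevel (K @ ?u)) (w2 @ B)"
      using IH[of "w2 @ B" "K @ ?u"] 1(2) W u0 1(4) by simp
    then show ?thesis using WL_E[OF s E, of "w2 @ B"] top W by simp
  qed
  ultimately show ?case by blast
qed

lemma conj_geo_rotate_n: "conj_geo w \<Longrightarrow> conj_geo (rotate n w)"
  using conj_geo_rotate[of "take (n mod length w) w" "drop (n mod length w) w"] by (simp add: rotate_drop_take)

lemma conj_geo_revisit_free: "conj_geo w \<Longrightarrow> revisit_free w"
  unfolding revisit_free_def
proof (intro allI impI)
  fix A l1 U l2 V l3 B
  assume *: "conj_geo w" "w = A @ l1 # U @ l2 # V @ l3 # B" "dir l2 = flip (dir l1)" "dir l3 = dir l1" "hw U = 0" "hw V = 0"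
  show False
    by (rule conj_geo_no_revisit[of A "l1 # U @ l2 # V @ l3 # B" l1 U l2 V l3 "B @ A"]) (use * in auto)
qed

text \<open>A dark leaf can be removed only if a letter remains to take over its switchings; the
  second hypothesis guarantees this.\<close>

lemma conj_geo_ok:
  assumes "conj_geo w" "3 \<le> length w \<or> hw w \<noteq> 0"
  shows "successively ok_pair w"
proof -
  have "ok_pair l1 l2" if w: "w = A @ l1 # l2 # B" for A l1 l2 B
  proof (rule ccontr)
    assume "\<not> ok_pair l1 l2"
    then have d: "dir l2 = flip (dir l1)" "post l1 = pre l2" by (auto simp: ok_pair_def)
    then have "B @ A \<noteq> []" using assms(2) w by auto
    then show False using conj_geo_no_dark_leaf[of A "l1 # l2 # B" l1 l2 "B @ A"] assms(1) w d by simp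
  qed
  then show ?thesis unfolding successively_conv_nth
    by (metis Cons_nth_drop_Suc Suc_lessD append_take_drop_id)
qed

lemma hw_rotate: "hw (rotate n w) = 0 \<longleftrightarrow> hw w = 0"
proof -
  have "hw (y @ x) = 0" if "hw (x @ y) = 0" for x y
    using that by (simp add: add_eq_0_iff)
  then show ?thesis using rotate_drop_take[of n w] append_take_drop_id[of "n mod length w" w] by metis
qed

lemma conj_geo_cyc_tight:
  assumes "conj_geo w" "3 \<le> length w \<or> hw w \<noteq> 0"
  shows "cyc_tight w"
  unfolding cyc_tight_def tight_def
  using assms conj_geo_revisit_free[OF conj_geo_rotate_n] conj_geo_ok[OF conj_geo_rotate_n] hw_rotate by auto

lemma conj_geo_SL: assumes "conj_geo w" shows "SL w"
proof (cases "hw w = 0")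
  case False
  then have "cyc_tight ([] @ w)" using conj_geo_cyc_tight assms by simp
  from WL_parse[OF this False] have "WL {} w" by simp
  then show ?thesis by (rule SL_W)
next
  case True
  show ?thesis
  proof (cases w)
    case Nil then show ?thesis by (simp add: SL_Nil)
  next
    case (Cons l1 w1)
    obtain M l2 w2 where *: "w1 = M @ l2 # w2" "hw M = 0" "hw w2 = 0" "dir l2 = flip (dir l1)"
      "\<forall>A B. M = A @ B \<longrightarrow> gn (dir l1) + hw A \<in> cone (dir l1)" using first_return[of l1 w1] True Cons by blast
    have w: "w = l1 # M @ l2 # w2" using Cons * by simp
    show ?thesis
    proof (cases "M = [] \<and> w2 = []")
      case True
      have "ev w \<noteq> \<one>\<^bsub>Gam\<^esub>"
      proof
        assume "ev w = \<one>\<^bsub>Gam\<^esub>"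
        then have "conjugate Gam (ev []) (ev w)" using conjugate_rotate[of "[]" "[]"] by simp
        then show False using assms w unfolding conj_geo_def by fastforce
      qed
      then show ?thesis using SL_two * w True by simp
    next
      case False
      then have cyc_tight: "cyc_tight w" using conj_geo_cyc_tight[OF assms] w by (cases M; cases w2) auto
      then have tight: "tight w" by (rule cyc_tight_tight)
      have "tight (l1 # M @ [l2])" using tight_factor[of "[]" "l1 # M @ [l2]" w2] tight w by simp
      then have E: "EL (dir l1) (l1 # M @ [l2])" using EL_parse * by blast
      show ?thesis
      proof (cases "w2 = []")
        case True
        have "tight ([] @ [l2, l1] @ M)" using cyc_tight_tight[OF cyc_tight_rotate[of "l1 # M" "[l2]"]] cyc_tight w True by simp
        from tight_factor[OF this] have "pre l1 \<noteq> post l2" using * by (auto simp: tight_def ok_pair_def)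
        moreover have "NL {flip (dir l1)} M" using E by (cases rule: EL.cases) auto
        ultimately show ?thesis using SL_closed2[of l1 "dir l1" l2 M] * w True False by simp
      next
        case False
        have "NL {dir l1} w2"
        proof (rule NL_parse)
          show "tight w2" using tight_factor[of "l1 # M @ [l2]" w2 "[]"] tight w by simp
          fix A l B assume w2: "w2 = A @ l # B" "hw A = 0"
          have "revisit_free ([] @ l1 # M @ l2 # A @ l # B)" using tight w w2 by (simp add: tight_def)
          then show "dir l \<notin> {dir l1}" using revisit_freeD * w2 by blast
        qed (rule *)
        from SL_closed1[OF E this False] show ?thesis using w by simp
      qed
    qed
  qed
qed

theorem conj_geo_iff_SL: "conj_geo w \<longleftrightarrow> SL w" using conj_geo_SL SL_conj_geo by blast

section \<open>Unambiguous grammars\<close>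

fun sym_lang :: "('n \<Rightarrow> 't list \<Rightarrow> bool) \<Rightarrow> 'n + 't \<Rightarrow> 't list \<Rightarrow> bool" where
  "sym_lang L (Inr a) w \<longleftrightarrow> w = [a]"
| "sym_lang L (Inl B) w \<longleftrightarrow> L B w"

lemma ptree_sound:
  assumes sound: "\<And>A xs ws. (A, xs) \<in> P \<Longrightarrow> list_all2 (sym_lang L) xs ws \<Longrightarrow> L A (concat ws)"
  shows "ptree_ok P t \<Longrightarrow> sym_lang L (root t) (yield t)"
proof (induction t)
  case (Node A ts)
  then have "list_all2 (sym_lang L) (map root ts) (map yield ts)" by (auto simp: list_all2_conv_all_nth)
  then show ?case using sound[of A "map root ts" "map yield ts"] Node by simp
qed simp

text \<open>Unambiguity is reduced to one level: if a word determines the production and the factors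
  at each nonterminal, trees agree by induction. Any family L of languages closed under the
  productions may be used for this.\<close>

lemma ptree_unique:
  assumes sound: "\<And>A xs ws. (A, xs) \<in> P \<Longrightarrow> list_all2 (sym_lang L) xs ws \<Longrightarrow> L A (concat ws)"
    and unique: "\<And>A xs ws xs' ws'. (A, xs) \<in> P \<Longrightarrow> (A, xs') \<in> P \<Longrightarrow> list_all2 (sym_lang L) xs ws \<Longrightarrow>
      list_all2 (sym_lang L) xs' ws' \<Longrightarrow> concat ws = concat ws' \<Longrightarrow> xs = xs' \<and> ws = ws'"
  shows "ptree_ok P t \<Longrightarrow> ptree_ok P t' \<Longrightarrow> root t = root t' \<Longrightarrow> yield t = yield t' \<Longrightarrow> t = t'"
proof (induction t arbitrary: t')
  case (Leaf a) then show ?case by (cases t') auto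
next
  case (Node A ts)
  then obtain ts' where t': "t' = Node A ts'" by (cases t') auto
  have *: "sym_lang L (root u) (yield u)" if "ptree_ok P u" for u
    using that by (rule ptree_sound[rotated]) (rule sound)
  have "list_all2 (sym_lang L) (map root us) (map yield us)" if "\<forall>t \<in> set us. ptree_ok P t" for us
    using that * by (simp add: list_all2_conv_all_nth)
  then have "map root ts = map root ts' \<and> map yield ts = map yield ts'"
    using Node t' unique[of A "map root ts" "map root ts'" "map yield ts" "map yield ts'"] by simp
  moreover from this have "length ts = length ts'" by (metis length_map)
  ultimately have "ts = ts'"
    using Node t' by (intro nth_equalityI) (auto simp: list_eq_iff_nth_eq)
  then show ?case using t' by simp
qed

lemma ptree_map_ok:
  "ptree_ok P t \<Longrightarrow> ptree_ok ((\<lambda>(A, xs). (f A, map (map_sum f g) xs)) ` P) (map_ptree f g t)"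
  "root (map_ptree f g t) = map_sum f g (root t)"
  "yield (map_ptree f g t) = map g (yield t)"
proof (induction t)
  case (Node A ts)
  { case 1
    have "map root (map (map_ptree f g) ts) = map (map_sum f g) (map root ts)" using Node(2) by simp
    then have "(f A, map root (map (map_ptree f g) ts)) \<in> (\<lambda>(A, xs). (f A, map (map_sum f g) xs)) ` P"
      using 1 by (intro image_eqI[of _ _ "(A, map root ts)"]) auto
    then show ?case using 1 Node(1) by auto }
  { case 3 show ?case using Node(3) by (induction ts) auto }
qed auto

text \<open>Nonterminals are numbered injectively only on the finite set N that matters, so renaming
  back and forth is the identity only on trees of the renamed grammar; this is the claim
  \<open>ret\<close>.\<close>

lemma unambiguous_cfl_rename:
  fixes P :: "('n \<times> ('n + 't) list) set" and g :: "'t \<Rightarrow> 'u"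
  assumes fin: "finite P" and inj: "inj g" and unamb: "cfg_unambiguous P S0"
  shows "unambiguous_cfl (map g ` cfg_lang P S0)"
proof -
  define N where "N = insert S0 (fst ` P \<union> (\<Union>(A, xs) \<in> P. {B. Inl B \<in> set xs}))"
  have "finite {B. Inl B \<in> set xs}" for xs :: "('n + 't) list"
    by (rule finite_subset[of _ "projl ` set xs"]) (force simp: image_iff)+
  then have "finite N" unfolding N_def using fin by auto
  then obtain f :: "'n \<Rightarrow> nat" where f: "inj_on f N" using finite_imp_inj_to_nat_seg by metis
  define f' where "f' = inv_into N f"
  have f': "f' (f A) = A" if "A \<in> N" for A using f that by (simp add: f'_def)
  define g' where "g' = inv_into UNIV g"
  have g': "g' (g a) = a" for a using inj by (simp add: g'_def)
  let ?r = "\<lambda>f g (A, xs). (f A, map (map_sum f g) xs)"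
  let ?P = "?r f g ` P"
  have in_N: "A \<in> N" "\<And>B. Inl B \<in> set xs \<Longrightarrow> B \<in> N" if "(A, xs) \<in> P" for A xs
    using that by (force simp: N_def)+
  have "?r f' g' (?r f g p) = p" if "p \<in> P" for p
  proof -
    obtain A xs where p: "p = (A, xs)" by (cases p)
    have "map_sum f' g' (map_sum f g x) = x" if "x \<in> set xs" for x
    proof (cases x)
      case (Inl B)
      then have "B \<in> N" using that in_N(2)[of A xs B] \<open>p \<in> P\<close> p by simp
      then show ?thesis using Inl f' by simp
    qed (simp add: g')
    then have "map (map_sum f' g' \<circ> map_sum f g) xs = xs" by (simp add: map_idI)
    then show ?thesis using p that in_N[of A xs] f' by (simp only: prod.case map_map)
  qed
  then have P_back: "?r f' g' ` ?P = P" unfolding image_image by (simp cong: image_cong)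
  have ret: "map_ptree f g (map_ptree f' g' t) = t" if "ptree_ok ?P t" "root t \<in> map_sum f g ` (Inl ` N \<union> range Inr)" for t
    using that
  proof (induction t)
    case (Leaf a) then show ?case using g' by auto
  next
    case (Node A ts)
    obtain A0 xs where P: "(A0, xs) \<in> P" "A = f A0" "map root ts = map (map_sum f g) xs" using Node(2) by auto
    have "map_ptree f g (map_ptree f' g' t) = t" if t: "t \<in> set ts" for t
    proof (rule Node(1)[OF t])
      show "ptree_ok ?P t" using Node(2) t by simp
      have "root t \<in> set (map root ts)" using t by simp
      then obtain x where x: "x \<in> set xs" "root t = map_sum f g x" unfolding P(3) by auto
      have "x \<in> Inl ` N \<union> range Inr"
      proof (cases x)
        case (Inl B) then show ?thesis using in_N(2)[OF P(1)] x by blast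
      qed blast
      then show "root t \<in> map_sum f g ` (Inl ` N \<union> range Inr)" using x by blast
    qed
    then show ?case using P f' in_N[OF P(1)] by (simp add: map_idI)
  qed
  have S0: "S0 \<in> N" by (simp add: N_def)
  have r0: "Inl (f S0) \<in> map_sum f g ` (Inl ` N \<union> range Inr)"
    by (rule image_eqI[of _ _ "Inl S0"]) (use S0 in auto)
  have pt: "parse_trees ?P (f S0) (map g w) = map_ptree f g ` parse_trees P S0 w" for w
  proof
    show "map_ptree f g ` parse_trees P S0 w \<subseteq> parse_trees ?P (f S0) (map g w)"
      unfolding parse_trees_def using ptree_map_ok(1)[of P _ f g] ptree_map_ok(2,3)[of f g] by auto
    show "parse_trees ?P (f S0) (map g w) \<subseteq> map_ptree f g ` parse_trees P S0 w"
    proof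
      fix t assume t: "t \<in> parse_trees ?P (f S0) (map g w)"
      let ?t = "map_ptree f' g' t"
      have "ptree_ok P ?t" using ptree_map_ok(1)[of ?P t f' g'] t P_back by (simp add: parse_trees_def)
      moreover have "root ?t = Inl S0" using t ptree_map_ok(2)[of f' g' t] f'[OF S0] by (simp add: parse_trees_def)
      moreover have "yield ?t = w" using t ptree_map_ok(3)[of f' g' t] g' by (simp add: parse_trees_def comp_def)
      moreover have "map_ptree f g ?t = t" using t r0 by (intro ret) (auto simp: parse_trees_def)
      ultimately show "t \<in> map_ptree f g ` parse_trees P S0 w"
        unfolding parse_trees_def by (intro image_eqI[of _ _ ?t]) auto
    qed
  qed
  have lang: "cfg_lang ?P (f S0) = map g ` cfg_lang P S0"
  proof
    show "map g ` cfg_lang P S0 \<subseteq> cfg_lang ?P (f S0)" unfolding cfg_lang_def using pt by auto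
    show "cfg_lang ?P (f S0) \<subseteq> map g ` cfg_lang P S0"
    proof
      fix w assume "w \<in> cfg_lang ?P (f S0)"
      then obtain t where t: "t \<in> parse_trees ?P (f S0) w" unfolding cfg_lang_def by auto
      have "map_ptree f g (map_ptree f' g' t) = t" using t r0 by (intro ret) (auto simp: parse_trees_def)
      then have "yield t = map g (yield (map_ptree f' g' t))" using ptree_map_ok(3) by metis
      then have w: "w = map g (yield (map_ptree f' g' t))" using t by (simp add: parse_trees_def)
      then have "parse_trees P S0 (yield (map_ptree f' g' t)) \<noteq> {}" using pt t by blast
      then show "w \<in> map g ` cfg_lang P S0" using w unfolding cfg_lang_def by blast
    qed
  qed
  have "cfg_unambiguous ?P (f S0)" unfolding cfg_unambiguous_def lang
  proof
    fix w assume "w \<in> map g ` cfg_lang P S0"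
    then obtain v where v: "w = map g v" "v \<in> cfg_lang P S0" by auto
    then obtain t where "\<And>t'. t' \<in> parse_trees P S0 v \<longleftrightarrow> t' = t" using unamb unfolding cfg_unambiguous_def by blast
    then have "parse_trees P S0 v = {t}" by auto
    then show "\<exists>!t. t \<in> parse_trees ?P (f S0) w" unfolding v(1) pt by simp
  qed
  then show ?thesis unfolding unambiguous_cfl_def using fin lang by (intro exI[of _ ?P] exI[of _ "f S0"]) simp
qed

section \<open>Unique factorisation into excursions, layers and paths\<close>

lemma cr_prefix:
  assumes "set (cr w) \<subseteq> branch s" "distinct (cr w)" "w = A @ B" "A \<noteq> []" "B \<noteq> []"
  shows "hw A \<in> cone s"
proof -
  have len: "length A < length w" "0 < length w" using assms by auto
  have i: "cr w ! length A = (hw A, dir (w ! length A))" "cr w ! 0 = (0, dir (w ! 0))"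
    using cr_nth[OF len(1)] cr_nth[OF len(2)] assms(3) by auto
  then have b: "(hw A, dir (w ! length A)) \<in> branch s" "(0, dir (w ! 0)) \<in> branch s"
    using assms(1) len by (metis length_cr nth_mem subsetD)+
  have "cr w ! length A \<noteq> cr w ! 0" using assms len by (simp add: nth_eq_iff_index_eq)
  then show ?thesis using b unfolding i by (auto simp: branch_def)
qed

lemma EL_prefix: "EL s u \<Longrightarrow> u = A @ B \<Longrightarrow> A \<noteq> [] \<Longrightarrow> B \<noteq> [] \<Longrightarrow> hw A \<in> cone s"
  using cr_prefix EL_NL_facts(1) by blast

lemma EL_prefix0: "EL s u \<Longrightarrow> u = A @ B \<Longrightarrow> hw A = 0 \<or> hw A \<in> cone s"
  using EL_prefix[of s u A B] EL_NL_facts(1)[of s u] by (cases "A = []"; cases "B = []") auto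

lemma PL_prefix: "PL c d w \<Longrightarrow> w = A @ B \<Longrightarrow> A \<noteq> [] \<Longrightarrow> hw A \<in> cone c"
  using cr_prefix[of w c A B] PL_facts[of c d w] by (cases "B = []") auto

text \<open>Excursions form a prefix code, because they close up only at their last letter.\<close>

lemma EL_unique_prefix:
  assumes "EL s u" "EL s' u'" "u @ x = u' @ y"
  shows "s = s' \<and> u = u' \<and> x = y"
proof -
  have ne: "u \<noteq> []" "u' \<noteq> []" and z: "hw u = 0" "hw u' = 0" and d: "dir (hd u) = s" "dir (hd u') = s'"
    using EL_NL_facts(1) assms by blast+
  have "hd u = hd u'" using assms(3) ne by (metis hd_append2)
  have "u = u'"
  proof -
    from assms(3) obtain us where "u = u' @ us \<or> u @ us = u'" by (auto simp: append_eq_append_conv2)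
    then show ?thesis
      using EL_prefix[OF assms(1), of u' us] EL_prefix[OF assms(2), of u us] ne z by (cases "us = []") auto
  qed
  then show ?thesis using \<open>hd u = hd u'\<close> d assms by simp
qed

lemma EL_unique_suffix:
  assumes "EL s u" "EL s' u'" "x @ u = y @ u'"
  shows "s = s' \<and> u = u' \<and> x = y"
proof -
  have ne: "u \<noteq> []" "u' \<noteq> []" and z: "hw u = 0" "hw u' = 0" and d: "dir (hd u) = s" "dir (hd u') = s'"
    using EL_NL_facts(1) assms by blast+
  have "u = u'"
  proof -
    from assms(3) obtain us where us: "u = us @ u' \<or> us @ u = u'" by (auto simp: append_eq_append_conv2)
    then have "hw us = 0" using z by auto
    then show ?thesis
      using us EL_prefix[OF assms(1), of us u'] EL_prefix[OF assms(2), of us u] ne by (cases "us = []") auto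
  qed
  then show ?thesis using d assms by simp
qed

lemma closed_no_closed_prefix_unique:
  assumes "hw u = 0" "hw u' = 0" "no_closed_prefix v" "no_closed_prefix v'" "u @ v = u' @ v'"
  shows "u = u'"
proof -
  from assms(5) obtain us where us: "u = u' @ us \<and> us @ v = v' \<or> u @ us = u' \<and> v = us @ v'"
    by (auto simp: append_eq_append_conv2)
  then have "hw us = 0" using assms(1,2) by auto
  then have "us = []" using us assms(3,4) unfolding no_closed_prefix_def by metis
  then show ?thesis using us by auto
qed

lemma NL_avoids: assumes "NL F u" "u = A @ B" "t \<in> F" shows "hw A \<notin> cone t"
proof
  assume "hw A \<in> cone t"
  then obtain C l D where C: "A = C @ l # D" "hw C = 0" "dir l = t" using enter_split by blast
  have u: "u = C @ l # (D @ B)" using C assms by simp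
  then have "(0, t) \<in> set (cr u)" using C by (simp add: cr_append sh_def)
  then obtain t' where "t' \<notin> F" "(0, t) \<in> branch t'" using EL_NL_facts(2)[OF assms(1)] by blast
  then show False using assms(3) by (auto simp: branch_def)
qed

text \<open>The time reversal of \<open>PL_prefix\<close>: seen from its end, the path lies beyond
  the reverse of its last step.\<close>

lemma PL_suffix: "PL c d w \<Longrightarrow> w = A @ B \<Longrightarrow> B \<noteq> [] \<Longrightarrow> - hw B \<in> cone (flip d)"
proof (induction arbitrary: A B rule: PL.induct)
  case (PL_one l c) then show ?case by (cases A) auto
next
  case (PL_Cons l c c' u d v)
  have v: "- hw v \<in> cone (flip d)" using PL_Cons(5)[of "[]" v] PL_facts[OF PL_Cons(4)] by simp
  have vc: "hw v \<in> cone c'" using PL_facts[OF PL_Cons(4)] by simp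
  have u0: "hw u = 0" using EL_NL_facts(2)[OF PL_Cons(3)] by simp
  \<comment> \<open>Leaving this half-tree would mean passing through the end point of v, but the
    excursions u avoid the direction in which v departs.\<close>
  have in_u: "- hw v + hw A' \<in> cone (flip d)" if u: "u = A' @ B'" for A' B'
  proof (rule ccontr)
    assume "- hw v + hw A' \<notin> cone (flip d)"
    from exit_split[OF v this] obtain M l2 w2 where *: "A' = M @ l2 # w2" "- hw v + hw M = gn (flip d)" "dir l2 = flip (flip d)"
      by blast
    have "- hw v + hw (M @ [l2]) = 0" using *(2,3) by (simp add: add.assoc[symmetric])
    then have "hw (M @ [l2]) = hw v" by (metis add.inverse_inverse minus_unique)
    moreover have "hw (M @ [l2]) \<notin> cone c'" using NL_avoids[OF PL_Cons(3), of "M @ [l2]" "w2 @ B'" c'] u * by simp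
    ultimately show False using vc by simp
  qed
  consider "A = []" | A' B' where "u = A' @ B'" "B = B' @ v" | A' where "v = A' @ B"
    using PL_Cons(6) by (cases A) (auto simp: append_eq_append_conv2)
  then show ?case
  proof cases
    case 1
    then have "B = l # u @ v" using PL_Cons(6) by simp
    then have B: "hw B = gn c + hw v" using PL_Cons(1) u0 by simp
    have "- hw B = - hw v + gn (flip c)" unfolding B by (simp add: minus_add)
    moreover have "- hw v + gn (flip c) \<in> cone (flip d)"
    proof (rule ccontr)
      assume "- hw v + gn (flip c) \<notin> cone (flip d)"
      from cone_exit[OF v this] have "- hw v = gn (flip d)" "flip c = flip (flip d)" by auto
      then have "hw v = gn (flip c)" by (metis add.inverse_inverse uminus_gn)
      then show False using vc PL_Cons(2) by simp
    qed
    ultimately show ?thesis by simp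
  next
    case (2 A' B')
    then have "- hw B' = hw A'" using u0 by (simp add: minus_unique)
    (metis add.inverse_inverse minus_unique)
    then have "- hw B = - hw v + hw A'" using 2 by (simp add: minus_add)
    then show ?thesis using in_u[OF 2(1)] by simp
  next
    case 3 then show ?thesis using PL_Cons by blast
  qed
qed

text \<open>\<open>hw A\<close> is a position seen from the start of w, \<open>- hw B\<close> one
  seen from its end. Both points become one vertex of the cyclic word, so the directions in F are
  excluded from either side.\<close>

definition avoids :: "gen set \<Rightarrow> letter list \<Rightarrow> bool" where
  "avoids F w \<longleftrightarrow> (\<forall>A B. w = A @ B \<longrightarrow> (\<forall>t \<in> F. hw A \<notin> cone t \<and> - hw B \<notin> cone t)) \<and> hw w \<noteq> 0"

lemma layer_facts:
  assumes w: "avoids {flip s} w" and d: "dir l1 = s" "dir l2 = flip s" and AB: "l1 # w @ [l2] = A @ B"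
  shows "A \<noteq> [] \<Longrightarrow> hw A \<in> cone s" "B \<noteq> [] \<Longrightarrow> - hw B \<in> cone s"
proof -
  have L: "gn s + hw A \<in> cone s" "gn s + - hw B \<in> cone s" if "w = A @ B" for A B
    using w that gn_plus_in_cone[of s "hw A"] gn_plus_in_cone[of s "- hw B"] unfolding avoids_def by blast+
  have nz: "hw w \<noteq> 0" using w unfolding avoids_def by blast
  have 1: "gn s + hw w + gn (flip s) \<in> cone s"
    using cone_exit[of "gn s + hw w" s "flip s"] L(1)[of w "[]"] nz by (metis add.right_neutral add_left_imp_eq append_Nil2)
  have 2: "gn s + - hw w + gn (flip s) \<in> cone s"
    using cone_exit[of "gn s + - hw w" s "flip s"] L(2)[of "[]" w] nz
    by (metis add.right_neutral add_left_imp_eq append_Nil neg_equal_0_iff_equal)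
  have cases: "A = [] \<or> B = [] \<or> (\<exists>A' B'. A = l1 # A' \<and> B = B' @ [l2] \<and> w = A' @ B')"
  proof (cases A)
    case (Cons a A')
    then have "w @ [l2] = A' @ B" "a = l1" using AB by auto
    then show ?thesis using Cons by (cases B rule: rev_cases) auto
  qed simp
  have m: "- (hw B' + gn (flip s)) = gn s + - hw B'" for B' by (simp add: minus_add)
  have e: "- (gn s + (hw w + gn (flip s))) = gn s + - hw w + gn (flip s)" by (simp add: minus_add add.assoc)
  show "hw A \<in> cone s" if "A \<noteq> []"
    using cases that AB L(1) 1 d by (auto simp: add.assoc)
  show "- hw B \<in> cone s" if B: "B \<noteq> []"
  proof -
    consider "A = []" | A' B' where "A = l1 # A'" "B = B' @ [l2]" "w = A' @ B'" using cases B by blast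
    then show ?thesis
    proof cases
      case 1 then have "hw B = gn s + (hw w + gn (flip s))" using AB d by auto
      then show ?thesis using 2 e by simp
    next
      case (2 A' B') then have "hw B = hw B' + gn (flip s)" using d by simp
      then show ?thesis using m L(2)[OF 2(3)] by simp
    qed
  qed
qed

text \<open>These facts separate the alternatives of the grammar: a word of \<open>VL\<close> has no
  closed prefix, hence never begins with an excursion, and no word of \<open>WL\<close> closes
  up.\<close>

lemma WL_VL_facts:
  "WL F w \<Longrightarrow> avoids F w"
  "VL F w \<Longrightarrow> avoids F w \<and> no_closed_prefix w"
proof (induction rule: WL_VL.inducts)
  case (WL_E t F u w)
  have u0: "hw u = 0" using EL_NL_facts(1)[OF WL_E(2)] by simp
  have w: "\<And>A B t'. w = A @ B \<Longrightarrow> t' \<in> insert t F \<Longrightarrow> hw A \<notin> cone t' \<and> - hw B \<notin> cone t'" "hw w \<noteq> 0"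
    using WL_E unfolding avoids_def by blast+
  show ?case unfolding avoids_def
  proof (intro conjI allI impI ballI)
    show "hw (u @ w) \<noteq> 0" using u0 w by simp
    fix A B t' assume AB: "u @ w = A @ B" "t' \<in> F"
    consider us where "u = A @ us" "B = us @ w" | us where "A = u @ us" "w = us @ B"
      using AB by (auto simp: append_eq_append_conv2)
    then have "hw A \<notin> cone t' \<and> - hw B \<notin> cone t'"
    proof cases
      case (1 us)
      have A: "hw A = 0 \<or> hw A \<in> cone t" using EL_prefix0[OF WL_E(2) 1(1)] .
      have "- hw us = hw A" using 1 u0 by (metis add.inverse_inverse hw_append minus_unique)
      then have B: "- hw B = - hw w + hw A" using 1 by (simp add: minus_add)
      have "- hw w + hw A \<notin> cone t'"
      proof
        assume "- hw w + hw A \<in> cone t'"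
        moreover have "- hw w \<notin> cone t'" using w(1)[of "[]" w t'] AB by simp
        ultimately obtain C l D where C: "A = C @ l # D" "- hw w + hw C = 0" using enter_split_from by blast
        then have "hw C = hw w" by (metis add.inverse_inverse minus_unique)
        moreover have "hw C = 0 \<or> hw C \<in> cone t" using EL_prefix0[OF WL_E(2), of C] 1 C by simp
        ultimately show False using w(1)[of w "[]" t] w(2) by auto
      qed
      then show ?thesis using A B WL_E(1) AB(2) cone_disjoint[of "hw A" t t'] by auto
    next
      case (2 us) then show ?thesis using w(1)[of us B t'] AB u0 by simp
    qed
    then show "hw A \<notin> cone t'" "- hw B \<notin> cone t'" by blast+
  qed
next
  case (VL_E t F w u)
  have u0: "hw u = 0" using EL_NL_facts(1)[OF VL_E(3)] by simp
  have w: "\<And>A B t'. w = A @ B \<Longrightarrow> t' \<in> insert t F \<Longrightarrow> hw A \<notin> cone t' \<and> - hw B \<notin> cone t'" "hw w \<noteq> 0" "no_closed_prefix w"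
    using VL_E unfolding avoids_def by blast+
  have no0: "hw w + hw C \<noteq> 0" if u: "u = C @ D" for C D
  proof
    assume "hw w + hw C = 0"
    then have "hw C = - hw w" by (simp add: minus_unique)
    moreover have "hw C = 0 \<or> hw C \<in> cone t" using EL_prefix0[OF VL_E(3) u] .
    ultimately show False using w(1)[of "[]" w t] w(2) by auto
  qed
  have "avoids F (w @ u)" unfolding avoids_def
  proof (intro conjI allI impI ballI)
    show "hw (w @ u) \<noteq> 0" using u0 w by simp
    fix A B t' assume AB: "w @ u = A @ B" "t' \<in> F"
    consider us where "w = A @ us" "B = us @ u" | us where "A = w @ us" "u = us @ B"
      using AB by (auto simp: append_eq_append_conv2)
    then have "hw A \<notin> cone t' \<and> - hw B \<notin> cone t'"
    proof cases
      case (1 us) then show ?thesis using w(1)[of A us t'] AB u0 by simp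
    next
      case (2 us)
      have A: "hw us = 0 \<or> hw us \<in> cone t" using EL_prefix0[OF VL_E(3) 2(2)] .
      have B: "- hw B = hw us" using 2 u0 by (metis add.inverse_inverse hw_append minus_unique)
      have "hw w + hw us \<notin> cone t'"
      proof
        assume "hw w + hw us \<in> cone t'"
        moreover have "hw w \<notin> cone t'" using w(1)[of w "[]" t'] AB by simp
        ultimately obtain C l D where C: "us = C @ l # D" "hw w + hw C = 0" using enter_split_from by blast
        then show False using no0[of C "l # D @ B"] 2 by simp
      qed
      then show ?thesis using A B 2 VL_E(1) AB(2) cone_disjoint[of "hw us" t t'] by auto
    qed
    then show "hw A \<notin> cone t'" "- hw B \<notin> cone t'" by blast+
  qed
  moreover have "no_closed_prefix (w @ u)" unfolding no_closed_prefix_def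
  proof (intro allI impI)
    fix A B assume AB: "w @ u = A @ B" "A \<noteq> []"
    consider us where "w = A @ us" "B = us @ u" | us where "A = w @ us" "u = us @ B"
      using AB by (auto simp: append_eq_append_conv2)
    then show "hw A \<noteq> 0"
    proof cases
      case 1 then show ?thesis using w(3) AB unfolding no_closed_prefix_def by blast
    next
      case (2 us) then show ?thesis using no0[of us B] by simp
    qed
  qed
  ultimately show ?case ..
next
  case (VL_layer l1 s l2 F w)
  note f = layer_facts[OF VL_layer.IH VL_layer(1,2)]
  have nc: "t \<in> F \<Longrightarrow> x \<in> cone s \<Longrightarrow> x \<notin> cone t" for t x using VL_layer(3) cone_disjoint by blast
  have "avoids F (l1 # w @ [l2])" unfolding avoids_def
  proof (intro conjI allI impI ballI)
    show "hw (l1 # w @ [l2]) \<noteq> 0" using f(1)[of "l1 # w @ [l2]" "[]"] by (metis append_Nil2 list.distinct(1) zero_notin_cone)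
    fix A B t assume "l1 # w @ [l2] = A @ B" "t \<in> F"
    then show "hw A \<notin> cone t" "- hw B \<notin> cone t" using f[of A B] nc by (cases "A = []"; cases "B = []"; fastforce)+
  qed
  moreover have "no_closed_prefix (l1 # w @ [l2])" unfolding no_closed_prefix_def using f(1) zero_notin_cone by metis
  ultimately show ?case ..
next
  case (VL_P c F d w)
  have nc: "x \<notin> cone t" if "t \<in> F" "x \<in> cone c \<or> x \<in> cone (flip d)" for t x
    using VL_P(1,2) that cone_disjoint by blast
  have "avoids F w" unfolding avoids_def
  proof (intro conjI allI impI ballI)
    show "hw w \<noteq> 0" using PL_facts[OF VL_P(4)] by (metis zero_notin_cone)
    fix A B t assume "w = A @ B" "t \<in> F"
    then show "hw A \<notin> cone t" "- hw B \<notin> cone t"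
      using PL_prefix[OF VL_P(4), of A B] PL_suffix[OF VL_P(4), of A B] nc by (cases "A = []"; cases "B = []"; fastforce)+
  qed
  moreover have "no_closed_prefix w" unfolding no_closed_prefix_def using PL_prefix[OF VL_P(4)] zero_notin_cone by metis
  ultimately show ?case ..
qed auto

section \<open>The grammar\<close>

datatype nt = ES gen | NS "gen set" | PS gen gen | WS "gen set" | VS "gen set" | Start

text \<open>Conditions that depend on the emptiness of a factor are split into separate productions.
  A nonempty interior therefore shows its first excursion explicitly, and every leaf condition
  concerns letters of a single production.\<close>

inductive prodn :: "nt \<Rightarrow> (nt + letter) list \<Rightarrow> bool" where
  ES_leaf: "dir l1 = s \<Longrightarrow> dir l2 = flip s \<Longrightarrow> post l1 \<noteq> pre l2 \<Longrightarrow> prodn (ES s) [Inr l1, Inr l2]"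
| ES_node: "dir l1 = s \<Longrightarrow> dir l2 = flip s \<Longrightarrow> t \<noteq> flip s \<Longrightarrow>
    prodn (ES s) [Inr l1, Inl (ES t), Inl (NS {flip s, t}), Inr l2]"
| NS_Nil: "prodn (NS F) []"
| NS_Cons: "t \<notin> F \<Longrightarrow> prodn (NS F) [Inl (ES t), Inl (NS (insert t F))]"
| PS_one: "dir l = c \<Longrightarrow> prodn (PS c c) [Inr l]"
| PS_Cons: "dir l = c \<Longrightarrow> c' \<noteq> flip c \<Longrightarrow> prodn (PS c d) [Inr l, Inl (NS {flip c, c'}), Inl (PS c' d)]"
| WS_E: "t \<notin> F \<Longrightarrow> prodn (WS F) [Inl (ES t), Inl (WS (insert t F))]"
| WS_V: "prodn (WS F) [Inl (VS F)]"
| VS_E: "t \<notin> F \<Longrightarrow> prodn (VS F) [Inl (VS (insert t F)), Inl (ES t)]"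
| VS_layer: "dir l1 = s \<Longrightarrow> dir l2 = flip s \<Longrightarrow> s \<notin> F \<Longrightarrow> (F = {} \<longrightarrow> pre l1 \<noteq> post l2) \<Longrightarrow>
    prodn (VS F) [Inr l1, Inl (WS {flip s}), Inr l2]"
| VS_P: "c \<notin> F \<Longrightarrow> flip d \<notin> F \<Longrightarrow> flip d \<noteq> c \<Longrightarrow> prodn (VS F) [Inl (PS c d)]"
| Start_Nil: "prodn Start []"
| Start_two: "dir l2 = flip (dir l1) \<Longrightarrow> ev [l1, l2] \<noteq> \<one>\<^bsub>Gam\<^esub> \<Longrightarrow> prodn Start [Inr l1, Inr l2]"
| Start_closed1: "t \<noteq> t' \<Longrightarrow> prodn Start [Inl (ES t), Inl (ES t'), Inl (NS {t, t'})]"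
| Start_closed2: "dir l1 = s \<Longrightarrow> dir l2 = flip s \<Longrightarrow> t \<noteq> flip s \<Longrightarrow> pre l1 \<noteq> post l2 \<Longrightarrow>
    prodn Start [Inr l1, Inl (ES t), Inl (NS {flip s, t}), Inr l2]"
| Start_W: "prodn Start [Inl (WS {})]"

fun lang :: "nt \<Rightarrow> letter list \<Rightarrow> bool" where
  "lang (ES s) = EL s"
| "lang (NS F) = NL F"
| "lang (PS c d) = PL c d"
| "lang (WS F) = WL F"
| "lang (VS F) = VL F"
| "lang Start = SL"

abbreviation "sl \<equiv> sym_lang lang"

lemma NL_two: "t \<noteq> s \<Longrightarrow> EL t u \<Longrightarrow> NL {s, t} v \<Longrightarrow> NL {s} (u @ v)"
  using NL_Cons[of t "{s}" u v] by (simp add: insert_commute)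

lemma EL_nonempty: "EL s u \<Longrightarrow> u \<noteq> []" using EL_NL_facts(1) by blast

lemma lang_sound: "prodn A xs \<Longrightarrow> list_all2 sl xs ws \<Longrightarrow> lang A (concat ws)"
proof (induction rule: prodn.induct)
  case (ES_leaf l1 s l2)
  then show ?case using EL_I[of l1 s l2 "[]"] NL_Nil by (auto simp: list_all2_Cons1)
next
  case (ES_node l1 s l2 t)
  then obtain u v where *: "ws = [[l1], u, v, [l2]]" "EL t u" "NL {flip s, t} v" by (simp add: list_all2_Cons1, ((elim exE conjE)?, simp)?)
  have "NL {flip s} (u @ v)" using NL_two * ES_node by blast
  then have "EL s (l1 # (u @ v) @ [l2])" using ES_node EL_nonempty[OF *(2)] by (intro EL_I) auto
  then show ?case using * by simp
next
  case (NS_Cons t F)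
  then obtain u v where "ws = [u, v]" "EL t u" "NL (insert t F) v" by (simp add: list_all2_Cons1, ((elim exE conjE)?, simp)?)
  then show ?case using NL_Cons[of t F u v] NS_Cons by simp
next
  case (PS_one l c) then have "ws = [[l]]" by (simp add: list_all2_Cons1, ((elim exE conjE)?, simp)?)
  then show ?case using PL_one[of l c] PS_one by simp
next
  case (PS_Cons l c c' d)
  then obtain u v where "ws = [[l], u, v]" "NL {flip c, c'} u" "PL c' d v" by (simp add: list_all2_Cons1, ((elim exE conjE)?, simp)?)
  then show ?case using PL_Cons[of l c c' u d v] PS_Cons by simp
next
  case (WS_E t F)
  then obtain u v where "ws = [u, v]" "EL t u" "WL (insert t F) v" by (simp add: list_all2_Cons1, ((elim exE conjE)?, simp)?)
  then show ?case using WL_E[of t F u v] WS_E by simp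
next
  case (WS_V F)
  then obtain u where "ws = [u]" "VL F u" by (simp add: list_all2_Cons1, ((elim exE conjE)?, simp)?)
  then show ?case using WL_V[of F u] by simp
next
  case (VS_E t F)
  then obtain u v where "ws = [v, u]" "EL t u" "VL (insert t F) v" by (simp add: list_all2_Cons1, ((elim exE conjE)?, simp)?)
  then show ?case using VL_E[of t F v u] VS_E by simp
next
  case (VS_layer l1 s l2 F)
  then obtain u where "ws = [[l1], u, [l2]]" "WL {flip s} u" by (simp add: list_all2_Cons1, ((elim exE conjE)?, simp)?)
  then show ?case using VL_layer[of l1 s l2 F u] VS_layer by simp
next
  case (VS_P c F d)
  then obtain u where "ws = [u]" "PL c d u" by (simp add: list_all2_Cons1, ((elim exE conjE)?, simp)?)
  then show ?case using VL_P[of c F d u] VS_P by simp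
next
  case (Start_two l2 l1) then have "ws = [[l1], [l2]]" by (simp add: list_all2_Cons1, ((elim exE conjE)?, simp)?)
  then show ?case using SL_two[of l2 l1] Start_two by simp
next
  case (Start_closed1 t t')
  then obtain u u' v where *: "ws = [u, u', v]" "EL t u" "EL t' u'" "NL {t, t'} v" by (simp add: list_all2_Cons1, ((elim exE conjE)?, simp)?)
  have "NL {t} (u' @ v)" using NL_two[of t' t u' v] * Start_closed1 by simp
  then show ?case using SL_closed1[OF *(2), of "u' @ v"] EL_nonempty[OF *(3)] * by simp
next
  case (Start_closed2 l1 s l2 t)
  then obtain u v where *: "ws = [[l1], u, v, [l2]]" "EL t u" "NL {flip s, t} v" by (simp add: list_all2_Cons1, ((elim exE conjE)?, simp)?)
  have "NL {flip s} (u @ v)" using NL_two * Start_closed2 by blast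
  then show ?case using SL_closed2[of l1 s l2 "u @ v"] EL_nonempty[OF *(2)] * Start_closed2 by simp
next
  case Start_W
  then obtain u where "ws = [u]" "WL {} u" by (simp add: list_all2_Cons1, ((elim exE conjE)?, simp)?)
  then show ?case using SL_W[of u] by simp
qed (auto intro: NL_Nil SL_Nil)

definition prods :: "(nt \<times> (nt + letter) list) set" where "prods = {(A, xs). prodn A xs}"

definition derives :: "nt \<Rightarrow> letter list \<Rightarrow> bool" where
  "derives A w \<longleftrightarrow> (\<exists>t. ptree_ok prods t \<and> root t = Inl A \<and> yield t = w)"

lemma derivesI:
  assumes "prodn A xs" "list_all2 (sym_lang derives) xs ws" "concat ws = w"
  shows "derives A w"
proof -
  have "\<exists>ts. map root ts = xs \<and> map yield ts = ws \<and> (\<forall>t \<in> set ts. ptree_ok prods t)"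
    using assms(2)
  proof (induction rule: list_all2_induct)
    case (Cons x xs w ws)
    then obtain ts where ts: "map root ts = xs" "map yield ts = ws" "\<forall>t \<in> set ts. ptree_ok prods t" by blast
    have "\<exists>t. root t = x \<and> yield t = w \<and> ptree_ok prods t"
    proof (cases x)
      case (Inl B) then show ?thesis using Cons(1) by (auto simp: derives_def)
    next
      case (Inr a) then show ?thesis using Cons(1) by (intro exI[of _ "Leaf a"]) simp
    qed
    then obtain t where "root t = x" "yield t = w" "ptree_ok prods t" by blast
    then show ?case using ts by (intro exI[of _ "t # ts"]) simp
  qed simp
  then obtain ts where "map root ts = xs" "map yield ts = ws" "\<forall>t \<in> set ts. ptree_ok prods t" by blast
  then show ?thesis unfolding derives_def using assms(1,3) by (intro exI[of _ "Node A ts"]) (simp add: prods_def)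
qed

text \<open>Supplies the explicit first excursion that productions with nonempty interior
  require.\<close>

lemma derives_NS:
  assumes "derives (NS F) w" "w \<noteq> []"
  shows "\<exists>t u v. t \<notin> F \<and> w = u @ v \<and> derives (ES t) u \<and> derives (NS (insert t F)) v"
proof -
  obtain ts where t: "ptree_ok prods (Node (NS F) ts)" "yield (Node (NS F) ts) = w"
    using assms unfolding derives_def by (metis Inl_inject Inr_Inl_False ptree.exhaust root.simps)
  then have "prodn (NS F) (map root ts)" by (simp add: prods_def)
  then show ?thesis
  proof cases
    case NS_Nil then show ?thesis using t assms by simp
  next
    case (NS_Cons t)
    then obtain t1 t2 where "ts = [t1, t2]" "root t1 = Inl (ES t)" "root t2 = Inl (NS (insert t F))" by auto
    then show ?thesis using t NS_Cons unfolding derives_def by (intro exI[of _ t] exI[of _ "yield t1"] exI[of _ "yield t2"]) auto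
  qed
qed

lemma EL_NL_derives: "EL s w \<Longrightarrow> derives (ES s) w" "NL F w \<Longrightarrow> derives (NS F) w"
proof (induction rule: EL_NL.inducts)
  case (EL_I l1 s l2 M)
  show ?case
  proof (cases "M = []")
    case True
    then show ?thesis using EL_I by (intro derivesI[OF ES_leaf[of l1 s l2], of "[[l1], [l2]]"]) auto
  next
    case False
    then obtain t u v where *: "t \<notin> {flip s}" "M = u @ v" "derives (ES t) u" "derives (NS (insert t {flip s})) v"
      using derives_NS EL_I by blast
    then show ?thesis using EL_I
      by (intro derivesI[OF ES_node[of l1 s l2 t], of "[[l1], u, v, [l2]]"]) (auto simp: insert_commute)
  qed
next
  case (NL_Nil F) show ?case by (intro derivesI[OF NS_Nil, of "[]"]) auto
next
  case (NL_Cons t F u v) then show ?case by (intro derivesI[OF NS_Cons[of t F], of "[u, v]"]) auto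
qed

lemma PL_derives: "PL c d w \<Longrightarrow> derives (PS c d) w"
proof (induction rule: PL.induct)
  case (PL_one l c) then show ?case by (intro derivesI[OF PS_one[of l c], of "[[l]]"]) auto
next
  case (PL_Cons l c c' u d v)
  then show ?case using EL_NL_derives by (intro derivesI[OF PS_Cons[of l c c' d], of "[[l], u, v]"]) auto
qed

lemma WL_VL_derives: "WL F w \<Longrightarrow> derives (WS F) w" "VL F w \<Longrightarrow> derives (VS F) w"
proof (induction rule: WL_VL.inducts)
  case (WL_E t F u w) then show ?case using EL_NL_derives by (intro derivesI[OF WS_E[of t F], of "[u, w]"]) auto
next
  case (WL_V F w) then show ?case by (intro derivesI[OF WS_V[of F], of "[w]"]) auto
next
  case (VL_E t F w u) then show ?case using EL_NL_derives by (intro derivesI[OF VS_E[of t F], of "[w, u]"]) auto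
next
  case (VL_layer l1 s l2 F w) then show ?case by (intro derivesI[OF VS_layer[of l1 s l2 F], of "[[l1], w, [l2]]"]) auto
next
  case (VL_P c F d w) then show ?case using PL_derives by (intro derivesI[OF VS_P[of c F d], of "[w]"]) auto
qed

lemma SL_derives: "SL w \<Longrightarrow> derives Start w"
proof (induction rule: SL.induct)
  case SL_Nil show ?case by (intro derivesI[OF Start_Nil, of "[]"]) auto
next
  case (SL_two l2 l1) then show ?case by (intro derivesI[OF Start_two[of l2 l1], of "[[l1], [l2]]"]) auto
next
  case (SL_closed1 t u r)
  then obtain t' u' v where *: "t' \<notin> {t}" "r = u' @ v" "derives (ES t') u'" "derives (NS (insert t' {t})) v"
    using derives_NS EL_NL_derives by blast
  then show ?case using SL_closed1 EL_NL_derives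
    by (intro derivesI[OF Start_closed1[of t t'], of "[u, u', v]"]) (auto simp: insert_commute)
next
  case (SL_closed2 l1 s l2 M)
  then obtain t u v where *: "t \<notin> {flip s}" "M = u @ v" "derives (ES t) u" "derives (NS (insert t {flip s})) v"
    using derives_NS EL_NL_derives by blast
  then show ?case using SL_closed2
    by (intro derivesI[OF Start_closed2[of l1 s l2 t], of "[[l1], u, v, [l2]]"]) (auto simp: insert_commute)
next
  case (SL_W w) then show ?case using WL_VL_derives by (intro derivesI[OF Start_W, of "[w]"]) auto
qed

lemma finite_prods: "finite prods"
proof -
  let ?U = "range ES \<union> range NS \<union> range (\<lambda>(c, d). PS c d) \<union> range WS \<union> range VS \<union> {Start}"
  have "A \<in> ?U" for A by (cases A) (auto simp: image_iff)
  then have "UNIV \<subseteq> ?U" by blast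
  moreover have "finite ?U" by (intro finite_UnI finite_imageI) auto
  ultimately have "finite (UNIV :: nt set)" by (rule finite_subset)
  then have "finite (UNIV :: (nt + letter) set)" by (simp add: finite_Plus_UNIV_iff)
  then have "finite {xs :: (nt + letter) list. set xs \<subseteq> UNIV \<and> length xs \<le> 4}" by (rule finite_lists_length_le)
  then have "finite (UNIV \<times> {xs :: (nt + letter) list. length xs \<le> 4} :: (nt \<times> _) set)"
    using \<open>finite (UNIV :: nt set)\<close> by simp
  moreover have "prods \<subseteq> UNIV \<times> {xs. length xs \<le> 4}"
  proof
    fix p assume "p \<in> prods"
    then obtain A xs where p: "p = (A, xs)" "prodn A xs" by (auto simp: prods_def)
    from p(2) have "length xs \<le> 4" by cases auto
    then show "p \<in> UNIV \<times> {xs. length xs \<le> 4}" using p by simp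
  qed
  ultimately show ?thesis by (rule rev_finite_subset)
qed

section \<open>Each word determines its production and factors\<close>

lemma decomp_ES:
  assumes "prodn (ES s) xs" "list_all2 sl xs ws"
  obtains (leaf) l1 l2 where "xs = [Inr l1, Inr l2]" "ws = [[l1], [l2]]"
    | (node) l1 t u v l2 where "xs = [Inr l1, Inl (ES t), Inl (NS {flip s, t}), Inr l2]" "ws = [[l1], u, v, [l2]]"
        "EL t u" "NL {flip s, t} v"
  using assms(1)
proof cases
  case (ES_leaf l1 l2) then show thesis using leaf assms(2) by (simp add: list_all2_Cons1, ((elim exE conjE)?, simp)?)
next
  case (ES_node l1 l2 t) then show thesis using node assms(2) by (simp add: list_all2_Cons1, ((elim exE conjE)?, simp)?)
qed

lemma decomp_NS:
  assumes "prodn (NS F) xs" "list_all2 sl xs ws"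
  obtains (nil) "xs = []" "ws = []"
    | (cons) t u v where "xs = [Inl (ES t), Inl (NS (insert t F))]" "ws = [u, v]" "EL t u"
  using assms(1)
proof cases
  case NS_Nil then show thesis using nil assms(2) by simp
next
  case (NS_Cons t) then show thesis using cons assms(2) by (simp add: list_all2_Cons1, ((elim exE conjE)?, simp)?)
qed

lemma decomp_PS:
  assumes "prodn (PS c d) xs" "list_all2 sl xs ws"
  obtains (one) l where "xs = [Inr l]" "ws = [[l]]"
    | (cons) l c' u v where "xs = [Inr l, Inl (NS {flip c, c'}), Inl (PS c' d)]" "ws = [[l], u, v]" "NL {flip c, c'} u" "PL c' d v"
  using assms(1)
proof cases
  case (PS_one l) then show thesis using one assms(2) by (simp add: list_all2_Cons1, ((elim exE conjE)?, simp)?)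
next
  case (PS_Cons l c') then show thesis using cons assms(2) by (simp add: list_all2_Cons1, ((elim exE conjE)?, simp)?)
qed

lemma decomp_WS:
  assumes "prodn (WS F) xs" "list_all2 sl xs ws"
  obtains (E) t u w where "xs = [Inl (ES t), Inl (WS (insert t F))]" "ws = [u, w]" "EL t u"
    | (V) w where "xs = [Inl (VS F)]" "ws = [w]" "VL F w"
  using assms(1)
proof cases
  case (WS_E t) then show thesis using E assms(2) by (simp add: list_all2_Cons1, ((elim exE conjE)?, simp)?)
next
  case WS_V then show thesis using V assms(2) by (simp add: list_all2_Cons1, ((elim exE conjE)?, simp)?)
qed

lemma decomp_VS:
  assumes "prodn (VS F) xs" "list_all2 sl xs ws"
  obtains (E) t w u where "xs = [Inl (VS (insert t F)), Inl (ES t)]" "ws = [w, u]" "EL t u"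
    | (layer) l1 l2 w where "xs = [Inr l1, Inl (WS {flip (dir l1)}), Inr l2]" "ws = [[l1], w, [l2]]" "WL {flip (dir l1)} w"
        "dir l2 = flip (dir l1)"
    | (P) c d w where "xs = [Inl (PS c d)]" "ws = [w]" "PL c d w" "flip d \<noteq> c"
  using assms(1)
proof cases
  case (VS_E t) then show thesis using E assms(2) by (simp add: list_all2_Cons1, ((elim exE conjE)?, simp)?)
next
  case (VS_layer l1 s l2) then show thesis using layer assms(2) by (simp add: list_all2_Cons1, ((elim exE conjE)?, simp)?)
next
  case (VS_P c d) then show thesis using P assms(2) by (simp add: list_all2_Cons1, ((elim exE conjE)?, simp)?)
qed

lemma decomp_Start:
  assumes "prodn Start xs" "list_all2 sl xs ws"
  obtains (nil) "xs = []" "ws = []"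
    | (two) l1 l2 where "xs = [Inr l1, Inr l2]" "ws = [[l1], [l2]]" "dir l2 = flip (dir l1)"
    | (c1) t t' u u' v where "xs = [Inl (ES t), Inl (ES t'), Inl (NS {t, t'})]" "ws = [u, u', v]" "EL t u" "EL t' u'" "NL {t, t'} v"
    | (c2) l1 t u v l2 where "xs = [Inr l1, Inl (ES t), Inl (NS {flip (dir l1), t}), Inr l2]" "ws = [[l1], u, v, [l2]]"
        "EL t u" "NL {flip (dir l1), t} v" "dir l2 = flip (dir l1)" "t \<noteq> flip (dir l1)"
    | (W) w where "xs = [Inl (WS {})]" "ws = [w]" "WL {} w"
  using assms(1)
proof cases
  case Start_Nil then show thesis using nil assms(2) by simp
next
  case (Start_two l2 l1) then show thesis using two assms(2) by (simp add: list_all2_Cons1, ((elim exE conjE)?, simp)?)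
next
  case (Start_closed1 t t') then show thesis using c1 assms(2) by (simp add: list_all2_Cons1, ((elim exE conjE)?, simp)?)
next
  case (Start_closed2 l1 s l2 t) then show thesis using c2 assms(2) by (simp add: list_all2_Cons1, ((elim exE conjE)?, simp)?)
next
  case Start_W then show thesis using W assms(2) by (simp add: list_all2_Cons1, ((elim exE conjE)?, simp)?)
qed

lemma node_unique:
  assumes "l1 # u @ v @ [l2] = l1' # u' @ v' @ [l2']" "EL t u" "EL t' u'"
  shows "l1 = l1' \<and> l2 = l2' \<and> t = t' \<and> u = u' \<and> v = v'"
proof -
  have "(u @ v) @ [l2] = (u' @ v') @ [l2']" using assms by simp
  then have e: "u @ v = u' @ v'" "l2 = l2'" by simp_all
  from EL_unique_prefix[OF assms(2,3) e(1)] show ?thesis using e assms(1) by simp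
qed

lemma unique_ES:
  assumes "prodn (ES s) xs" "prodn (ES s) xs'" "list_all2 sl xs ws" "list_all2 sl xs' ws'" "concat ws = concat ws'"
  shows "xs = xs' \<and> ws = ws'"
  using assms(1,3)
proof (cases rule: decomp_ES)
  case leaf: (leaf l1 l2)
  from assms(2,4) show ?thesis
  proof (cases rule: decomp_ES)
    case (leaf l1' l2') then show ?thesis using \<open>xs = _\<close> \<open>ws = _\<close> assms(5) by simp
  next
    case (node l1' t u v l2')
    then show ?thesis using leaf assms(5) EL_nonempty[OF node(3)] by (cases u) auto
  qed
next
  case node: (node l1 t u v l2)
  from assms(2,4) show ?thesis
  proof (cases rule: decomp_ES)
    case (leaf l1' l2')
    then show ?thesis using node assms(5) EL_nonempty[OF node(3)] by (cases u) auto
  next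
    case (node l1' t' u' v' l2')
    have "l1 # u @ v @ [l2] = l1' # u' @ v' @ [l2']" using assms(5) node \<open>ws = _\<close> by simp
    from node_unique[OF this \<open>EL t u\<close> node(3)] show ?thesis using node \<open>xs = _\<close> \<open>ws = _\<close> by simp
  qed
qed

lemma unique_NS:
  assumes "prodn (NS F) xs" "prodn (NS F) xs'" "list_all2 sl xs ws" "list_all2 sl xs' ws'" "concat ws = concat ws'"
  shows "xs = xs' \<and> ws = ws'"
  using assms(1,3)
proof (cases rule: decomp_NS)
  case nil
  from assms(2,4) show ?thesis
    by (cases rule: decomp_NS) (use nil assms(5) EL_nonempty in auto)
next
  case c: (cons t u v)
  from assms(2,4) show ?thesis
  proof (cases rule: decomp_NS)
    case nil then show ?thesis using c assms(5) EL_nonempty by auto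
  next
    case (cons t' u' v')
    have "u @ v = u' @ v'" using assms(5) c cons by simp
    from EL_unique_prefix[OF c(3) cons(3) this] show ?thesis using c cons by simp
  qed
qed

lemma PL_no_closed_prefix: "PL c d w \<Longrightarrow> no_closed_prefix w"
  unfolding no_closed_prefix_def using PL_prefix zero_notin_cone by metis
lemma PL_no_closed_suffix: "PL c d w \<Longrightarrow> no_closed_suffix w"
  unfolding no_closed_suffix_def using PL_suffix zero_notin_cone by (metis neg_equal_0_iff_equal)

lemma unique_PS:
  assumes "prodn (PS c d) xs" "prodn (PS c d) xs'" "list_all2 sl xs ws" "list_all2 sl xs' ws'" "concat ws = concat ws'"
  shows "xs = xs' \<and> ws = ws'"
proof -
  have ne: "v \<noteq> []" if "PL c' d v" for c' v using PL_facts[OF that] by simp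
  from assms(1,3) show ?thesis
  proof (cases rule: decomp_PS)
    case o: (one l)
    from assms(2,4) show ?thesis
    proof (cases rule: decomp_PS)
      case (one l') then show ?thesis using o assms(5) by simp
    next
      case (cons l' c' u v) then show ?thesis using o assms(5) ne[OF cons(4)] by simp
    qed
  next
    case c: (cons l c' u v)
    from assms(2,4) show ?thesis
    proof (cases rule: decomp_PS)
      case (one l') then show ?thesis using c assms(5) ne[OF c(4)] by simp
    next
      case (cons l' c2 u' v')
      have e: "l = l'" "u @ v = u' @ v'" using assms(5) c cons by simp_all
      have "u = u'" using closed_no_closed_prefix_unique[of u u' v v'] EL_NL_facts(2)[OF c(3)] EL_NL_facts(2)[OF cons(3)]
          PL_no_closed_prefix[OF c(4)] PL_no_closed_prefix[OF cons(4)] e(2) by simp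
      then have "v = v'" using e by simp
      moreover have "c' = c2" using PL_facts[OF c(4)] PL_facts[OF cons(4)] calculation by simp
      ultimately show ?thesis using c cons e \<open>u = u'\<close> by simp
    qed
  qed
qed

lemma unique_WS:
  assumes "prodn (WS F) xs" "prodn (WS F) xs'" "list_all2 sl xs ws" "list_all2 sl xs' ws'" "concat ws = concat ws'"
  shows "xs = xs' \<and> ws = ws'"
proof -
  have no: False if "EL t u" "VL F (u @ w)" for t u w
    using WL_VL_facts(2)[OF that(2)] EL_NL_facts(1)[OF that(1)] unfolding no_closed_prefix_def by blast
  from assms(1,3) show ?thesis
  proof (cases rule: decomp_WS)
    case e: (E t u w)
    from assms(2,4) show ?thesis
    proof (cases rule: decomp_WS)
      case (E t' u' w')
      have "u @ w = u' @ w'" using assms(5) e E by simp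
      from EL_unique_prefix[OF e(3) E(3) this] show ?thesis using e E by simp
    next
      case (V w') then show ?thesis using no[OF e(3), of w] e assms(5) by simp
    qed
  next
    case v: (V w)
    from assms(2,4) show ?thesis
    proof (cases rule: decomp_WS)
      case (E t' u' w') then show ?thesis using no[OF E(3), of w'] v assms(5) by simp
    next
      case (V w') then show ?thesis using v assms(5) by simp
    qed
  qed
qed

text \<open>A final excursion is a closed suffix, which layers and paths do not have; a layer ends
  with the reversal of its first direction, which \<open>VS_P\<close> forbids for paths.\<close>

lemma unique_VS:
  assumes "prodn (VS F) xs" "prodn (VS F) xs'" "list_all2 sl xs ws" "list_all2 sl xs' ws'" "concat ws = concat ws'"
  shows "xs = xs' \<and> ws = ws'"
proof -
  have noL: False if "EL t u" "WL {flip (dir l1)} w'" "dir l2 = flip (dir l1)" "w @ u = l1 # w' @ [l2]" for t u w w' l1 l2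
  proof -
    have "- hw u \<in> cone (dir l1)"
      by (rule layer_facts(2)[OF WL_VL_facts(1)[OF that(2)] refl that(3) that(4)[symmetric]]) (use EL_nonempty that(1) in blast)
    then show False using EL_NL_facts(1)[OF that(1)] by simp
  qed
  have noP: False if "EL t u" "PL c d w'" "w @ u = w'" for t u w w' c d
    using PL_no_closed_suffix[OF that(2)] that(3) EL_NL_facts(1)[OF that(1)] unfolding no_closed_suffix_def by blast
  have LP: False if "dir l2 = flip (dir l1)" "PL c d w'" "flip d \<noteq> c" "l1 # w @ [l2] = w'" for l1 l2 w c d w'
    using PL_facts[OF that(2)] that(1,3) unfolding that(4)[symmetric] by auto
  from assms(1,3) show ?thesis
  proof (cases rule: decomp_VS)
    case e: (E t w u)
    from assms(2,4) show ?thesis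
    proof (cases rule: decomp_VS)
      case (E t' w' u')
      have "w @ u = w' @ u'" using assms(5) e E by simp
      from EL_unique_suffix[OF e(3) E(3) this] show ?thesis using e E by simp
    next
      case (layer l1 l2 w') then show ?thesis using noL[OF e(3) layer(3,4), of w] e assms(5) by simp
    next
      case (P c d w') then show ?thesis using noP[OF e(3) P(3), of w] e assms(5) by simp
    qed
  next
    case l: (layer l1 l2 w)
    from assms(2,4) show ?thesis
    proof (cases rule: decomp_VS)
      case (E t' w' u') then show ?thesis using noL[OF E(3) l(3,4), of w'] l assms(5) by simp
    next
      case (layer l1' l2' w') then show ?thesis using l assms(5) by simp
    next
      case (P c d w') then show ?thesis using LP[OF l(4) P(3,4), of w] l assms(5) by simp
    qed
  next
    case p: (P c d w)
    from assms(2,4) show ?thesis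
    proof (cases rule: decomp_VS)
      case (E t' w' u') then show ?thesis using noP[OF E(3) p(3), of w'] p assms(5) by simp
    next
      case (layer l1' l2' w') then show ?thesis using LP[OF layer(4) p(3,4), of w'] p assms(5) by simp
    next
      case (P c' d' w')
      have "w = w'" using assms(5) p P by simp
      then show ?thesis using PL_facts[OF p(3)] PL_facts[OF P(3)] p P by simp
    qed
  qed
qed

text \<open>Closing up separates \<open>WL\<close> from the rest, length separates the short words,
  and the two closed shapes differ in whether the first excursion ends before the word does.\<close>

lemma unique_Start:
  assumes "prodn Start xs" "prodn Start xs'" "list_all2 sl xs ws" "list_all2 sl xs' ws'" "concat ws = concat ws'"
  shows "xs = xs' \<and> ws = ws'"
proof -
  have EL2: "2 \<le> length u" if "EL t u" for t u
    using that by (cases rule: EL.cases) auto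
  have WL0: "hw w \<noteq> 0" if "WL F w" for F w using WL_VL_facts(1)[OF that] unfolding avoids_def by blast
  have closed: "hw u = 0" if "EL t u" for t u using EL_NL_facts(1)[OF that] by simp
  have closedN: "hw u = 0" if "NL F u" for F u using EL_NL_facts(2)[OF that] by simp
  have no12: False if "EL t u" "EL t' u'" "EL t2 u2" "NL {flip (dir l1), t2} v2" "dir l2 = flip (dir l1)" "t2 \<noteq> flip (dir l1)"
    "u @ u' @ v = l1 # u2 @ v2 @ [l2]" for t u t' u' v t2 u2 v2 l1 l2
  proof -
    have "EL (dir l1) (l1 # (u2 @ v2) @ [l2])"
      using NL_two[OF that(6,3,4)] that(5) EL_nonempty[OF that(3)] by (intro EL_I) auto
    from EL_unique_prefix[OF that(1) this, of "u' @ v" "[]"] that(7) EL_nonempty[OF that(2)] show False by simp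
  qed
  show ?thesis
    using assms(1,3)
  proof (cases rule: decomp_Start)
    case nil
    from assms(2,4) show ?thesis
      by (cases rule: decomp_Start) (use nil assms(5) EL_nonempty WL0 in fastforce)+
  next
    case a: (two l1 l2)
    from assms(2,4) show ?thesis
    proof (cases rule: decomp_Start)
      case nil then show ?thesis using a assms(5) by simp
    next
      case (two l1' l2') then show ?thesis using a assms(5) by simp
    next
      case (c1 t t' u u' v)
      have "length (concat ws) = 2" "length (concat ws') \<ge> 4" using a c1 EL2[OF c1(3)] EL2[OF c1(4)] by simp_all
      then show ?thesis using assms(5) by simp
    next
      case (c2 l1' t u v l2')
      have "length (concat ws) = 2" "length (concat ws') \<ge> 4" using a c2 EL2[OF c2(3)] by simp_all
      then show ?thesis using assms(5) by simp
    next
      case (W w)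
      have "hw (concat ws) = 0" using a by simp
      then show ?thesis using WL0[OF W(3)] W assms(5) by simp
    qed
  next
    case a: (c1 t t' u u' v)
    have len: "length (concat ws) \<ge> 4" using a EL2[OF a(3)] EL2[OF a(4)] by simp
    have hw: "hw (concat ws) = 0" using a closed[OF a(3)] closed[OF a(4)] closedN[OF a(5)] by simp
    from assms(2,4) show ?thesis
    proof (cases rule: decomp_Start)
      case nil then show ?thesis using len assms(5) by simp
    next
      case (two l1' l2') then show ?thesis using len assms(5) by simp
    next
      case (c1 t2 t2' u2 u2' v2)
      have e: "u @ u' @ v = u2 @ u2' @ v2" using a c1 assms(5) by simp
      from EL_unique_prefix[OF a(3) c1(3) e] have 1: "t = t2" "u = u2" "u' @ v = u2' @ v2" by simp_all
      from EL_unique_prefix[OF a(4) c1(4) 1(3)] show ?thesis using 1 a c1 by simp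
    next
      case (c2 l1' t2 u2 v2 l2')
      have "u @ u' @ v = l1' # u2 @ v2 @ [l2']" using a c2 assms(5) by simp
      from no12[OF a(3,4) c2(3-6) this] show ?thesis ..
    next
      case (W w) then show ?thesis using hw WL0[OF W(3)] assms(5) by simp
    qed
  next
    case a: (c2 l1 t u v l2)
    have len: "length (concat ws) \<ge> 4" using a EL2[OF a(3)] by simp
    have hw: "hw (concat ws) = 0" using a closed[OF a(3)] closedN[OF a(4)] by simp
    from assms(2,4) show ?thesis
    proof (cases rule: decomp_Start)
      case nil then show ?thesis using len assms(5) by simp
    next
      case (two l1' l2') then show ?thesis using len assms(5) by simp
    next
      case (c1 t2 t2' u2 u2' v2)
      have "u2 @ u2' @ v2 = l1 # u @ v @ [l2]" using a c1 assms(5) by simp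
      from no12[OF c1(3,4) a(3-6) this] show ?thesis ..
    next
      case (c2 l1' t2 u2 v2 l2')
      have "l1 # u @ v @ [l2] = l1' # u2 @ v2 @ [l2']" using a c2 assms(5) by simp
      from node_unique[OF this a(3) c2(3)] show ?thesis using a c2 by simp
    next
      case (W w) then show ?thesis using hw WL0[OF W(3)] assms(5) by simp
    qed
  next
    case a: (W w)
    have hw: "hw (concat ws) \<noteq> 0" using a WL0[OF a(3)] by simp
    from assms(2,4) show ?thesis
    proof (cases rule: decomp_Start)
      case nil then show ?thesis using hw assms(5) by simp
    next
      case (two l1' l2') then show ?thesis using hw assms(5) by simp
    next
      case (c1 t2 t2' u2 u2' v2)
      then show ?thesis using hw assms(5) closed[OF c1(3)] closed[OF c1(4)] closedN[OF c1(5)] by simp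
    next
      case (c2 l1' t2 u2 v2 l2') then show ?thesis using hw assms(5) closed[OF c2(3)] closedN[OF c2(4)] by simp
    next
      case (W w') then show ?thesis using a assms(5) by simp
    qed
  qed
qed

lemma unique_production:
  assumes "prodn A xs" "prodn A xs'" "list_all2 sl xs ws" "list_all2 sl xs' ws'" "concat ws = concat ws'"
  shows "xs = xs' \<and> ws = ws'"
proof (cases A)
  case (ES s) then show ?thesis using unique_ES assms by blast
next
  case (NS F) then show ?thesis using unique_NS assms by blast
next
  case (PS c d) then show ?thesis using unique_PS assms by blast
next
  case (WS F) then show ?thesis using unique_WS assms by blast
next
  case (VS F) then show ?thesis using unique_VS assms by blast
next
  case Start then show ?thesis using unique_Start assms by blast
qed

lemma cfg_lang_prods: "cfg_lang prods Start = {w. conj_geo w}"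
proof -
  have "conj_geo w" if "t \<in> parse_trees prods Start w" for t w
  proof -
    have "sl (root t) (yield t)"
      by (rule ptree_sound[of prods]) (use lang_sound that in \<open>auto simp: prods_def parse_trees_def\<close>)
    then show ?thesis using that conj_geo_iff_SL by (simp add: parse_trees_def)
  qed
  moreover have "parse_trees prods Start w \<noteq> {}" if "conj_geo w" for w
    using that SL_derives conj_geo_iff_SL unfolding derives_def parse_trees_def by auto
  ultimately show ?thesis unfolding cfg_lang_def by blast
qed

lemma cfg_unambiguous_prods: "cfg_unambiguous prods Start"
  unfolding cfg_unambiguous_def
proof
  fix w assume "w \<in> cfg_lang prods Start"
  then obtain t where t: "t \<in> parse_trees prods Start w" unfolding cfg_lang_def by auto
  have "t' = t" if "t' \<in> parse_trees prods Start w" for t'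
  proof (rule ptree_unique[of prods lang])
    show "lang A (concat ws)" if "(A, xs) \<in> prods" "list_all2 sl xs ws" for A xs ws
      using lang_sound that by (simp add: prods_def)
    show "xs = xs' \<and> ws = ws'" if "(A, xs) \<in> prods" "(A, xs') \<in> prods" "list_all2 sl xs ws"
      "list_all2 sl xs' ws'" "concat ws = concat ws'" for A xs ws xs' ws'
      using unique_production that by (simp add: prods_def)
  qed (use t that in \<open>auto simp: parse_trees_def\<close>)
  then show "\<exists>!t. t \<in> parse_trees prods Start w" using t by blast
qed

lemma unambiguous_cfl_conj_geo: "inj g \<Longrightarrow> unambiguous_cfl (map g ` {w. conj_geo w})"
  using unambiguous_cfl_rename[OF finite_prods _ cfg_unambiguous_prods] by (simp add: cfg_lang_prods)

section \<open>The word problem\<close>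

text \<open>Used for tables on letters: their codes come from an enumeration that need not be
  computable, but there are only finitely many of them.\<close>

lemma computable_finite_support: "finite {n. f n \<noteq> (c :: nat)} \<Longrightarrow> computable f"
proof (induction "{n. f n \<noteq> c}" arbitrary: f rule: finite_induct)
  case empty
  then have "f = (\<lambda>n. c)" by auto
  then show ?case using computable_const by simp
next
  case (insert a F)
  have "F = {n. (f(a := c)) n \<noteq> c}" using insert(2,4) by auto
  from insert(3)[OF this] have 1: "computable (f(a := c))" .
  have "computable (\<lambda>n. if n = a then f a else (f(a := c)) n)"
    by (intro computable_if decidable_eq computable_intros 1)
  moreover have "(\<lambda>n. if n = a then f a else (f(a := c)) n) = f" by auto
  ultimately show ?case by simp
qed

lemma decidable_finite: "finite {n. P n} \<Longrightarrow> decidable_pred P"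
  unfolding decidable_pred_def by (rule computable_finite_support[where c = 0]) simp

section \<open>Coded paths and the coded form\<close>

definition gc :: "gen \<Rightarrow> nat" where
  "gc s = (if fst s then 2 else 0) + (if snd s then 1 else 0)"

definition cflip :: "nat \<Rightarrow> nat" where
  "cflip n = (if n = 0 then 1 else if n = 1 then 0 else if n = 2 then 3 else 2)"

lemma cflip_gc: "cflip (gc s) = gc (flip s)" by (simp add: cflip_def gc_def flip_def)
lemma gc_inject: "gc s = gc t \<longleftrightarrow> s = t"
  by (cases s; cases t) (auto simp: gc_def split: if_splits)

definition cg :: "gen list \<Rightarrow> nat" where "cg w = list_encode (map gc w)"

lemma cg_inject: "cg v = cg w \<longleftrightarrow> v = w"
  using list_encode_eq inj_map_eq_map[of gc] gc_inject by (metis cg_def injI)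
lemma list_decode_cg [simp]: "list_decode (cg w) = map gc w" by (simp add: cg_def)
lemma pcons_cg: "pcons (gc s) (cg w) = cg (s # w)" by (simp add: cg_def pcons_list_encode del: list_encode.simps)
lemma cg_Nil: "cg [] = 0" by (simp add: cg_def)

lemma computable_cflip: "computable f \<Longrightarrow> computable (\<lambda>x. cflip (f x))"
  unfolding cflip_def by (intro computable_intros decidable_intros)

text \<open>An integer height is kept as the pair of the numbers of upward steps (code 3) and
  downward steps (code 2).\<close>

definition cheights :: "nat \<Rightarrow> nat" where
  "cheights l = foldl (\<lambda>s g. if g = 3 then pair (Suc (pfst s)) (psnd s)
    else if g = 2 then pair (pfst s) (Suc (psnd s)) else s) (pair 0 0) (list_decode l)"

definition cstage :: "nat \<Rightarrow> nat \<Rightarrow> bool" where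
  "cstage s t \<longleftrightarrow> psnd s \<le> pfst s \<and> (pfst s - psnd s) + psnd t < pfst t \<and>
    halts_in (pfst s - psnd s) (pfst t - psnd t - (pfst s - psnd s) - 1)"

definition cchi :: "nat \<Rightarrow> nat" where
  "cchi l = psnd (foldl (\<lambda>s g. if g = 3 then pair (pair (Suc (pfst (pfst s))) (psnd (pfst s))) (psnd s)
    else if g = 2 then pair (pair (pfst (pfst s)) (Suc (psnd (pfst s)))) (psnd s)
    else if cstage (pfst s) (cheights l) then pair (pfst s) (Suc (psnd s)) else s) (pair (pair 0 0) 0) (list_decode l))"

text \<open>Paths are coded last letter first. The result is an unreduced word for the inverse of
  the position y times the position p, which suffices since \<open>chi\<close> can be read off any
  word.\<close>

definition cjoin :: "nat \<Rightarrow> nat \<Rightarrow> nat" where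
  "cjoin y p = foldl (\<lambda>s g. pcons (cflip g) s) (list_encode (rev (list_decode p)))
    (list_decode (list_encode (rev (list_decode y))))"

definition csum :: "nat \<Rightarrow> nat \<Rightarrow> nat" where
  "csum m p = foldl (\<lambda>s y. s + cchi (cjoin y p)) 0 (list_decode m)"

definition cred :: "nat \<Rightarrow> nat" where
  "cred y = foldl (\<lambda>s g. if s \<noteq> 0 \<and> pfst (s - 1) = cflip g then psnd (s - 1) else pcons g s) 0
    (list_decode (list_encode (rev (list_decode y))))"

lemma computable_cheights: "computable f \<Longrightarrow> computable (\<lambda>x. cheights (f x))"
  unfolding cheights_def by (intro computable_intros decidable_intros)

lemma decidable_cstage: "computable f \<Longrightarrow> computable g \<Longrightarrow> decidable_pred (\<lambda>x. cstage (f x) (g x))"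
  unfolding cstage_def by (intro computable_intros decidable_intros decidable_halts_in)

lemma computable_cchi: "computable f \<Longrightarrow> computable (\<lambda>x. cchi (f x))"
proof -
  have "computable cchi" unfolding cchi_def[abs_def]
    by (intro computable_comp[OF computable_psnd] computable_foldl computable_if decidable_cstage decidable_eq
        computable_cheights computable_intros)
  then show "computable f \<Longrightarrow> computable (\<lambda>x. cchi (f x))" by (rule computable_comp)
qed

lemma computable_cjoin: "computable f \<Longrightarrow> computable g \<Longrightarrow> computable (\<lambda>x. cjoin (f x) (g x))"
  unfolding cjoin_def by (intro computable_intros computable_cflip)

lemma computable_csum:
  assumes "computable f" "computable g" shows "computable (\<lambda>x. csum (f x) (g x))"
proof -
  have "computable (\<lambda>p. csum (pfst p) (psnd p))" unfolding csum_def
    by (intro computable_intros computable_cchi computable_cjoin)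
  from computable_comp[OF this computable_pairI[OF assms]] show ?thesis by simp
qed

lemma computable_cred: "computable f \<Longrightarrow> computable (\<lambda>x. cred (f x))"
  unfolding cred_def by (intro computable_intros decidable_intros computable_cflip)

lemma step_height_simps: "step_height (True, True) = 1" "step_height (True, False) = - 1" "step_height (False, b) = 0"
  by (simp_all add: step_height_def)

lemma cheights: "int (pfst (cheights (cg w))) - int (psnd (cheights (cg w))) = height w"
proof -
  have "int (pfst (foldl (\<lambda>s g. if g = 3 then pair (Suc (pfst s)) (psnd s)
    else if g = 2 then pair (pfst s) (Suc (psnd s)) else s) s (map gc w))) -
    int (psnd (foldl (\<lambda>s g. if g = 3 then pair (Suc (pfst s)) (psnd s)
    else if g = 2 then pair (pfst s) (Suc (psnd s)) else s) s (map gc w))) = int (pfst s) - int (psnd s) + height w" for s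
  proof (induction w arbitrary: s)
    case (Cons x w)
    obtain a b where "x = (a, b)" by (cases x)
    then show ?case using Cons by (cases a; cases b) (simp_all add: gc_def step_height_simps)
  qed simp
  from this[of "pair 0 0"] show ?thesis by (simp add: cheights_def)
qed

lemma cstage: "cstage s t \<longleftrightarrow> stage (int (pfst s) - int (psnd s)) (int (pfst t) - int (psnd t))"
proof (cases "psnd s \<le> pfst s \<and> (pfst s - psnd s) + psnd t < pfst t")
  case True
  have 1: "nat (int (pfst s) - int (psnd s)) = pfst s - psnd s" by simp
  have 2: "nat (int (pfst t) - int (psnd t) - (int (pfst s) - int (psnd s)) - 1) = pfst t - psnd t - (pfst s - psnd s) - 1"
    using True by linarith
  show ?thesis unfolding cstage_def stage_def 1 2 using True by linarith
next
  case False
  then show ?thesis unfolding cstage_def stage_def by linarith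
qed

lemma cchi: "of_nat (cchi (cg w)) = chi (gsum w)"
proof -
  let ?J = "cheights (cg w)"
  let ?f = "\<lambda>s g. if g = 3 then pair (pair (Suc (pfst (pfst s))) (psnd (pfst s))) (psnd s)
    else if g = 2 then pair (pair (pfst (pfst s)) (Suc (psnd (pfst s)))) (psnd s)
    else if cstage (pfst s) ?J then pair (pfst s) (Suc (psnd s)) else s"
  have "(of_nat (psnd (foldl ?f s (map gc v))) :: bit) =
      of_nat (psnd s) + chi_from (height w) (int (pfst (pfst s)) - int (psnd (pfst s))) v" for s v
  proof (induction v arbitrary: s)
    case (Cons x v)
    obtain a b where x: "x = (a, b)" by (cases x)
    consider "a" "b" | "a" "\<not> b" | "\<not> a" by blast
    then show ?case
    proof cases
      case 1
      then have "gc x = 3" "fst x" "step_height x = 1" using x by (simp_all add: gc_def step_height_simps)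
      then show ?thesis using Cons[of "pair (pair (Suc (pfst (pfst s))) (psnd (pfst s))) (psnd s)"]
        by (simp add: algebra_simps)
    next
      case 2
      then have "gc x = 2" "fst x" "step_height x = - 1" using x by (simp_all add: gc_def step_height_simps)
      then show ?thesis using Cons[of "pair (pair (pfst (pfst s)) (Suc (psnd (pfst s)))) (psnd s)"]
        by (simp add: algebra_simps)
    next
      case 3
      have st: "cstage (pfst s) ?J \<longleftrightarrow> stage (int (pfst (pfst s)) - int (psnd (pfst s))) (height w)"
        using cstage cheights by simp
      have g: "gc x \<noteq> 3" "gc x \<noteq> 2" using 3 x by (simp_all add: gc_def)
      then have "foldl ?f s (map gc (x # v)) = foldl ?f (if cstage (pfst s) ?J then pair (pfst s) (Suc (psnd s)) else s) (map gc v)"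
        by simp
      then show ?thesis using Cons[of "if cstage (pfst s) ?J then pair (pfst s) (Suc (psnd s)) else s"] 3 x st
        by (simp only:) (simp add: step_height_simps add.assoc add.left_commute add.commute)
    qed
  qed simp
  from this[of "pair (pair 0 0) 0" w] show ?thesis unfolding chi_gsum cchi_def by simp
qed

lemma gsum_map_flip: "gsum (map flip y) = - gsum (rev y)"
proof (induction y)
  case (Cons s y) then show ?case by (simp add: minus_add)
qed simp

lemma cjoin: "cjoin (cg y) (cg p) = cg (map flip y @ rev p)"
proof -
  have "foldl (\<lambda>s g. pcons (cflip g) s) (cg q) (map gc v) = cg (rev (map flip v) @ q)" for q v
    by (induction v arbitrary: q) (simp_all add: cflip_gc pcons_cg)
  from this[of "rev p" "rev y"] show ?thesis by (simp add: cjoin_def cg_def rev_map)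
qed

lemma cchi_cjoin: "of_nat (cchi (cjoin (cg y) (cg p))) = chi (- gsum (rev y) + gsum (rev p))"
  by (simp add: cjoin cchi gsum_map_flip)

definition cm :: "gen list list \<Rightarrow> nat" where "cm m = list_encode (map cg m)"

lemma csum: "of_nat (csum (cm m) (cg p)) = (\<Sum>y\<leftarrow>m. chi (- gsum (rev y) + gsum (rev p)))"
proof -
  have "(of_nat (foldl (\<lambda>s y. s + cchi (cjoin y (cg p))) s (map cg m)) :: bit) =
      of_nat s + (\<Sum>y\<leftarrow>m. chi (- gsum (rev y) + gsum (rev p)))" for s
    by (induction m arbitrary: s) (simp_all add: cchi_cjoin add.assoc)
  from this[of 0] show ?thesis by (simp add: csum_def cm_def)
qed

lemma cred: "cred (cg y) = cg (Rep_fg (gsum (rev y)))"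
proof -
  have "foldl (\<lambda>s g. if s \<noteq> 0 \<and> pfst (s - 1) = cflip g then psnd (s - 1) else pcons g s) (cg q) (map gc v) =
      cg (fold push v q)" for q v
  proof (induction v arbitrary: q)
    case (Cons s v)
    have "(if cg q \<noteq> 0 \<and> pfst (cg q - 1) = cflip (gc s) then psnd (cg q - 1) else pcons (gc s) (cg q)) = cg (push s q)"
    proof (cases q)
      case (Cons t q')
      have "cg q = Suc (pair (gc t) (cg q'))" using Cons pcons_cg[of t q'] by (simp add: pcons_def)
      moreover have "push s q = (if t = flip s then q' else s # q)" using Cons by simp
      ultimately show ?thesis using pcons_cg[of s q] by (auto simp: cflip_gc gc_inject)
    qed (simp add: cg_Nil pcons_cg[of s "[]", unfolded cg_Nil])
    then show ?case using Cons by simp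
  qed simp
  from this[of "[]" "rev y"] show ?thesis by (simp add: cred_def Rep_gsum cg_Nil rev_map)
qed

definition odds :: "gen list list \<Rightarrow> fg set" where
  "odds m = {x. odd (length (filter (\<lambda>y. gsum (rev y) = x) m))}"

lemma odds_Nil [simp]: "odds [] = {}" by (simp add: odds_def)
lemma odds_Cons: "odds (y # m) = sd {gsum (rev y)} (odds m)"
  by (auto simp: odds_def)
lemma finite_odds [simp]: "finite (odds m)" by (induction m) (simp_all add: odds_Cons)

lemma sum_odds: "(\<Sum>x \<in> odds m. \<phi> x) = (\<Sum>y\<leftarrow>m. \<phi> (gsum (rev y)) :: bit)"
  by (induction m) (simp_all add: odds_Cons sum_sd)

lemma odds_empty: "odds m = {} \<longleftrightarrow> (\<forall>y \<in> set m. even (length (filter (\<lambda>y'. gsum (rev y') = gsum (rev y)) m)))"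
proof
  assume "\<forall>y \<in> set m. even (length (filter (\<lambda>y'. gsum (rev y') = gsum (rev y)) m))"
  then have "even (length (filter (\<lambda>y'. gsum (rev y') = x) m))" for x
    by (cases "\<exists>y \<in> set m. gsum (rev y) = x") (auto simp: filter_empty_conv dest: arg_cong[of _ "[]" length])
  then show "odds m = {}" by (simp add: odds_def)
qed (auto simp: odds_def)

text \<open>Words are read from left to right; the state consists of the path walked so far, the list of
  all positions where a lamp was switched, and the accumulated central coordinate, counted in the
  natural numbers. Neither paths nor lamps are reduced before the end.\<close>
locale letter_code =
  fixes cl :: "letter \<Rightarrow> nat"
  assumes inj_cl: "inj cl"
begin

definition ltr :: "nat \<Rightarrow> letter" where "ltr n = inv_into UNIV cl n"

lemma ltr_cl [simp]: "ltr (cl l) = l" by (simp add: ltr_def inj_cl)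

definition is_ltr :: "nat \<Rightarrow> bool" where "is_ltr n \<longleftrightarrow> n \<in> range cl"
definition cpre :: "nat \<Rightarrow> bool" where "cpre n \<longleftrightarrow> is_ltr n \<and> pre (ltr n)"
definition cpost :: "nat \<Rightarrow> bool" where "cpost n \<longleftrightarrow> is_ltr n \<and> post (ltr n)"
definition ccen :: "nat \<Rightarrow> nat" where "ccen n = of_bool (is_ltr n \<and> cen (ltr n))"
definition cdir :: "nat \<Rightarrow> nat" where "cdir n = (if is_ltr n then gc (dir (ltr n)) else 0)"

lemma is_ltr_cl [simp]: "is_ltr (cl l)" by (simp add: is_ltr_def)

lemma finite_range_cl: "finite (range cl)" by (rule finite_imageI) (rule finite)

lemma letter_parts:
  "decidable_pred is_ltr" "decidable_pred cpre" "decidable_pred cpost" "computable ccen" "computable cdir"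
proof -
  have fin: "finite {n. Q n}" if "\<And>n. Q n \<Longrightarrow> is_ltr n" for Q
    by (rule finite_subset[OF _ finite_range_cl]) (use that in \<open>auto simp: is_ltr_def\<close>)
  show "decidable_pred is_ltr" "decidable_pred cpre" "decidable_pred cpost"
    by (rule decidable_finite, rule fin, simp add: cpre_def cpost_def)+
  show "computable ccen" "computable cdir"
    by (rule computable_finite_support[where c = 0], rule fin, simp add: ccen_def cdir_def split: if_splits)+
qed

text \<open>Both values of the form use the lamp list before the letter, because multiplication by a
  generator pairs the old configuration with the lamps of the letter, and not these with each
  other.\<close>

definition cstep :: "nat \<Rightarrow> nat \<Rightarrow> nat" where
  "cstep s n = pair (pcons (cdir n) (pfst s)) (pair
    (if cpost n then pcons (pcons (cdir n) (pfst s)) (if cpre n then pcons (pfst s) (pfst (psnd s)) else pfst (psnd s))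
      else if cpre n then pcons (pfst s) (pfst (psnd s)) else pfst (psnd s))
    (psnd (psnd s) + ccen n + (if cpre n then csum (pfst (psnd s)) (pfst s) else 0) +
      (if cpost n then csum (pfst (psnd s)) (pcons (cdir n) (pfst s)) else 0)))"

definition crun :: "nat \<Rightarrow> nat" where
  "crun x = foldl cstep (pair 0 (pair 0 0)) (list_decode x)"

lemma computable_crun: "computable f \<Longrightarrow> computable (\<lambda>x. crun (f x))"
proof -
  have "computable (\<lambda>p. cstep (pfst (psnd p)) (psnd (psnd p)))" unfolding cstep_def
    by (intro computable_intros1 computable_pcons computable_if computable_csum
        decidable_comp[OF letter_parts(2)] decidable_comp[OF letter_parts(3)]
        computable_comp[OF letter_parts(4)] computable_comp[OF letter_parts(5)])
  from computable_foldl[OF this computable_const computable_id]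
  have "computable crun" unfolding crun_def[abs_def] .
  then show "computable f \<Longrightarrow> computable (\<lambda>x. crun (f x))" by (rule computable_comp)
qed

lemma crun:
  "\<exists>m e. crun (list_encode (map cl w)) = pair (cg (rev (map dir w))) (pair (cm m) e) \<and> ev w = (odds m, hw w, of_nat e)"
proof (induction w rule: rev_induct)
  case Nil
  show ?case by (rule exI[of _ "[]"], rule exI[of _ 0]) (simp add: crun_def cg_Nil cm_def)
next
  case (snoc l w)
  then obtain m e where m: "crun (list_encode (map cl w)) = pair (cg (rev (map dir w))) (pair (cm m) e)"
    "ev w = (odds m, hw w, of_nat e)" by blast
  define p where "p = rev (map dir w)"
  define p' where "p' = dir l # p"
  have pos: "gsum (rev p) = hw w" "gsum (rev p') = hw w + gn (dir l)" by (simp_all add: hw_gsum p_def p'_def)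
  define m1 where "m1 = (if pre l then p # m else m)"
  define m2 where "m2 = (if post l then p' # m1 else m1)"
  define e2 where "e2 = e + of_bool (cen l) + (if pre l then csum (cm m) (cg p) else 0) + (if post l then csum (cm m) (cg p') else 0)"
  have cons: "pcons (cg y) (cm m) = cm (y # m)" for y m by (simp add: cm_def pcons_list_encode del: list_encode.simps)
  have p': "pcons (gc (dir l)) (cg p) = cg p'" by (simp add: pcons_cg p'_def)
  have "crun (list_encode (map cl (w @ [l]))) = cstep (crun (list_encode (map cl w))) (cl l)" by (simp add: crun_def)
  also have "\<dots> = pair (cg p') (pair (cm m2) e2)"
    unfolding m p_def[symmetric] cstep_def
    by (simp add: cpre_def cpost_def ccen_def cdir_def p' m1_def m2_def e2_def cons)
  finally have "crun (list_encode (map cl (w @ [l]))) = pair (cg (rev (map dir (w @ [l])))) (pair (cm m2) e2)"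
    by (simp add: p'_def p_def)
  moreover have "ev (w @ [l]) = (odds m2, hw (w @ [l]), of_nat e2)"
  proof -
    have "ev (w @ [l]) = ev w \<otimes>\<^bsub>Gam\<^esub> gl l" by (simp add: ev_append ev_Cons del: Gam_simps)
    also have "\<dots> = (sd (odds m) (tr (hw w) (lset l)), hw w + gn (dir l),
        of_nat e + of_bool (cen l) + beta (odds m) (tr (hw w) (lset l)))"
      by (simp add: m gl_def)
    also have "sd (odds m) (tr (hw w) (lset l)) = odds m2"
    proof -
      have "tr (hw w) (lset l) = (if pre l then {hw w} else {}) \<union> (if post l then {hw w + gn (dir l)} else {})"
        by (simp add: lset_alt tr_def image_Un)
      moreover have "hw w + gn (dir l) \<noteq> hw w" using add_left_imp_eq[of "hw w" "gn (dir l)" 0] by auto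
      moreover have "x \<in> odds (y # n) \<longleftrightarrow> (x = gsum (rev y)) \<noteq> (x \<in> odds n)" for x y n by (simp add: odds_Cons)
      ultimately have "x \<in> sd (odds m) (tr (hw w) (lset l)) \<longleftrightarrow> x \<in> odds m2" for x
        unfolding m2_def m1_def by (cases "pre l"; cases "post l"; cases "x = hw w"; cases "x = hw w + gn (dir l)") (simp_all add: pos)
      then show ?thesis by blast
    qed
    also have "beta (odds m) (tr (hw w) (lset l)) =
        (if pre l then of_nat (csum (cm m) (cg p)) else 0) + (if post l then of_nat (csum (cm m) (cg p')) else 0)"
      unfolding csum pos beta_def sum_tr sum_odds lset_alt
      by (cases "pre l"; cases "post l") (simp_all add: sum_list_addf)
    finally show ?thesis by (simp add: e2_def add.assoc)
  qed
  ultimately show ?case by blast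
qed

text \<open>The recursion from 1 with step \<open>1 - r\<close> tests for evenness. Lamps cancel
  when every recorded position occurs an even number of times, positions being compared by reduced
  words.\<close>

definition accepts :: "nat \<Rightarrow> bool" where
  "accepts x \<longleftrightarrow> (\<forall>n \<in> set (list_decode x). is_ltr n) \<and> cred (pfst (crun x)) = 0 \<and>
    rec_nat 1 (\<lambda>m r. 1 - r) (psnd (psnd (crun x))) = (1 :: nat) \<and>
    (\<forall>y \<in> set (list_decode (pfst (psnd (crun x)))).
      rec_nat 1 (\<lambda>m r. 1 - r) (foldl (\<lambda>s y'. if cred y' = cred y then Suc s else s) 0 (list_decode (pfst (psnd (crun x))))) = (1 :: nat))"

lemma decidable_accepts: "decidable_pred accepts"
  unfolding accepts_def
  by (intro decidable_intros computable_intros computable_cred computable_crun decidable_comp[OF letter_parts(1)])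

lemma rec_even: "rec_nat 1 (\<lambda>m r. 1 - r) n = (1 :: nat) \<longleftrightarrow> even n"
proof -
  have "rec_nat 1 (\<lambda>m r. 1 - r) n = (if even n then 1 else 0 :: nat)" by (induction n) auto
  then show ?thesis by simp
qed

lemma accepts_iff: "accepts x \<longleftrightarrow> (\<exists>w. x = list_encode (map cl w) \<and> ev w = \<one>\<^bsub>Gam\<^esub>)"
proof (cases "\<forall>n \<in> set (list_decode x). is_ltr n")
  case False
  then show ?thesis unfolding accepts_def by auto
next
  case True
  then have "map cl (map ltr (list_decode x)) = list_decode x"
    by (auto simp: is_ltr_def intro!: map_idI)
  then obtain w where w: "list_decode x = map cl w" by metis
  then have x: "x = list_encode (map cl w)" by (metis list_decode_inverse)
  obtain m e where m: "crun x = pair (cg (rev (map dir w))) (pair (cm m) e)" "ev w = (odds m, hw w, of_nat e)"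
    using crun x by metis
  have "cred (cg (rev (map dir w))) = 0 \<longleftrightarrow> hw w = 0"
    using cg_inject[of "Rep_fg (hw w)" "[]"] Rep_fg_inject[of "hw w" 0] by (simp add: cred hw_gsum Rep_zero cg_Nil)
  moreover have "foldl (\<lambda>s y'. if cred y' = cred (cg y) then Suc s else s) k (map cg m') =
      k + length (filter (\<lambda>y'. gsum (rev y') = gsum (rev y)) m')" for y k m'
    by (induction m' arbitrary: k) (simp_all add: cred cg_inject Rep_fg_inject)
  moreover have "even e \<longleftrightarrow> (of_nat e :: bit) = 0" by (induction e) auto
  ultimately have "accepts x \<longleftrightarrow> ev w = \<one>\<^bsub>Gam\<^esub>"
    using True unfolding accepts_def rec_even m by (auto simp: cm_def odds_empty)
  moreover have "\<And>w'. x = list_encode (map cl w') \<Longrightarrow> w' = w"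
    using x inj_cl by (metis inj_map_eq_map list_encode_eq)
  ultimately show ?thesis using x by blast
qed

end

section \<open>The conjugacy problem and the main theorem\<close>

definition plain :: "gen \<Rightarrow> letter" where "plain s = (False, s, False, False)"

lemma ev_plain: "ev (map plain w) = ({}, gsum w, 0)"
  by (induction w) (simp_all add: ev_Cons gl_def plain_def lset_def)

definition up :: gen where "up = (True, True)"
definition side :: gen where "side = (False, True)"

definition hook :: "nat \<Rightarrow> gen list" where
  "hook i = replicate i up @ [side] @ replicate i (flip up)"
definition hook_back :: "nat \<Rightarrow> gen list" where
  "hook_back i = replicate i up @ [flip side] @ replicate i (flip up)"

text \<open>Each lamp is switched by a step aside and back; the first such pair carries the mark b
  for the factor z.\<close>

definition test_word :: "bool \<Rightarrow> nat \<Rightarrow> letter list" where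
  "test_word b i = [(True, side, False, False), (False, flip side, False, b)] @ map plain (hook i) @
    [(True, side, False, False), (False, flip side, False, False)] @ map plain (hook_back i)"

lemma gsum_replicate_flip: "gsum (replicate i (flip s)) = - gsum (replicate i s)"
proof (induction i)
  case (Suc i)
  have "replicate (Suc i) s = replicate i s @ [s]" by (simp add: replicate_append_same)
  then have "gsum (replicate (Suc i) s) = gsum (replicate i s) + gn s" by (simp only: gsum_append) simp
  then show ?case using Suc by (simp only: minus_add uminus_gn) simp
qed simp

lemma gsum_hook_back: "gsum (hook_back i) = - gsum (hook i)"
  by (simp only: hook_def hook_back_def gsum_append gsum.simps gsum_replicate_flip minus_add uminus_gn
      minus_minus add.assoc add_0_right add_0_left)

lemma height_replicate: "height (replicate i s) = int i * step_height s"
  by (induction i) (simp_all add: algebra_simps)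

lemma height_hook [simp]: "height (hook i) = 0" "height (hook_back i) = 0"
  by (simp_all add: hook_def hook_back_def height_replicate up_def side_def flip_def step_height_def)

lemma chi_from_replicate: "fst s \<Longrightarrow> chi_from j k (replicate i s) = 0"
  by (induction i arbitrary: k) simp_all

lemma chi_from_hook: "chi_from j k (hook i) = of_bool (stage (k + int i) j)" "chi_from j k (hook_back i) = of_bool (stage (k + int i) j)"
  by (simp_all add: hook_def hook_back_def chi_from_append chi_from_replicate height_replicate up_def side_def flip_def step_height_def)

definition elevation :: "fg \<Rightarrow> int" where "elevation y = height (gword y)"

text \<open>In front of y the letter r is read at height i against the final height of y; the hook
  then returns to height 0, so y contributes as before.\<close>

lemma chi_hook_left: "chi (- gsum (hook i) + y) = of_bool (stage (int i) (elevation y)) + chi y"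
proof -
  have "- gsum (hook i) + y = gsum (hook_back i @ gword y)" by (simp add: gsum_hook_back)
  then show ?thesis
    by (simp only: chi_gsum height_append) (simp add: chi_from_append chi_from_hook chi_def elevation_def)
qed

text \<open>Behind \<open>- y\<close> the letter r is read i above the final height, where
  \<open>stage\<close> is false.\<close>

lemma chi_hook_right: "chi (- y + gsum (hook i)) = chi (- y)"
proof -
  have "- y + gsum (hook i) = gsum (gword (- y) @ hook i)" by simp
  then have "chi (- y + gsum (hook i)) = chi (- y) + of_bool (stage (elevation (- y) + int i) (elevation (- y)))"
    by (simp only: chi_gsum height_append) (simp add: chi_from_append chi_from_hook chi_def elevation_def)
  moreover have "\<not> stage (elevation (- y) + int i) (elevation (- y))" by (simp add: stage_def)
  ultimately show ?thesis by simp
qed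

lemma hook_nonzero: "gsum (hook i) \<noteq> 0"
proof
  assume "gsum (hook i) = 0"
  then have "gsum (replicate i up) + (gn side + - gsum (replicate i up)) = 0"
    by (simp add: hook_def gsum_replicate_flip)
  then have "gn side + - gsum (replicate i up) = - gsum (replicate i up)" by (metis minus_unique)
  from add_left_eq_self[OF this] show False by simp
qed

lemma ev_test_word:
  "ev (test_word b i) = ({0, gsum (hook i)}, 0, of_bool b + chi (gsum (hook i)))"
proof -
  have l: "ev [(True, side, False, False), (False, flip side, False, b)] = ({0}, 0, of_bool b)" for b
    by (simp add: ev_Cons gl_def lset_def)
  have t: "tr (gsum (hook i)) {0} = {gsum (hook i)}" by (simp add: tr_def)
  have s: "sd {0} {gsum (hook i)} = {0, gsum (hook i)}" using hook_nonzero[of i] by auto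
  have "ev (test_word b i) = ({0}, 0, of_bool b) \<otimes>\<^bsub>Gam\<^esub> (({}, gsum (hook i), 0) \<otimes>\<^bsub>Gam\<^esub> (({0}, 0, 0) \<otimes>\<^bsub>Gam\<^esub> ({}, - gsum (hook i), 0)))"
    unfolding test_word_def ev_append l ev_plain gsum_hook_back by simp
  then show ?thesis by (simp add: t s beta_def)
qed

text \<open>Moving a configuration past the two lamps costs the form in both orders, that is one
  halting condition for each of its positions. The factor z can be produced as soon as one condition
  holds.\<close>

lemma conjugate_test_words:
  "conjugate Gam (ev (test_word False i)) (ev (test_word True i)) \<longleftrightarrow> (\<exists>s. halts_in i s)"
proof -
  let ?g = "gsum (hook i)"
  let ?F = "{0, ?g}"
  \<comment> \<open>\<open>chi y\<close> and \<open>chi (- y)\<close> occur once for each of the two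
    lamps and cancel; only the stage term of the hook remains.\<close>
  have q: "(\<Sum>u \<in> ?F. chi (- y + u) + chi (- u + y)) = of_bool (stage (int i) (elevation y))" for y
    using hook_nonzero[of i] by (simp add: chi_hook_left chi_hook_right add.assoc add.left_commute[of "chi y"] add.left_commute[of "chi (- y)"])
  have B: "beta \<phi> ?F + beta ?F \<phi> = (\<Sum>y \<in> \<phi>. of_bool (stage (int i) (elevation y)))" if "finite \<phi>" for \<phi>
  proof -
    have "beta ?F \<phi> = (\<Sum>y \<in> \<phi>. \<Sum>u \<in> ?F. chi (- u + y))" unfolding beta_def by (rule sum.swap)
    then have "beta \<phi> ?F + beta ?F \<phi> = (\<Sum>y \<in> \<phi>. \<Sum>u \<in> ?F. chi (- y + u) + chi (- u + y))"
      unfolding beta_def sum.distrib by simp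
    then show ?thesis unfolding q .
  qed
  show ?thesis
  proof
    assume "conjugate Gam (ev (test_word False i)) (ev (test_word True i))"
    then obtain g where g: "g \<in> carrier Gam" "g \<otimes>\<^bsub>Gam\<^esub> ev (test_word True i) = ev (test_word False i) \<otimes>\<^bsub>Gam\<^esub> g"
      unfolding conjugate_iff by blast
    obtain \<phi> k d where \<phi>: "g = (\<phi>, k, d)" by (metis prod_cases3)
    have fin: "finite \<phi>" and lamps: "sd \<phi> (tr k ?F) = sd ?F \<phi>"
      and cen: "d + (1 + chi ?g) + beta \<phi> (tr k ?F) = chi ?g + d + beta ?F \<phi>"
      using g unfolding \<phi> ev_test_word by simp_all
    \<comment> \<open>Adding the conjugator's own lamps to both sides leaves this, so its position
      has no influence on the form.\<close>
    have "tr k ?F = ?F"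
    proof -
      have "sd \<phi> (sd \<phi> (tr k ?F)) = sd \<phi> (sd \<phi> ?F)" using lamps by (simp add: sd_commute)
      then show ?thesis by (simp add: sd_assoc[symmetric])
    qed
    then have c: "d + (1 + chi ?g) + beta \<phi> ?F = chi ?g + d + beta ?F \<phi>" using cen by simp
    have "beta \<phi> ?F + beta ?F \<phi> = 1"
      using c by (cases d; cases "chi ?g"; cases "beta \<phi> ?F"; cases "beta ?F \<phi>") simp_all
    then have "(\<Sum>y \<in> \<phi>. of_bool (stage (int i) (elevation y)) :: bit) \<noteq> 0" using B[OF fin] by simp
    then obtain y where "stage (int i) (elevation y)"
      by (metis (mono_tags, lifting) of_bool_eq(1) sum.neutral)
    then show "\<exists>s. halts_in i s" unfolding stage_def by auto
  next
    assume "\<exists>s. halts_in i s"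
    then obtain s where s: "halts_in i s" ..
    \<comment> \<open>A single lamp at height \<open>i + s + 1\<close>, the final height that
      decodes to machine i and computation s.\<close>
    define y where "y = gsum (replicate (i + s + 1) up)"
    have "elevation y = int (i + s + 1)"
      unfolding elevation_def y_def height_gword_gsum height_replicate by (simp add: up_def step_height_def)
    then have st: "stage (int i) (elevation y)" using s by (simp add: stage_def)
    have "({y}, 0, 0) \<otimes>\<^bsub>Gam\<^esub> ev (test_word True i) = ev (test_word False i) \<otimes>\<^bsub>Gam\<^esub> ({y}, 0, 0)"
    proof -
      have b: "beta {y} ?F + beta ?F {y} = 1" using B[of "{y}"] st by simp
      have "1 + chi ?g + beta {y} ?F = chi ?g + beta ?F {y}"
        using b by (cases "chi ?g"; cases "beta {y} ?F"; cases "beta ?F {y}") simp_all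
      then show ?thesis unfolding ev_test_word by (simp add: sd_commute)
    qed
    then show "conjugate Gam (ev (test_word False i)) (ev (test_word True i))"
      unfolding conjugate_iff using ev_carrier by (metis Gam_simps(1) finite.emptyI finite.insertI)
  qed
qed

lemma gl_inverse: "\<exists>l'. gl l' \<otimes>\<^bsub>Gam\<^esub> gl l = \<one>\<^bsub>Gam\<^esub>"
proof -
  let ?A = "tr (gn (flip (dir l))) (lset l)"
  have "?A \<subseteq> {0, gn (flip (dir l))}" using lset_subset[of l] unfolding tr_def by (auto dest!: subsetD)
  then obtain l0 where l0: "dir l0 = flip (dir l)" "lset l0 = ?A" using ex_letter by blast
  \<comment> \<open>The mark offsets both the central coordinate of l and the form of the lamp set
    with itself.\<close>
  define b where "b = (of_bool (cen l) + beta ?A ?A = 1)"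
  let ?l = "(pre l0, dir l0, post l0, b)"
  have "lset ?l = ?A" using l0 by (simp add: lset_def)
  moreover have "of_bool b = of_bool (cen l) + beta ?A ?A" unfolding b_def by (cases "of_bool (cen l) + beta ?A ?A") simp_all
  ultimately have "gl ?l \<otimes>\<^bsub>Gam\<^esub> gl l = \<one>\<^bsub>Gam\<^esub>" using l0 by (simp add: gl_def add.assoc add.commute add.left_commute)
  then show ?thesis ..
qed

section \<open>Transport to a group of natural numbers\<close>

lemma countable_Gam: "countable (carrier Gam)"
proof -
  have "carrier Gam \<subseteq> range ev" using ev_surj by blast
  then show ?thesis by (rule countable_subset) simp
qed

definition enc :: "gel \<Rightarrow> nat" where "enc = to_nat_on (carrier Gam)"
definition dec :: "nat \<Rightarrow> gel" where "dec = inv_into (carrier Gam) enc"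

lemma inj_enc: "inj_on enc (carrier Gam)"
  unfolding enc_def using countable_Gam by (rule inj_on_to_nat_on)
lemma dec_enc [simp]: "x \<in> carrier Gam \<Longrightarrow> dec (enc x) = x"
  unfolding dec_def using inj_enc by simp
lemma enc_inject: "x \<in> carrier Gam \<Longrightarrow> y \<in> carrier Gam \<Longrightarrow> enc x = enc y \<longleftrightarrow> x = y"
  using inj_enc by (auto simp: inj_on_def)

text \<open>The group transported to a set of natural numbers; the coding need not be computable, since the
  decision problems only see words in the generators.\<close>
definition GN :: "nat monoid" where
  "GN = \<lparr>carrier = enc ` carrier Gam, monoid.mult = (\<lambda>x y. enc (dec x \<otimes>\<^bsub>Gam\<^esub> dec y)), one = enc \<one>\<^bsub>Gam\<^esub>\<rparr>"

lemma carrier_GN: "carrier GN = enc ` carrier Gam" by (simp add: GN_def)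
lemma one_GN: "\<one>\<^bsub>GN\<^esub> = enc \<one>\<^bsub>Gam\<^esub>" by (simp add: GN_def)
lemma mult_GN: "x \<in> carrier Gam \<Longrightarrow> y \<in> carrier Gam \<Longrightarrow> enc x \<otimes>\<^bsub>GN\<^esub> enc y = enc (x \<otimes>\<^bsub>Gam\<^esub> y)"
  by (simp add: GN_def)

lemma group_GN: "group GN"
proof (rule groupI)
  fix x assume "x \<in> carrier GN"
  then obtain x' where x: "x = enc x'" "x' \<in> carrier Gam" by (auto simp: carrier_GN)
  have "enc (inv\<^bsub>Gam\<^esub> x') \<otimes>\<^bsub>GN\<^esub> x = \<one>\<^bsub>GN\<^esub>"
    using x by (simp add: mult_GN one_GN del: Gam_simps)
  then show "\<exists>y \<in> carrier GN. y \<otimes>\<^bsub>GN\<^esub> x = \<one>\<^bsub>GN\<^esub>" using x by (auto simp: carrier_GN simp del: Gam_simps)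
  show "\<one>\<^bsub>GN\<^esub> \<otimes>\<^bsub>GN\<^esub> x = x" using x by (simp add: mult_GN one_GN del: Gam_simps)
next
  show "\<one>\<^bsub>GN\<^esub> \<in> carrier GN" by (simp add: carrier_GN one_GN del: Gam_simps)
next
  fix x y assume "x \<in> carrier GN" "y \<in> carrier GN"
  then show "x \<otimes>\<^bsub>GN\<^esub> y \<in> carrier GN" by (auto simp: carrier_GN mult_GN simp del: Gam_simps)
next
  fix x y z assume "x \<in> carrier GN" "y \<in> carrier GN" "z \<in> carrier GN"
  then show "x \<otimes>\<^bsub>GN\<^esub> y \<otimes>\<^bsub>GN\<^esub> z = x \<otimes>\<^bsub>GN\<^esub> (y \<otimes>\<^bsub>GN\<^esub> z)"
    by (auto simp: carrier_GN mult_GN Gam.m_assoc simp del: Gam_simps)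
qed

interpretation GN: group GN by (rule group_GN)

lemma inv_GN: "x \<in> carrier Gam \<Longrightarrow> inv\<^bsub>GN\<^esub> (enc x) = enc (inv\<^bsub>Gam\<^esub> x)"
  by (rule GN.inv_equality) (simp_all add: carrier_GN mult_GN one_GN del: Gam_simps)

lemma conjugate_GN:
  assumes "x \<in> carrier Gam" "y \<in> carrier Gam"
  shows "conjugate GN (enc x) (enc y) \<longleftrightarrow> conjugate Gam x y"
proof -
  have "enc y = inv\<^bsub>GN\<^esub> (enc g) \<otimes>\<^bsub>GN\<^esub> enc x \<otimes>\<^bsub>GN\<^esub> enc g \<longleftrightarrow> y = inv\<^bsub>Gam\<^esub> g \<otimes>\<^bsub>Gam\<^esub> x \<otimes>\<^bsub>Gam\<^esub> g"
    if "g \<in> carrier Gam" for g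
    using that assms by (simp add: inv_GN mult_GN enc_inject del: Gam_simps)
  then show ?thesis unfolding conjugate_def using assms by (auto simp: carrier_GN)
qed

definition cl :: "letter \<Rightarrow> nat" where "cl l = enc (gl l)"

lemma inj_letter_cl: "inj cl"
  using inj_gl enc_inject by (auto simp: inj_def cl_def)

interpretation letter_code cl by unfold_locales (rule inj_letter_cl)

lemma word_eval_GN: "word_eval GN (map cl w) = enc (ev w)"
  by (induction w) (simp_all add: word_eval_def one_GN ev_Cons cl_def mult_GN del: Gam_simps)

lemma lists_range_cl: "lists (range cl) = range (map cl)"
proof
  show "lists (range cl) \<subseteq> range (map cl)"
  proof
    fix w assume "w \<in> lists (range cl)"
    then have "map cl (map ltr w) = w" by (induction w) auto
    then show "w \<in> range (map cl)" by (metis rangeI)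
  qed
qed auto

lemma word_length_GN:
  "word_length GN (range cl) (enc (ev v)) = (LEAST n. \<exists>w. length w = n \<and> ev w = ev v)"
proof -
  have "(\<exists>w \<in> lists (range cl). length w = n \<and> word_eval GN w = enc (ev v)) \<longleftrightarrow> (\<exists>w. length w = n \<and> ev w = ev v)" for n
    unfolding lists_range_cl by (auto simp: word_eval_GN enc_inject)
  then show ?thesis unfolding word_length_def by simp
qed

text \<open>An infimum of naturals over a nonempty set is attained, and every conjugate is the value
  of some word; so comparison with word lengths of conjugates is comparison with all words for
  conjugates.\<close>

lemma ConjGeo_GN: "ConjGeo GN (range cl) = map cl ` {w. conj_geo w}"
proof -
  have "length v = (INF h \<in> {h \<in> carrier GN. conjugate GN h (word_eval GN (map cl v))}. word_length GN (range cl) h) \<longleftrightarrow> conj_geo v" for v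
  proof -
    let ?M = "word_length GN (range cl) ` {h \<in> carrier GN. conjugate GN h (word_eval GN (map cl v))}"
    define len where "len w = (LEAST n. \<exists>w'. length w' = n \<and> ev w' = ev w)" for w
    have len_le: "len w \<le> length w" for w unfolding len_def by (rule Least_le) blast
    have len_ex: "\<exists>w'. length w' = len w \<and> ev w' = ev w" for w
      unfolding len_def by (rule LeastI[of "\<lambda>n. \<exists>w'. length w' = n \<and> ev w' = ev w" "length w"]) blast
    have M: "?M = {len w | w. conjugate Gam (ev w) (ev v)}"
    proof
      show "?M \<subseteq> {len w | w. conjugate Gam (ev w) (ev v)}"
      proof
        fix k assume "k \<in> ?M"
        then obtain x where x: "x \<in> carrier Gam" "conjugate GN (enc x) (enc (ev v))" "k = word_length GN (range cl) (enc x)"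
          by (auto simp: carrier_GN word_eval_GN)
        obtain w where w: "ev w = x" using ev_surj x(1) by blast
        then show "k \<in> {len w | w. conjugate Gam (ev w) (ev v)}"
          using x conjugate_GN[of "ev w" "ev v"] word_length_GN[of w] by (auto simp: len_def)
      qed
      show "{len w | w. conjugate Gam (ev w) (ev v)} \<subseteq> ?M"
      proof
        fix k assume "k \<in> {len w | w. conjugate Gam (ev w) (ev v)}"
        then obtain w where w: "conjugate Gam (ev w) (ev v)" "k = len w" by blast
        show "k \<in> ?M"
          by (rule image_eqI[of _ _ "enc (ev w)"])
            (use w conjugate_GN[of "ev w" "ev v"] word_length_GN[of w] in \<open>auto simp: len_def carrier_GN word_eval_GN\<close>)
      qed
    qed
    have refl: "conjugate Gam (ev v) (ev v)" using conjugate_rotate[of v "[]"] by simp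
    have v: "len v \<in> ?M" unfolding M using refl by blast
    show ?thesis
    proof
      assume e: "length v = Inf ?M"
      show "conj_geo v" unfolding conj_geo_def
      proof (intro allI impI)
        fix w assume "conjugate Gam (ev w) (ev v)"
        then have "len w \<in> ?M" unfolding M by blast
        then have "Inf ?M \<le> len w" by (intro cInf_lower) auto
        then show "length v \<le> length w" using e len_le[of w] by linarith
      qed
    next
      assume c: "conj_geo v"
      have "length v \<le> k" if "k \<in> ?M" for k
      proof -
        obtain w where w: "conjugate Gam (ev w) (ev v)" "k = len w" using \<open>k \<in> ?M\<close> unfolding M by blast
        obtain w' where "length w' = len w" "ev w' = ev w" using len_ex by blast
        then show ?thesis using c w unfolding conj_geo_def by metis
      qed
      then have "length v \<le> Inf ?M" using v by (intro cInf_greatest) auto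
      moreover have "Inf ?M \<le> len v" using v by (intro cInf_lower) auto
      ultimately show "length v = Inf ?M" using len_le[of v] by linarith
    qed
  qed
  then show ?thesis unfolding ConjGeo_def lists_range_cl by auto
qed

lemma generate_GN: "generate GN (range cl) = carrier GN"
proof
  have "range cl \<subseteq> carrier GN" by (auto simp: cl_def carrier_GN)
  then show "generate GN (range cl) \<subseteq> carrier GN" by (rule GN.generate_incl)
  show "carrier GN \<subseteq> generate GN (range cl)"
  proof
    fix x assume "x \<in> carrier GN"
    then obtain x' where x': "x = enc x'" "x' \<in> carrier Gam" unfolding carrier_GN by blast
    obtain w where "ev w = x'" using ev_surj[OF x'(2)] by blast
    then have "x = word_eval GN (map cl w)" using x' by (simp add: word_eval_GN)
    moreover have "word_eval GN (map cl w) \<in> generate GN (range cl)" for w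
      by (induction w) (auto simp: word_eval_def intro: generate.one generate.eng generate.incl)
    ultimately show "x \<in> generate GN (range cl)" by simp
  qed
qed

lemma inv_closed_cl: "s \<in> range cl \<Longrightarrow> inv\<^bsub>GN\<^esub> s \<in> range cl"
proof -
  assume "s \<in> range cl"
  then obtain l where s: "s = cl l" by auto
  obtain l' where "gl l' \<otimes>\<^bsub>Gam\<^esub> gl l = \<one>\<^bsub>Gam\<^esub>" using gl_inverse by blast
  then have "inv\<^bsub>Gam\<^esub> (gl l) = gl l'" by (intro Gam.inv_equality) simp_all
  then show ?thesis using s by (simp add: cl_def inv_GN)
qed

lemma decidable_word_problem: "decidable_set (word_problem_set GN (range cl))"
proof -
  have "word_problem_set GN (range cl) = {x. accepts x}"
    unfolding word_problem_set_def accepts_iff lists_range_cl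
    by (auto simp: word_eval_GN one_GN enc_inject simp del: Gam_simps)
  then show ?thesis using decidable_accepts
    unfolding decidable_set_def decidable_pred_def computable_def by simp
qed

text \<open>Halting reduces to it by sending i to the pair of test words. This map is computable:
  letter codes are fixed constants, and powers of u are added by recursion.\<close>

lemma undecidable_conj_problem: "\<not> decidable_set (conj_problem_set GN (range cl))"
proof
  assume "decidable_set (conj_problem_set GN (range cl))"
  then have d: "decidable_pred (\<lambda>x. x \<in> conj_problem_set GN (range cl))"
    unfolding decidable_set_def decidable_pred_def computable_def by simp
  let ?c = "\<lambda>b i. list_encode (map cl (test_word b i))"
  have rep: "rec_nat c (\<lambda>_ s. pcons k s) i = list_encode (replicate i k @ list_decode c)" for c k i
    by (induction i) (simp_all add: pcons_list_encode del: list_encode.simps)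
  \<comment> \<open>The code is built from the end of the word, with one recursion for each block of
    equal letters.\<close>
  have code: "?c b i = pcons (cl (True, side, False, False)) (pcons (cl (False, flip side, False, b))
      (rec_nat (pcons (cl (plain side)) (rec_nat (pcons (cl (True, side, False, False))
        (pcons (cl (False, flip side, False, False)) (rec_nat (pcons (cl (plain (flip side)))
          (rec_nat 0 (\<lambda>_ s. pcons (cl (plain (flip up))) s) i)) (\<lambda>_ s. pcons (cl (plain up)) s) i)))
        (\<lambda>_ s. pcons (cl (plain (flip up))) s) i)) (\<lambda>_ s. pcons (cl (plain up)) s) i))" for b i
    unfolding rep by (simp add: test_word_def hook_def hook_back_def pcons_list_encode del: list_encode.simps)
  have "computable (\<lambda>i. ?c b i)" for b
    unfolding code by (intro computable_intros)
  then have "computable (\<lambda>i. pair (?c False i) (?c True i))" by (intro computable_intros)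
  from decidable_comp[OF d this]
  have "decidable_pred (\<lambda>i. pair (?c False i) (?c True i) \<in> conj_problem_set GN (range cl))" .
  moreover have "pair (?c False i) (?c True i) \<in> conj_problem_set GN (range cl) \<longleftrightarrow> (\<exists>s. halts_in i s)" for i
  proof -
    have "pair (?c False i) (?c True i) \<in> conj_problem_set GN (range cl) \<longleftrightarrow>
        conjugate GN (enc (ev (test_word False i))) (enc (ev (test_word True i)))"
      unfolding conj_problem_set_def pair_def lists_range_cl
      by (auto simp: word_eval_GN list_encode_eq simp del: Gam_simps list_encode.simps)
    then show ?thesis using conjugate_GN conjugate_test_words by simp
  qed
  ultimately show False using undecidable_halting by simp
qed

theorem mainTheorem1:
  shows "\<exists>(G :: nat monoid) (S :: nat set).
     group G \<and> finite S \<and> S \<subseteq> carrier G \<and> (\<forall>s \<in> S. inv\<^bsub>G\<^esub> s \<in> S) \<and>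
     generate G S = carrier G \<and>
     decidable_set (word_problem_set G S) \<and>
     \<not> decidable_set (conj_problem_set G S) \<and>
     unambiguous_cfl (ConjGeo G S)"
proof (intro exI conjI)
  show "group GN" by (rule group_GN)
  show "finite (range cl)" by (rule finite_range_cl)
  show "range cl \<subseteq> carrier GN" by (auto simp: cl_def carrier_GN)
  show "\<forall>s \<in> range cl. inv\<^bsub>GN\<^esub> s \<in> range cl" using inv_closed_cl by blast
  show "generate GN (range cl) = carrier GN" by (rule generate_GN)
  show "decidable_set (word_problem_set GN (range cl))" by (rule decidable_word_problem)
  show "\<not> decidable_set (conj_problem_set GN (range cl))" by (rule undecidable_conj_problem)
  show "unambiguous_cfl (ConjGeo GN (range cl))"
    unfolding ConjGeo_GN using inj_cl by (rule unambiguous_cfl_conj_geo)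
qed

end
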